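(* Suppose that $q\in\Omega$ is an $\Omega$-local minimizer of $J$, and let $B$ be a $C^1$ neighborhood of $q$ contained in $\Omega$ such that $J(q)\le J(\tilde q)$ for every $\tilde q\in B$. If $q_0\in B$ satisfies $J(q_0)=J(q)$ and $Tq_0(\tau)=Tq(\tau)$ for some $\tau\in(0,T)$, then $q_0\equiv q$ on $[0,T]$.
   Context: $Q$ is a complete connected Riemannian manifold, $\frac{D}{dt}$ is the covariant derivative along a curve for the Levi-Civita connection, and $V:Q\to\mathbb{R}$ is smooth and non-negative. Fix $T>0$ and $\xi=(q_a,v_a),\eta=(q_b,v_b)\in TQ$. $\Omega=\Omega_{\xi,\eta}^{0,T}$ is the set of piecewise smooth $C^1$ curves $\gamma:[0,T]\to Q$ with $\gamma(0)=q_a$, $\dot\gamma(0)=v_a$, $\gamma(T)=q_b$, $\dot\gamma(T)=v_b$. The functional is $J(q)=\int_0^T\big(\tfrac12\|\tfrac{D}{dt}\dot q(t)\|^2+V(q(t))\big)dt$. An $\Omega$-local minimizer of $J$ is a curve $q\in\Omega$ with $J(q)\le J(\tilde q)$ for all $\tilde q$ in some $C^1$ neighborhood of $q$ within $\Omega$. $Tq:[0,T]\to TQ$ denotes the tangent lift of $q$, i.e. $Tq(t)=(q(t),\dot q(t))$.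
   Formalization: The C^1 neighborhood B is taken to be a tube: all curves in Ω whose tangent lifts have graphs in a fixed open subset of [0,T]×TQ containing the graph of Tq; for arbitrary C^1 neighborhoods (e.g. a union of small balls around two minimizers) the claim fails. *)

theory Defs
  imports "HOL-Analysis.Analysis"
begin

section \<open>Smooth maps between Euclidean spaces\<close>

text \<open>
  Derivatives are taken within \<open>S\<close>. The definition is only used for sets \<open>S\<close> on which these
  derivatives are unique: open sets, and relatively open subsets of intervals (where it
  means one-sided smoothness at the endpoints).
\<close>

primrec ck_on :: "nat \<Rightarrow> 'a::euclidean_space set \<Rightarrow> ('a \<Rightarrow> 'b::real_normed_vector) \<Rightarrow> bool" where
  "ck_on 0 S f \<longleftrightarrow> continuous_on S f"
| "ck_on (Suc k) S f \<longleftrightarrow> f differentiable_on S \<and>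
     (\<forall>v. ck_on k S (\<lambda>x. frechet_derivative f (at x within S) v))"

definition smooth_on :: "'a::euclidean_space set \<Rightarrow> ('a \<Rightarrow> 'b::real_normed_vector) \<Rightarrow> bool" where
  "smooth_on S f \<longleftrightarrow> (\<forall>k. ck_on k S f)"

section \<open>Smooth manifolds and tangent vectors\<close>

text \<open>A chart is a pair of its domain and its coordinate map.\<close>

type_synonym ('q, 'e) chart = "'q set \<times> ('q \<Rightarrow> 'e)"

definition chart_inv :: "('q, 'e) chart \<Rightarrow> 'e \<Rightarrow> 'q" where
  "chart_inv \<kappa> = inv_into (fst \<kappa>) (snd \<kappa>)"

definition transition :: "('q, 'e) chart \<Rightarrow> ('q, 'e) chart \<Rightarrow> 'e \<Rightarrow> 'e" where
  "transition \<kappa> \<kappa>' = snd \<kappa>' \<circ> chart_inv \<kappa>"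

definition smooth_atlas :: "('q::topological_space, 'e::euclidean_space) chart set \<Rightarrow> bool" where
  "smooth_atlas A \<longleftrightarrow>
     (\<forall>\<kappa>\<in>A. open (fst \<kappa>) \<and> open (snd \<kappa> ` fst \<kappa>) \<and>
        homeomorphism (fst \<kappa>) (snd \<kappa> ` fst \<kappa>) (snd \<kappa>) (chart_inv \<kappa>)) \<and>
     (\<Union>\<kappa>\<in>A. fst \<kappa>) = UNIV \<and>
     (\<forall>\<kappa>\<in>A. \<forall>\<kappa>'\<in>A. smooth_on (snd \<kappa> ` (fst \<kappa> \<inter> fst \<kappa>')) (transition \<kappa> \<kappa>'))"

definition smooth_function ::
  "('q::topological_space, 'e::euclidean_space) chart set \<Rightarrow> ('q \<Rightarrow> real) \<Rightarrow> bool" where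
  "smooth_function A V \<longleftrightarrow> (\<forall>\<kappa>\<in>A. smooth_on (snd \<kappa> ` fst \<kappa>) (V \<circ> chart_inv \<kappa>))"

text \<open>
  A tangent vector at \<open>p\<close> is the family of its coordinate vectors in the charts of the atlas
  around \<open>p\<close>, related by the differentials of the transition maps. Its value at every other
  argument is fixed to be 0, so that equality of tangent vectors is equality of functions.
\<close>

type_synonym ('q, 'e) tvec = "('q, 'e) chart \<Rightarrow> 'e"

definition tangent_space ::
  "('q, 'e::euclidean_space) chart set \<Rightarrow> 'q \<Rightarrow> ('q, 'e) tvec set" where
  "tangent_space A p = {v.
     (\<forall>\<kappa>\<in>A. \<forall>\<kappa>'\<in>A. p \<in> fst \<kappa> \<inter> fst \<kappa>' \<longrightarrow>
        v \<kappa>' = frechet_derivative (transition \<kappa> \<kappa>') (at (snd \<kappa> p)) (v \<kappa>)) \<and>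
     (\<forall>\<kappa>. \<not> (\<kappa> \<in> A \<and> p \<in> fst \<kappa>) \<longrightarrow> v \<kappa> = 0)}"

definition tangent_bundle ::
  "('q, 'e::euclidean_space) chart set \<Rightarrow> ('q \<times> ('q, 'e) tvec) set" where
  "tangent_bundle A = (SIGMA p:UNIV. tangent_space A p)"

text \<open>
  The usual topology of the tangent bundle, for which each \<open>(p, v) \<mapsto> (snd \<kappa> p, v \<kappa>)\<close> is a
  homeomorphism from the part over \<open>fst \<kappa>\<close> onto the open set \<open>snd \<kappa> ` fst \<kappa> \<times> UNIV\<close>.
\<close>

definition tangent_open ::
  "('q, 'e::euclidean_space) chart set \<Rightarrow> ('q \<times> ('q, 'e) tvec) set \<Rightarrow> bool" where
  "tangent_open A W \<longleftrightarrow> W \<subseteq> tangent_bundle A \<and>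
     (\<forall>\<kappa>\<in>A. \<exists>N. open N \<and>
        (\<forall>(p, v)\<in>tangent_bundle A. p \<in> fst \<kappa> \<longrightarrow> ((p, v) \<in> W \<longleftrightarrow> (snd \<kappa> p, v \<kappa>) \<in> N)))"

definition tangent_topology ::
  "('q, 'e::euclidean_space) chart set \<Rightarrow> ('q \<times> ('q, 'e) tvec) topology" where
  "tangent_topology A = topology (tangent_open A)"

lemma istopology_tangent_open: "istopology (tangent_open A)"
  unfolding istopology_def
proof (intro conjI allI impI)
  fix S T assume S: "tangent_open A S" and T: "tangent_open A T"
  show "tangent_open A (S \<inter> T)"
    unfolding tangent_open_def
  proof (intro conjI ballI)
    show "S \<inter> T \<subseteq> tangent_bundle A" using S unfolding tangent_open_def by blast
    fix \<kappa> assume \<kappa>: "\<kappa> \<in> A"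
    obtain M where M: "open M"
      "\<forall>(p, v)\<in>tangent_bundle A. p \<in> fst \<kappa> \<longrightarrow> ((p, v) \<in> S \<longleftrightarrow> (snd \<kappa> p, v \<kappa>) \<in> M)"
      using S \<kappa> unfolding tangent_open_def by blast
    obtain N where N: "open N"
      "\<forall>(p, v)\<in>tangent_bundle A. p \<in> fst \<kappa> \<longrightarrow> ((p, v) \<in> T \<longleftrightarrow> (snd \<kappa> p, v \<kappa>) \<in> N)"
      using T \<kappa> unfolding tangent_open_def by blast
    have "open (M \<inter> N)" using M(1) N(1) by (rule open_Int)
    moreover have "\<forall>(p, v)\<in>tangent_bundle A. p \<in> fst \<kappa> \<longrightarrow>
        ((p, v) \<in> S \<inter> T \<longleftrightarrow> (snd \<kappa> p, v \<kappa>) \<in> M \<inter> N)"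
      using M(2) N(2) by blast
    ultimately show "\<exists>N. open N \<and> (\<forall>(p, v)\<in>tangent_bundle A. p \<in> fst \<kappa> \<longrightarrow>
        ((p, v) \<in> S \<inter> T \<longleftrightarrow> (snd \<kappa> p, v \<kappa>) \<in> N))"
      by blast
  qed
next
  fix K assume K: "\<forall>S\<in>K. tangent_open A S"
  show "tangent_open A (\<Union>K)"
    unfolding tangent_open_def
  proof (intro conjI ballI)
    show "\<Union>K \<subseteq> tangent_bundle A" using K unfolding tangent_open_def by blast
    fix \<kappa> assume \<kappa>: "\<kappa> \<in> A"
    define R where "R S N \<longleftrightarrow> (\<forall>(p, v)\<in>tangent_bundle A. p \<in> fst \<kappa> \<longrightarrow>
        ((p, v) \<in> S \<longleftrightarrow> (snd \<kappa> p, v \<kappa>) \<in> N))" for S N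
    have "\<forall>S\<in>K. \<exists>N. open N \<and> R S N"
      using K \<kappa> unfolding tangent_open_def R_def by blast
    then obtain N where N: "\<And>S. S \<in> K \<Longrightarrow> open (N S)" "\<And>S. S \<in> K \<Longrightarrow> R S (N S)"
      by metis
    have "open (\<Union>S\<in>K. N S)" using N(1) by (rule open_UN[rule_format])
    moreover have "R (\<Union>K) (\<Union>S\<in>K. N S)"
      unfolding R_def
    proof clarify
      fix p v assume "(p, v) \<in> tangent_bundle A" "p \<in> fst \<kappa>"
      then have "(p, v) \<in> S \<longleftrightarrow> (snd \<kappa> p, v \<kappa>) \<in> N S" if "S \<in> K" for S
        using N(2)[OF that] unfolding R_def by blast
      then show "(p, v) \<in> \<Union>K \<longleftrightarrow> (snd \<kappa> p, v \<kappa>) \<in> (\<Union>S\<in>K. N S)"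
        by blast
    qed
    ultimately show "\<exists>N. open N \<and> (\<forall>(p, v)\<in>tangent_bundle A. p \<in> fst \<kappa> \<longrightarrow>
        ((p, v) \<in> \<Union>K \<longleftrightarrow> (snd \<kappa> p, v \<kappa>) \<in> N))"
      unfolding R_def by blast
  qed
qed

lemma openin_tangent_topology: "openin (tangent_topology A) W \<longleftrightarrow> tangent_open A W"
  unfolding tangent_topology_def by (simp add: istopology_tangent_open topology_inverse')

section \<open>Riemannian metrics and the Levi-Civita connection\<close>

text \<open>
  \<open>g \<kappa> x\<close> is the bilinear form representing the metric in the chart \<open>\<kappa>\<close> at the coordinate
  point \<open>x\<close>.
\<close>

type_synonym ('q, 'e) metric = "('q, 'e) chart \<Rightarrow> 'e \<Rightarrow> 'e \<Rightarrow> 'e \<Rightarrow> real"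

definition riemannian_metric ::
  "('q, 'e::euclidean_space) chart set \<Rightarrow> ('q, 'e) metric \<Rightarrow> bool" where
  "riemannian_metric A g \<longleftrightarrow>
     (\<forall>\<kappa>\<in>A. \<forall>x\<in>snd \<kappa> ` fst \<kappa>. bilinear (g \<kappa> x) \<and>
        (\<forall>v w. g \<kappa> x v w = g \<kappa> x w v) \<and> (\<forall>v. v \<noteq> 0 \<longrightarrow> 0 < g \<kappa> x v v)) \<and>
     (\<forall>\<kappa>\<in>A. \<forall>v w. smooth_on (snd \<kappa> ` fst \<kappa>) (\<lambda>x. g \<kappa> x v w)) \<and>
     (\<forall>\<kappa>\<in>A. \<forall>\<kappa>'\<in>A. \<forall>x\<in>snd \<kappa> ` (fst \<kappa> \<inter> fst \<kappa>'). \<forall>v w.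
        g \<kappa> x v w = g \<kappa>' (transition \<kappa> \<kappa>' x)
          (frechet_derivative (transition \<kappa> \<kappa>') (at x) v)
          (frechet_derivative (transition \<kappa> \<kappa>') (at x) w))"

text \<open>The chart used to evaluate the norm is irrelevant, by the transformation law of \<open>g\<close>.\<close>

definition tnorm ::
  "('q, 'e::euclidean_space) chart set \<Rightarrow> ('q, 'e) metric \<Rightarrow> 'q \<Rightarrow> ('q, 'e) tvec \<Rightarrow> real" where
  "tnorm A g p v =
     (let \<kappa> = (SOME \<kappa>. \<kappa> \<in> A \<and> p \<in> fst \<kappa>) in sqrt (g \<kappa> (snd \<kappa> p) (v \<kappa>) (v \<kappa>)))"

text \<open>
  The Levi-Civita connection in a chart, \<open>\<nabla>\<^sub>u w = D\<^sub>u w + \<Gamma>(u, w)\<close>: its coefficients at \<open>x\<close> are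
  the unique bilinear map that is symmetric (no torsion) and satisfies
  \<open>D\<^sub>u g (v, w) = g (\<Gamma>(u, v), w) + g (v, \<Gamma>(u, w))\<close> (metric compatibility).
\<close>

definition christoffel ::
  "('q, 'e::euclidean_space) metric \<Rightarrow> ('q, 'e) chart \<Rightarrow> 'e \<Rightarrow> 'e \<Rightarrow> 'e \<Rightarrow> 'e" where
  "christoffel g \<kappa> x = (THE \<Gamma>. bilinear \<Gamma> \<and> (\<forall>u w. \<Gamma> u w = \<Gamma> w u) \<and>
     (\<forall>u v w. frechet_derivative (\<lambda>y. g \<kappa> y v w) (at x) u =
        g \<kappa> x (\<Gamma> u v) w + g \<kappa> x v (\<Gamma> u w)))"

section \<open>Curves\<close>

definition ck_curve ::
  "('q::topological_space, 'e::euclidean_space) chart set \<Rightarrow> nat \<Rightarrow> real set \<Rightarrow> (real \<Rightarrow> 'q) \<Rightarrow> bool"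
  where
  "ck_curve A k I \<gamma> \<longleftrightarrow> continuous_on I \<gamma> \<and>
     (\<forall>\<kappa>\<in>A. ck_on k (I \<inter> \<gamma> -` fst \<kappa>) (snd \<kappa> \<circ> \<gamma>))"

definition smooth_curve ::
  "('q::topological_space, 'e::euclidean_space) chart set \<Rightarrow> real set \<Rightarrow> (real \<Rightarrow> 'q) \<Rightarrow> bool"
  where
  "smooth_curve A I \<gamma> \<longleftrightarrow> (\<forall>k. ck_curve A k I \<gamma>)"

definition piecewise_smooth_curve ::
  "('q::topological_space, 'e::euclidean_space) chart set \<Rightarrow> real \<Rightarrow> (real \<Rightarrow> 'q) \<Rightarrow> bool" where
  "piecewise_smooth_curve A T \<gamma> \<longleftrightarrow> continuous_on {0..T} \<gamma> \<and>
     (\<exists>P. finite P \<and> (\<forall>a b. 0 \<le> a \<and> a < b \<and> b \<le> T \<and> {a<..<b} \<inter> P = {} \<longrightarrow>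
        smooth_curve A {a..b} \<gamma>))"

definition velocity ::
  "('q, 'e::euclidean_space) chart set \<Rightarrow> real set \<Rightarrow> (real \<Rightarrow> 'q) \<Rightarrow> real \<Rightarrow> ('q, 'e) tvec" where
  "velocity A I \<gamma> t = (\<lambda>\<kappa>. if \<kappa> \<in> A \<and> \<gamma> t \<in> fst \<kappa>
     then vector_derivative (snd \<kappa> \<circ> \<gamma>) (at t within I) else 0)"

definition tangent_lift ::
  "('q, 'e::euclidean_space) chart set \<Rightarrow> real set \<Rightarrow> (real \<Rightarrow> 'q) \<Rightarrow> real \<Rightarrow> 'q \<times> ('q, 'e) tvec"
  where
  "tangent_lift A I \<gamma> t = (\<gamma> t, velocity A I \<gamma> t)"

text \<open>The covariant derivative of the vector field \<open>X\<close> along \<open>\<gamma>\<close>.\<close>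

definition cov_deriv ::
  "('q, 'e::euclidean_space) chart set \<Rightarrow> ('q, 'e) metric \<Rightarrow> real set \<Rightarrow> (real \<Rightarrow> 'q) \<Rightarrow>
   (real \<Rightarrow> ('q, 'e) tvec) \<Rightarrow> real \<Rightarrow> ('q, 'e) tvec" where
  "cov_deriv A g I \<gamma> X t = (\<lambda>\<kappa>. if \<kappa> \<in> A \<and> \<gamma> t \<in> fst \<kappa>
     then vector_derivative (\<lambda>s. X s \<kappa>) (at t within I) +
       christoffel g \<kappa> (snd \<kappa> (\<gamma> t)) (velocity A I \<gamma> t \<kappa>) (X t \<kappa>)
     else 0)"

definition geodesically_complete ::
  "('q::topological_space, 'e::euclidean_space) chart set \<Rightarrow> ('q, 'e) metric \<Rightarrow> bool" where
  "geodesically_complete A g \<longleftrightarrow>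
     (\<forall>\<xi>\<in>tangent_bundle A. \<exists>\<gamma>. smooth_curve A UNIV \<gamma> \<and> tangent_lift A UNIV \<gamma> 0 = \<xi> \<and>
        (\<forall>t. cov_deriv A g UNIV \<gamma> (velocity A UNIV \<gamma>) t = (\<lambda>\<kappa>. 0)))"

section \<open>The variational problem\<close>

definition admissible_curves ::
  "('q::topological_space, 'e::euclidean_space) chart set \<Rightarrow> real \<Rightarrow>
   'q \<times> ('q, 'e) tvec \<Rightarrow> 'q \<times> ('q, 'e) tvec \<Rightarrow> (real \<Rightarrow> 'q) set" where
  "admissible_curves A T \<xi> \<eta> = {\<gamma>. piecewise_smooth_curve A T \<gamma> \<and> ck_curve A 1 {0..T} \<gamma> \<and>
     tangent_lift A {0..T} \<gamma> 0 = \<xi> \<and> tangent_lift A {0..T} \<gamma> T = \<eta>}"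

text \<open>
  The covariant derivative of the velocity is unspecified at the finitely many times where
  the velocity is not differentiable; these do not affect the integral.
\<close>

definition action ::
  "('q, 'e::euclidean_space) chart set \<Rightarrow> ('q, 'e) metric \<Rightarrow> ('q \<Rightarrow> real) \<Rightarrow> real \<Rightarrow>
   (real \<Rightarrow> 'q) \<Rightarrow> real" where
  "action A g V T \<gamma> = integral {0..T} (\<lambda>t.
     1/2 * (tnorm A g (\<gamma> t) (cov_deriv A g {0..T} \<gamma> (velocity A {0..T} \<gamma>) t))\<^sup>2 + V (\<gamma> t))"

text \<open>
  The \<open>C\<^sup>1\<close> neighborhoods of \<open>q\<close>: all admissible curves whose tangent lift has its graph in an
  open tube \<open>W\<close> of \<open>[0,T] \<times> TQ\<close> around the graph of the tangent lift of \<open>q\<close>. As \<open>[0,T]\<close> is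
  compact, these sets form a neighborhood base of \<open>q\<close> for the \<open>C\<^sup>1\<close> topology (uniform
  convergence of tangent lifts), and the balls of any \<open>C\<^sup>1\<close> distance
  \<open>sup\<^sub>t d (Tq(t), T\<gamma>(t))\<close>, with \<open>d\<close> a distance inducing the topology of \<open>TQ\<close>, are of this form.
  A union of small balls around two different curves need not be of this form.
\<close>

definition c1_neighborhood ::
  "('q::topological_space, 'e::euclidean_space) chart set \<Rightarrow> real \<Rightarrow>
   'q \<times> ('q, 'e) tvec \<Rightarrow> 'q \<times> ('q, 'e) tvec \<Rightarrow> (real \<Rightarrow> 'q) \<Rightarrow> (real \<Rightarrow> 'q) set \<Rightarrow> bool" where
  "c1_neighborhood A T \<xi> \<eta> q B \<longleftrightarrow> (\<exists>W.
     openin (prod_topology (top_of_set {0..T}) (tangent_topology A)) W \<and>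
     (\<forall>t\<in>{0..T}. (t, tangent_lift A {0..T} q t) \<in> W) \<and>
     B = {\<gamma> \<in> admissible_curves A T \<xi> \<eta>. \<forall>t\<in>{0..T}. (t, tangent_lift A {0..T} \<gamma> t) \<in> W})"

definition local_minimizer ::
  "('q::topological_space, 'e::euclidean_space) chart set \<Rightarrow> ('q, 'e) metric \<Rightarrow> ('q \<Rightarrow> real) \<Rightarrow>
   real \<Rightarrow> 'q \<times> ('q, 'e) tvec \<Rightarrow> 'q \<times> ('q, 'e) tvec \<Rightarrow> (real \<Rightarrow> 'q) \<Rightarrow> bool" where
  "local_minimizer A g V T \<xi> \<eta> q \<longleftrightarrow> q \<in> admissible_curves A T \<xi> \<eta> \<and>
     (\<exists>B. c1_neighborhood A T \<xi> \<eta> q B \<and> (\<forall>\<gamma>\<in>B. action A g V T q \<le> action A g V T \<gamma>))"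

end

theory Submission
  imports Defs
begin

text \<open>
  Let \<open>p\<close> and \<open>q\<close> minimize the action in the same tube of curves, and suppose that their
  tangent lifts agree at an interior time \<open>\<sigma>\<close>. The two curves that follow one of them up to \<open>\<sigma>\<close>
  and the other one afterwards are \<open>C\<^sup>1\<close>, lie in the tube, and their actions add up to the
  actions of \<open>p\<close> and \<open>q\<close>; hence they are minimizers too (\<open>minimal_concat\<close>). So there are minimizers
  that coincide after \<open>\<sigma>\<close> but possibly not before \<open>\<sigma>\<close>, and minimizers for which it is the other way
  round. It remains to see that a minimizer cannot branch at \<open>\<sigma>\<close> in this way.

  Classically this follows from the regularity of minimizers and the uniqueness of solutions of
  the fourth order Euler-Lagrange equation. Here one well chosen variation replaces both. In a
  chart the action is \<open>\<integral> L(x, x', x'')\<close>, where \<open>L(x, v, a) = 1/2 g\<^sub>x(a + \<Gamma>\<^sub>x(v, v), a + \<Gamma>\<^sub>x(v, v)) + V(x)\<close> is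
  smooth and quadratic in \<open>a\<close> with a positive definite leading part. Let \<open>x\<close> and \<open>y\<close> be the
  coordinates of two minimizers on an interval \<open>[c, \<sigma>]\<close> without break points, with a common
  continuation \<open>z\<close> on \<open>[\<sigma>, d]\<close>, and put \<open>w = x - y\<close>. The function \<open>h(t) = w(t) - w(c) - (t - c) w'(c)\<close>
  vanishes to first order at \<open>c\<close>, has the same second derivative as \<open>w\<close>, and is continued by a
  cubic polynomial on \<open>[\<sigma>, d]\<close> so as to vanish to first order at \<open>d\<close>. Varying \<open>x\<close> by \<open>-s h\<close> and
  \<open>y\<close> by \<open>s h\<close>, the contributions of first order in \<open>s\<close> on \<open>[\<sigma>, d]\<close> cancel, and minimality leaves
  \<open>\<integral>\<^sub>c\<^sup>\<sigma> (DL(x, x', x'') - DL(y, y', y'')) (h, h', w'') \<le> 0\<close> (\<open>first_variation_nonpos\<close>).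
  Ellipticity makes the left hand side at least \<open>m \<integral> |w''|\<^sup>2\<close> up to terms that contain a factor
  \<open>w\<close>, \<open>w'\<close>, \<open>h\<close> or \<open>h'\<close>, and each of these is bounded by \<open>\<integral> |w''|\<close>, because \<open>w\<close> and \<open>h\<close> vanish to
  first order somewhere in \<open>[c, \<sigma>]\<close>. If \<open>\<sigma> - c\<close> is small the leading term wins and \<open>w = 0\<close>
  (\<open>jets_coincide\<close>, \<open>endpoint_rigidity\<close>). The argument does not distinguish left from right, so
  \<open>p = q\<close> near \<open>\<sigma>\<close> (\<open>local_coincidence\<close>). The set of interior times at which the tangent lifts agree is
  therefore open; it is closed by continuity; as \<open>(0, T)\<close> is connected, it is everything.

  What is needed around this argument is the coordinate expression of the action. The norm of the
  covariant acceleration does not depend on the chart because of the transformation law of the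
  Christoffel symbols (\<open>christoffel_transition\<close>), and \<open>L\<close> is smooth because the Christoffel symbols are
  obtained from the derivatives of the metric by solving a linear system with smooth coefficients
  (\<open>ck_on_linear_solve\<close>).
\<close>

section \<open>Calculus of continuously differentiable maps\<close>

text \<open>
  A set has this property if each of its points can be approached inside the set along every
  coordinate axis. Derivatives within such a set are unique, so that the derivatives chosen in the
  definition of \<open>ck_on\<close> can be computed by the usual rules.
\<close>

definition unique_derivs :: "'a::euclidean_space set \<Rightarrow> bool" where
  "unique_derivs S \<longleftrightarrow>
     (\<forall>x\<in>S. \<forall>i\<in>Basis. \<forall>e>0. \<exists>d. 0 < \<bar>d\<bar> \<and> \<bar>d\<bar> < e \<and> x + d *\<^sub>R i \<in> S)"

lemma unique_derivs_eq:
  assumes "unique_derivs S" "x \<in> S"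
    "(f has_derivative F) (at x within S)" "(f has_derivative G) (at x within S)"
  shows "F = G"
  using assms(3,4) by (rule frechet_derivative_unique_within)
    (use assms(1,2) in \<open>auto simp: unique_derivs_def\<close>)

lemma unique_derivs_open:
  fixes S :: "'a::euclidean_space set"
  assumes "open S" shows "unique_derivs S"
  unfolding unique_derivs_def
proof (intro ballI allI impI)
  fix x i :: 'a and e :: real assume *: "x \<in> S" "i \<in> Basis" "0 < e"
  obtain r where r: "0 < r" "ball x r \<subseteq> S"
    using assms * openE by blast
  define d where "d = min e r / 2"
  have "x + d *\<^sub>R i \<in> ball x r" using * r by (auto simp: d_def dist_norm)
  then show "\<exists>d. 0 < \<bar>d\<bar> \<and> \<bar>d\<bar> < e \<and> x + d *\<^sub>R i \<in> S"
    using r * by (intro exI[of _ d]) (auto simp: d_def)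
qed

lemma unique_derivs_interval:
  fixes a b :: real
  assumes "a < b" "openin (top_of_set {a..b}) S"
  shows "unique_derivs S"
  unfolding unique_derivs_def
proof (intro ballI allI impI)
  fix x i e :: real assume *: "x \<in> S" "i \<in> Basis" "0 < e"
  obtain O' where O': "open O'" "S = {a..b} \<inter> O'" using assms(2) by (auto simp: openin_open)
  then obtain r where r: "0 < r" "ball x r \<subseteq> O'" using * openE by blast
  \<comment> \<open>Points other than the right end are approached from the right, the right end from the left.\<close>
  define d where "d = (if x < b then min (min e r) (b - x) / 2 else - (min (min e r) (b - a) / 2))"
  have "x + d \<in> S" "0 < \<bar>d\<bar>" "\<bar>d\<bar> < e"
    using O' r * assms(1) by (auto simp: d_def dist_real_def subset_iff min_def field_simps)
  then show "\<exists>d. 0 < \<bar>d\<bar> \<and> \<bar>d\<bar> < e \<and> x + d *\<^sub>R i \<in> S" using * by auto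
qed

lemma frechet_derivative_eqI:
  "\<lbrakk>unique_derivs S; x \<in> S; (f has_derivative F) (at x within S)\<rbrakk>
    \<Longrightarrow> frechet_derivative f (at x within S) = F"
  by (metis unique_derivs_eq frechet_derivative_works differentiableI)

lemma has_derivative_cong_on:
  assumes "x \<in> S" "\<And>y. y \<in> S \<Longrightarrow> f y = g y"
  shows "(f has_derivative F) (at x within S) \<longleftrightarrow> (g has_derivative F) (at x within S)"
  using has_derivative_transform[of x S f g F] has_derivative_transform[of x S g f F] assms by metis

lemma ck_on_cong:
  "(\<And>x. x \<in> S \<Longrightarrow> f x = g x) \<Longrightarrow> ck_on k S f \<longleftrightarrow> ck_on k S g"
proof (induction k arbitrary: f g)
  case 0 then show ?case by (auto cong: continuous_on_cong)
next
  case (Suc k)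
  have *: "(f has_derivative F) (at x within S) \<longleftrightarrow> (g has_derivative F) (at x within S)"
    if "x \<in> S" for x F using has_derivative_cong_on[of x S f g F] that Suc.prems by blast
  have "frechet_derivative f (at x within S) v = frechet_derivative g (at x within S) v"
    if "x \<in> S" for x v using * that by (simp add: frechet_derivative_def)
  then have "\<forall>v. ck_on k S (\<lambda>x. frechet_derivative f (at x within S) v) =
     ck_on k S (\<lambda>x. frechet_derivative g (at x within S) v)"
    by (intro allI Suc.IH) auto
  moreover have "f differentiable_on S \<longleftrightarrow> g differentiable_on S"
    using * by (simp add: differentiable_on_def differentiable_def)
  ultimately show ?case by simp
qed

text \<open>
  This rule and \<open>ck_on_SucE\<close> allow any family of derivatives in place of the chosen one. The closure
  properties below are inductions on the order of differentiability that rest on these two rules.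
\<close>

lemma ck_on_SucI:
  assumes "unique_derivs S" "\<And>x. x \<in> S \<Longrightarrow> (f has_derivative F x) (at x within S)"
    "\<And>v. ck_on k S (\<lambda>x. F x v)"
  shows "ck_on (Suc k) S f"
proof -
  have "frechet_derivative f (at x within S) v = F x v" if "x \<in> S" for x v
    using frechet_derivative_eqI[OF assms(1) that assms(2)[OF that]] by simp
  then have "ck_on k S (\<lambda>x. frechet_derivative f (at x within S) v)" for v
    using assms(3)[of v] by (subst ck_on_cong) auto
  moreover have "f differentiable_on S"
    using assms(2) by (auto simp: differentiable_on_def differentiable_def)
  ultimately show ?thesis by simp
qed

lemma ck_on_SucE:
  assumes "ck_on (Suc k) S f"
  obtains F where "\<And>x. x \<in> S \<Longrightarrow> (f has_derivative F x) (at x within S)"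
    "\<And>v. ck_on k S (\<lambda>x. F x v)"
  using that[of "\<lambda>x. frechet_derivative f (at x within S)"] assms
  by (auto simp: differentiable_on_def frechet_derivative_works)

lemma ck_on_Suc_imp: "ck_on (Suc k) S f \<Longrightarrow> ck_on k S f"
proof (induction k arbitrary: f)
  case 0 then show ?case by (auto intro: differentiable_imp_continuous_on)
qed auto

lemma ck_on_le: "ck_on k S f \<Longrightarrow> j \<le> k \<Longrightarrow> ck_on j S f"
  by (induction k) (auto simp: le_Suc_eq dest: ck_on_Suc_imp simp del: ck_on.simps(2))

lemma ck_on_imp_continuous_on: "ck_on k S f \<Longrightarrow> continuous_on S f"
  using ck_on_le[of k S f 0] by simp

lemma ck_on_subset:
  assumes "unique_derivs T" "T \<subseteq> S"
  shows "ck_on k S f \<Longrightarrow> ck_on k T f"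
proof (induction k arbitrary: f)
  case 0 then show ?case using assms continuous_on_subset by auto
next
  case (Suc k)
  obtain F where F: "\<And>x. x \<in> S \<Longrightarrow> (f has_derivative F x) (at x within S)"
    "\<And>v. ck_on k S (\<lambda>x. F x v)" using ck_on_SucE[OF Suc.prems] by metis
  show ?case using assms F Suc.IH
    by (intro ck_on_SucI[where F = F]) (auto intro: has_derivative_subset)
qed

lemma ck_on_const: "unique_derivs S \<Longrightarrow> ck_on k S (\<lambda>x. c)"
proof (induction k arbitrary: c)
  case (Suc k)
  then show ?case by (intro ck_on_SucI[where F = "\<lambda>_ _. 0"]) auto
qed auto

lemma ck_on_linear:
  assumes "unique_derivs S" "bounded_linear l"
  shows "ck_on k S f \<Longrightarrow> ck_on k S (\<lambda>x. l (f x))"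
proof (induction k arbitrary: f)
  case 0 then show ?case using assms bounded_linear.continuous_on by auto
next
  case (Suc k)
  obtain F where F: "\<And>x. x \<in> S \<Longrightarrow> (f has_derivative F x) (at x within S)"
    "\<And>v. ck_on k S (\<lambda>x. F x v)" using ck_on_SucE[OF Suc.prems] by metis
  show ?case using assms F Suc.IH
    by (intro ck_on_SucI[where F = "\<lambda>x v. l (F x v)"])
      (auto intro: bounded_linear.has_derivative)
qed

lemma ck_on_add:
  assumes "unique_derivs S"
  shows "ck_on k S f \<Longrightarrow> ck_on k S g \<Longrightarrow> ck_on k S (\<lambda>x. f x + g x)"
proof (induction k arbitrary: f g)
  case 0 then show ?case by (auto intro: continuous_on_add)
next
  case (Suc k)
  obtain F where F: "\<And>x. x \<in> S \<Longrightarrow> (f has_derivative F x) (at x within S)"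
    "\<And>v. ck_on k S (\<lambda>x. F x v)" using ck_on_SucE[OF Suc.prems(1)] by metis
  obtain G where G: "\<And>x. x \<in> S \<Longrightarrow> (g has_derivative G x) (at x within S)"
    "\<And>v. ck_on k S (\<lambda>x. G x v)" using ck_on_SucE[OF Suc.prems(2)] by metis
  show ?case using assms F G Suc.IH
    by (intro ck_on_SucI[where F = "\<lambda>x v. F x v + G x v"]) (auto intro: has_derivative_add)
qed

lemma ck_on_bilinear:
  assumes "unique_derivs S" "bounded_bilinear p"
  shows "ck_on k S f \<Longrightarrow> ck_on k S g \<Longrightarrow> ck_on k S (\<lambda>x. p (f x) (g x))"
proof (induction k arbitrary: f g)
  case 0 then show ?case using bounded_bilinear.continuous_on[OF assms(2)] by auto
next
  case (Suc k)
  obtain F where F: "\<And>x. x \<in> S \<Longrightarrow> (f has_derivative F x) (at x within S)"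
    "\<And>v. ck_on k S (\<lambda>x. F x v)" using ck_on_SucE[OF Suc.prems(1)] by metis
  obtain G where G: "\<And>x. x \<in> S \<Longrightarrow> (g has_derivative G x) (at x within S)"
    "\<And>v. ck_on k S (\<lambda>x. G x v)" using ck_on_SucE[OF Suc.prems(2)] by metis
  show ?case using assms F G Suc.IH Suc.prems[THEN ck_on_Suc_imp]
    by (intro ck_on_SucI[where F = "\<lambda>x v. p (f x) (G x v) + p (F x v) (g x)"] ck_on_add)
      (auto intro: bounded_bilinear.FDERIV)
qed

lemmas ck_on_scaleR = ck_on_bilinear[OF _ bounded_bilinear_scaleR]
lemmas ck_on_mult = ck_on_bilinear[OF _ bounded_bilinear_mult]
lemmas ck_on_inner = ck_on_bilinear[OF _ bounded_bilinear_inner]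

lemma ck_on_minus:
  "unique_derivs S \<Longrightarrow> ck_on k S f \<Longrightarrow> ck_on k S (\<lambda>x. - f x)"
  using ck_on_linear[OF _ bounded_linear_minus[OF bounded_linear_ident]] .

lemma ck_on_diff:
  "unique_derivs S \<Longrightarrow> ck_on k S f \<Longrightarrow> ck_on k S g \<Longrightarrow> ck_on k S (\<lambda>x. f x - g x)"
  using ck_on_add[of S k f "\<lambda>x. - g x"] ck_on_minus[of S k g] by simp

lemma ck_on_sum:
  "unique_derivs S \<Longrightarrow> (\<And>i. i \<in> I \<Longrightarrow> ck_on k S (f i)) \<Longrightarrow> ck_on k S (\<lambda>x. \<Sum>i\<in>I. f i x)"
  by (induction I rule: infinite_finite_induct) (auto intro: ck_on_const ck_on_add)

lemma ck_on_ident: "unique_derivs S \<Longrightarrow> ck_on k S (\<lambda>x. x)"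
  by (cases k) (auto intro!: ck_on_SucI[where F = "\<lambda>_ v. v"] ck_on_const
     intro: derivative_eq_intros simp del: ck_on.simps(2))

text \<open>
  The derivative \<open>H(f(x)) (F(x) v)\<close> of the composition is the sum of the products of the coordinates of
  \<open>F(x) v\<close> with the partial derivatives of \<open>h\<close> at \<open>f(x)\<close>. The former are \<open>C\<^sup>k\<close> by assumption, the latter
  by induction. This is the only form of the higher chain rule that is used.
\<close>

lemma ck_on_compose:
  fixes f :: "'a::euclidean_space \<Rightarrow> 'b::euclidean_space"
  assumes S: "unique_derivs S" and U: "unique_derivs U" and fU: "\<And>x. x \<in> S \<Longrightarrow> f x \<in> U"
  shows "ck_on k U h \<Longrightarrow> ck_on k S f \<Longrightarrow> ck_on k S (\<lambda>x. h (f x))"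
proof (induction k arbitrary: h)
  case 0 then show ?case using fU by (auto intro: continuous_on_compose2)
next
  case (Suc k)
  obtain F where F: "\<And>x. x \<in> S \<Longrightarrow> (f has_derivative F x) (at x within S)"
    "\<And>v. ck_on k S (\<lambda>x. F x v)" using ck_on_SucE[OF Suc.prems(2)] by metis
  obtain H where H: "\<And>x. x \<in> U \<Longrightarrow> (h has_derivative H x) (at x within U)"
    "\<And>v. ck_on k U (\<lambda>x. H x v)" using ck_on_SucE[OF Suc.prems(1)] by metis
  have eq: "H (f x) (F x v) = (\<Sum>i\<in>Basis. (F x v \<bullet> i) *\<^sub>R H (f x) i)" if "x \<in> S" for x v
  proof -
    have "linear (H (f x))" using H(1) fU that has_derivative_linear by blast
    then show ?thesis by (subst (1) euclidean_representation[of "F x v", symmetric])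
      (simp add: linear_sum linear_scale)
  qed
  show ?case
  proof (rule ck_on_SucI[OF S, where F = "\<lambda>x v. H (f x) (F x v)"])
    fix x assume "x \<in> S"
    then show "((\<lambda>x. h (f x)) has_derivative (\<lambda>v. H (f x) (F x v))) (at x within S)"
      using has_derivative_in_compose2[of U h H f S x "F x"] H(1) F(1) fU by auto
  next
    fix v
    have "ck_on k S (\<lambda>x. \<Sum>i\<in>Basis. (F x v \<bullet> i) *\<^sub>R H (f x) i)"
      using S F(2) ck_on_Suc_imp[OF Suc.prems(2)] H(2)
      by (intro ck_on_sum ck_on_scaleR ck_on_inner ck_on_const Suc.IH) auto
    then show "ck_on k S (\<lambda>x. H (f x) (F x v))" using eq by (subst ck_on_cong) auto
  qed
qed

section \<open>Linear equations with smooth coefficients\<close>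

text \<open>
  At a zero of \<open>f\<close> the product rule for \<open>c f\<close> only requires continuity of \<open>c\<close>. This breaks the circle in
  the differentiation of a solution of a linear system, where \<open>c\<close> is the solution itself.
\<close>

lemma has_derivative_vanishing_scaleR:
  fixes f :: "'a::real_normed_vector \<Rightarrow> 'b::real_normed_vector"
  assumes f: "(f has_derivative F) (at x within S)" "f x = 0"
    and c: "continuous (at x within S) c"
  shows "((\<lambda>y. c y *\<^sub>R f y) has_derivative (\<lambda>v. c x *\<^sub>R F v)) (at x within S)"
proof -
  interpret F: bounded_linear F using f(1) by (rule has_derivative_bounded_linear)
  have c0: "((\<lambda>y. c y - c x) \<longlongrightarrow> 0) (at x within S)"
    using c by (simp add: continuous_within LIM_zero)
  obtain K where K: "\<And>v. norm (F v) \<le> norm v * K" using F.bounded by blast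
  have f0: "((\<lambda>y. norm (f y - F (y - x)) / norm (y - x)) \<longlongrightarrow> 0) (at x within S)"
    using f by (simp add: has_derivative_iff_norm)
  have "((\<lambda>y. norm (c y *\<^sub>R f y - c x *\<^sub>R f x - c x *\<^sub>R F (y - x)) / norm (y - x)) \<longlongrightarrow> 0) (at x within S)"
  proof (rule Lim_null_comparison)
    have "((\<lambda>y. \<bar>c y\<bar> * (norm (f y - F (y - x)) / norm (y - x)) + \<bar>c y - c x\<bar> * K) \<longlongrightarrow> \<bar>c x\<bar> * 0 + \<bar>0\<bar> * K) (at x within S)"
      using c f0 c0 by (intro tendsto_intros) (auto simp: continuous_within)
    then show "((\<lambda>y. \<bar>c y\<bar> * (norm (f y - F (y - x)) / norm (y - x)) + \<bar>c y - c x\<bar> * K) \<longlongrightarrow> 0) (at x within S)" by simp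
    have "norm (norm (c y *\<^sub>R f y - c x *\<^sub>R f x - c x *\<^sub>R F (y - x)) / norm (y - x))
        \<le> \<bar>c y\<bar> * (norm (f y - F (y - x)) / norm (y - x)) + \<bar>c y - c x\<bar> * K" if "y \<noteq> x" for y
    proof -
      have "c y *\<^sub>R f y - c x *\<^sub>R f x - c x *\<^sub>R F (y - x) = c y *\<^sub>R (f y - F (y - x)) + (c y - c x) *\<^sub>R F (y - x)"
        using f(2) by (simp add: algebra_simps)
      also have "norm \<dots> \<le> \<bar>c y\<bar> * norm (f y - F (y - x)) + \<bar>c y - c x\<bar> * (norm (y - x) * K)"
        by (rule norm_triangle_le) (auto intro!: add_mono mult_left_mono K)
      finally show ?thesis using that by (simp add: field_simps)
    qed
    then show "\<forall>\<^sub>F y in at x within S. norm (norm (c y *\<^sub>R f y - c x *\<^sub>R f x - c x *\<^sub>R F (y - x)) / norm (y - x))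
        \<le> \<bar>c y\<bar> * (norm (f y - F (y - x)) / norm (y - x)) + \<bar>c y - c x\<bar> * K"
      by (auto simp: eventually_at_filter)
  qed
  then show ?thesis using f(2)
    by (simp add: has_derivative_iff_norm bounded_linear_scaleR_right F.bounded_linear_axioms
      bounded_linear_compose[OF bounded_linear_scaleR_right])
qed

lemma linear_eq_sum_Basis:
  fixes f :: "'a::euclidean_space \<Rightarrow> 'b::real_vector"
  assumes "linear f"
  shows "f v = (\<Sum>i\<in>Basis. (v \<bullet> i) *\<^sub>R f i)"
  by (subst (1) euclidean_representation[of v, symmetric])
    (simp add: assms linear_sum linear_scale)

lemma positive_linear_bij:
  fixes G :: "'b::euclidean_space \<Rightarrow> 'b"
  assumes "linear G" "\<And>v. v \<noteq> 0 \<Longrightarrow> 0 < G v \<bullet> v"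
  shows "bij G" "linear (inv G)"
proof -
  have "inj G" unfolding linear_injective_0[OF assms(1)] using assms(2) by fastforce
  then show "bij G" using linear_injective_imp_surjective[OF assms(1)] by (simp add: bij_def)
  show "linear (inv G)" using assms(1) \<open>inj G\<close> by (rule inj_linear_imp_inv_linear)
qed

text \<open>
  The quadratic form attains its minimum on the unit sphere, which is compact.
\<close>

lemma positive_linear_coercive:
  fixes G :: "'b::euclidean_space \<Rightarrow> 'b"
  assumes "linear G" "\<And>v. v \<noteq> 0 \<Longrightarrow> 0 < G v \<bullet> v"
  obtains m where "0 < m" "\<And>v. m * (norm v)\<^sup>2 \<le> G v \<bullet> v"
proof -
  obtain i :: 'b where i: "i \<in> Basis" using nonempty_Basis by blast
  have "compact (sphere (0::'b) 1)" "sphere (0::'b) 1 \<noteq> {}" using i by (auto simp: ex_in_conv[symmetric] intro!: exI[of _ i])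
  moreover have "continuous_on (sphere 0 1) (\<lambda>v. G v \<bullet> v)"
    using assms(1) by (intro continuous_intros linear_continuous_on linear_linear[THEN iffD2])
       (auto simp: linear_conv_bounded_linear)
  ultimately obtain w where w: "w \<in> sphere 0 1" "\<And>v. v \<in> sphere 0 1 \<Longrightarrow> G w \<bullet> w \<le> G v \<bullet> v"
    using continuous_attains_inf[of "sphere (0::'b) 1" "\<lambda>v. G v \<bullet> v"] by blast
  show thesis
  proof (rule that[of "G w \<bullet> w"])
    show "0 < G w \<bullet> w" using w(1) by (intro assms(2)) auto
    fix v show "(G w \<bullet> w) * (norm v)\<^sup>2 \<le> G v \<bullet> v"
    proof (cases "v = 0")
      case False
      have "G w \<bullet> w \<le> G (v /\<^sub>R norm v) \<bullet> (v /\<^sub>R norm v)" using False by (intro w(2)) auto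
      also have "\<dots> = (G v \<bullet> v) / (norm v)\<^sup>2"
        by (simp add: linear_scale[OF assms(1)] power2_eq_square divide_simps)
      finally show ?thesis using False by (simp add: field_simps)
    qed (simp add: linear_0[OF assms(1)])
  qed
qed

text \<open>
  Coercivity of \<open>G(x)\<close> survives a small perturbation of \<open>x\<close> with half the constant. Applied to
  \<open>G(y) (f(y) - f(x)) = b(y) - G(y) f(x)\<close> it bounds \<open>f(y) - f(x)\<close> by a quantity that tends to 0.
\<close>

lemma continuous_on_linear_solve:
  fixes G :: "'a::euclidean_space \<Rightarrow> 'b::euclidean_space \<Rightarrow> 'b"
  assumes lin: "\<And>x. x \<in> S \<Longrightarrow> linear (G x)"
    and pos: "\<And>x v. x \<in> S \<Longrightarrow> v \<noteq> 0 \<Longrightarrow> 0 < G x v \<bullet> v"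
    and G: "\<And>v. continuous_on S (\<lambda>x. G x v)" and b: "continuous_on S b"
    and f: "\<And>x. x \<in> S \<Longrightarrow> G x (f x) = b x"
  shows "continuous_on S f"
  unfolding continuous_on_def
proof
  fix x assume x: "x \<in> S"
  obtain m where m: "0 < m" "\<And>v. m * (norm v)\<^sup>2 \<le> G x v \<bullet> v"
    using positive_linear_coercive lin pos x by metis
  define d where "d y = (\<Sum>i\<in>Basis. norm (G y i - G x i))" for y
  have "(d \<longlongrightarrow> (\<Sum>i\<in>(Basis::'b set). norm (G x i - G x i))) (at x within S)"
    unfolding d_def using G x by (intro tendsto_intros) (auto simp: continuous_on_def)
  then have "\<forall>\<^sub>F y in at x within S. d y < m / 2"
    using m(1) by (intro order_tendstoD(2)) auto
  moreover have "\<forall>\<^sub>F y in at x within S. y \<in> S" by (auto simp: eventually_at_filter)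
  ultimately have ev: "\<forall>\<^sub>F y in at x within S. norm (f y - f x) \<le> 2 / m * norm (b y - G y (f x))"
  proof eventually_elim
    case (elim y)
    define w where "w = f y - f x"
    have "norm (G y w - G x w) = norm (\<Sum>i\<in>Basis. (w \<bullet> i) *\<^sub>R (G y i - G x i))"
      using linear_eq_sum_Basis[OF lin[OF x], of w] linear_eq_sum_Basis[OF lin[OF elim(2)], of w]
      by (simp add: scaleR_diff_right sum_subtractf)
    also have "\<dots> \<le> (\<Sum>i\<in>Basis. norm w * norm (G y i - G x i))"
      by (rule order_trans[OF norm_sum], intro sum_mono) (auto intro!: mult_right_mono Basis_le_norm)
    also have "\<dots> = norm w * d y" by (simp add: d_def sum_distrib_left)
    also have "\<dots> \<le> norm w * (m / 2)" using elim(1) by (intro mult_left_mono) auto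
    finally have *: "norm (G y w - G x w) \<le> norm w * (m / 2)" .
    have "\<bar>(G y w - G x w) \<bullet> w\<bar> \<le> norm w * (m / 2) * norm w"
      using order_trans[OF Cauchy_Schwarz_ineq2 mult_right_mono[OF *]] by auto
    then have "m / 2 * (norm w)\<^sup>2 \<le> G y w \<bullet> w" using m(2)[of w]
      by (simp add: inner_diff_left power2_eq_square abs_if mult.commute mult.left_commute split: if_splits)
    also have "G y w = b y - G y (f x)"
      using f[OF elim(2)] lin[OF elim(2)] by (simp add: w_def linear_diff)
    also have "\<dots> \<bullet> w \<le> norm (b y - G y (f x)) * norm w" by (rule norm_cauchy_schwarz)
    finally have "m / 2 * norm w \<le> norm (b y - G y (f x))"
      by (cases "w = 0") (auto simp: power2_eq_square)
    then show ?case using m(1) by (simp add: w_def field_simps)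
  qed
  have "((\<lambda>y. b y - G y (f x)) \<longlongrightarrow> b x - G x (f x)) (at x within S)"
    using b G[of "f x"] x by (intro tendsto_diff) (simp_all add: continuous_on_def)
  then have "((\<lambda>y. 2 / m * norm (b y - G y (f x))) \<longlongrightarrow> 2 / m * norm (b x - G x (f x))) (at x within S)"
    by (rule tendsto_mult[OF tendsto_const tendsto_norm])
  then have "((\<lambda>y. f y - f x) \<longlongrightarrow> 0) (at x within S)"
    using Lim_null_comparison[OF ev] f[OF x] by simp
  then show "(f \<longlongrightarrow> f x) (at x within S)" by (rule LIM_zero_cancel)
qed

text \<open>
  With \<open>x\<close> fixed, the equation is rewritten as \<open>f(y) = f(x) + G(x)\<^sup>-\<^sup>1 (b(y) - b(x) - (G(y) - G(x)) f(y))\<close>.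
  The unknown \<open>f(y)\<close> on the right is multiplied by a function vanishing at \<open>y = x\<close>, so its continuity is
  enough to differentiate.
\<close>

lemma has_derivative_linear_solve:
  fixes G :: "'a::euclidean_space \<Rightarrow> 'b::euclidean_space \<Rightarrow> 'b"
  assumes lin: "\<And>x. x \<in> S \<Longrightarrow> linear (G x)"
    and pos: "\<And>x v. x \<in> S \<Longrightarrow> v \<noteq> 0 \<Longrightarrow> 0 < G x v \<bullet> v"
    and f: "\<And>x. x \<in> S \<Longrightarrow> G x (f x) = b x" and cont: "continuous_on S f"
    and x: "x \<in> S" and b: "(b has_derivative b') (at x within S)"
    and G: "\<And>i. i \<in> Basis \<Longrightarrow> ((\<lambda>x. G x i) has_derivative G' i) (at x within S)"
  shows "(f has_derivative (\<lambda>v. inv (G x) (b' v - (\<Sum>i\<in>Basis. (f x \<bullet> i) *\<^sub>R G' i v)))) (at x within S)"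
proof -
  note bij = positive_linear_bij[OF lin[OF x] pos[OF x]]
  have inv_l: "inv (G x) (G x v) = v" for v using bij(1) by (simp add: bij_def)
  have eq: "f y = f x + inv (G x) (b y - b x - (\<Sum>i\<in>Basis. (f y \<bullet> i) *\<^sub>R (G y i - G x i)))"
    if y: "y \<in> S" for y
  proof -
    have "(\<Sum>i\<in>Basis. (f y \<bullet> i) *\<^sub>R (G y i - G x i)) = b y - G x (f y)"
      using linear_eq_sum_Basis[OF lin[OF x], of "f y"] linear_eq_sum_Basis[OF lin[OF y], of "f y"] f[OF y]
      by (simp add: scaleR_diff_right sum_subtractf)
    then have "b y - b x - (\<Sum>i\<in>Basis. (f y \<bullet> i) *\<^sub>R (G y i - G x i)) = G x (f y - f x)"
      using f[OF x] lin[OF x] by (simp add: linear_diff)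
    then show ?thesis by (simp add: inv_l)
  qed
  have "((\<lambda>y. (f y \<bullet> i) *\<^sub>R (G y i - G x i)) has_derivative (\<lambda>v. (f x \<bullet> i) *\<^sub>R (G' i v))) (at x within S)"
    if "i \<in> Basis" for i
    using G[OF that] cont x
    by (intro has_derivative_vanishing_scaleR)
       (auto intro!: derivative_eq_intros continuous_intros simp: continuous_on_eq_continuous_within)
  then have R: "((\<lambda>y. b y - b x - (\<Sum>i\<in>Basis. (f y \<bullet> i) *\<^sub>R (G y i - G x i))) has_derivative
     (\<lambda>v. b' v - 0 - (\<Sum>i\<in>Basis. (f x \<bullet> i) *\<^sub>R G' i v))) (at x within S)"
    by (intro has_derivative_diff has_derivative_sum has_derivative_const b)
  have "bounded_linear (inv (G x))" using bij(2) by (simp add: linear_conv_bounded_linear)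
  from has_derivative_add[OF has_derivative_const[of "f x"] bounded_linear.has_derivative[OF this R]] have "((\<lambda>y. f x + inv (G x) (b y - b x - (\<Sum>i\<in>Basis. (f y \<bullet> i) *\<^sub>R (G y i - G x i)))) has_derivative
     (\<lambda>v. 0 + inv (G x) (b' v - 0 - (\<Sum>i\<in>Basis. (f x \<bullet> i) *\<^sub>R G' i v)))) (at x within S)"
    .
  then show ?thesis using eq by (subst has_derivative_cong_on[OF x]) auto
qed

text \<open>
  The derivative of a solution solves the linear system with the same operators \<open>G(x)\<close> and another
  right hand side, which involves the solution itself only to order 0. So one more derivative can be
  gained at each step.
\<close>

lemma ck_on_linear_solve:
  fixes G :: "'a::euclidean_space \<Rightarrow> 'b::euclidean_space \<Rightarrow> 'b"
  assumes S: "unique_derivs S" and lin: "\<And>x. x \<in> S \<Longrightarrow> linear (G x)"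
    and pos: "\<And>x v. x \<in> S \<Longrightarrow> v \<noteq> 0 \<Longrightarrow> 0 < G x v \<bullet> v"
  shows "\<lbrakk>\<And>v. ck_on k S (\<lambda>x. G x v); ck_on k S b; \<And>x. x \<in> S \<Longrightarrow> G x (f x) = b x\<rbrakk>
    \<Longrightarrow> ck_on k S f"
proof (induction k arbitrary: f b)
  case 0
  then show ?case using continuous_on_linear_solve[of S G b f] lin pos by auto
next
  case (Suc k)
  have "\<forall>v. \<exists>D. (\<forall>x\<in>S. ((\<lambda>x. G x v) has_derivative D x) (at x within S)) \<and> (\<forall>u. ck_on k S (\<lambda>x. D x u))"
    using Suc.prems(1) ck_on_SucE by metis
  then obtain G' where G': "\<And>v x. x \<in> S \<Longrightarrow> ((\<lambda>x. G x v) has_derivative G' v x) (at x within S)"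
     "\<And>v u. ck_on k S (\<lambda>x. G' v x u)" by metis
  obtain b' where b': "\<And>x. x \<in> S \<Longrightarrow> (b has_derivative b' x) (at x within S)"
    "\<And>v. ck_on k S (\<lambda>x. b' x v)" using ck_on_SucE[OF Suc.prems(2)] by metis
  have G: "\<And>v. ck_on k S (\<lambda>x. G x v)" using Suc.prems(1) ck_on_Suc_imp by blast
  have f: "ck_on k S f" using Suc.IH[OF G ck_on_Suc_imp[OF Suc.prems(2)] Suc.prems(3)] .
  show ?case
  proof (rule ck_on_SucI[OF S])
    fix x assume x: "x \<in> S"
    show "(f has_derivative (\<lambda>v. inv (G x) (b' x v - (\<Sum>i\<in>Basis. (f x \<bullet> i) *\<^sub>R G' i x v)))) (at x within S)"
      by (rule has_derivative_linear_solve[where S = S and b = b])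
        (use lin pos Suc.prems(3) ck_on_imp_continuous_on[OF f] b'(1)[OF x] G'(1)[OF x] x in simp_all)
  next
    fix v
    show "ck_on k S (\<lambda>x. inv (G x) (b' x v - (\<Sum>i\<in>Basis. (f x \<bullet> i) *\<^sub>R G' i x v)))"
    proof (rule Suc.IH[OF G])
      show "ck_on k S (\<lambda>x. b' x v - (\<Sum>i\<in>Basis. (f x \<bullet> i) *\<^sub>R G' i x v))"
        using S b'(2) G'(2) f by (intro ck_on_diff ck_on_sum ck_on_scaleR ck_on_inner ck_on_const) auto
    next
      fix x assume "x \<in> S"
      then have "surj (G x)" using positive_linear_bij(1)[of "G x"] lin pos by (auto simp: bij_def)
      then show "G x (inv (G x) (b' x v - (\<Sum>i\<in>Basis. (f x \<bullet> i) *\<^sub>R G' i x v))) =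
          b' x v - (\<Sum>i\<in>Basis. (f x \<bullet> i) *\<^sub>R G' i x v)" by (rule surj_f_inv_f)
    qed
  qed
qed

section \<open>Symmetry of second derivatives\<close>

text \<open>
  By the mean value theorem, applied to the difference of \<open>f\<close> along two parallel segments in direction
  \<open>u\<close>, the second difference is \<open>t\<close> times a difference of two values of \<open>D y u\<close> near \<open>x\<close>, which is computed
  from the derivative \<open>E\<close>. As the second difference is symmetric in \<open>u\<close> and \<open>v\<close>, so is its limit.
\<close>

lemma second_difference_tendsto:
  fixes f :: "'a::real_normed_vector \<Rightarrow> real"
  assumes "open U" "x \<in> U" and D: "\<And>y. y \<in> U \<Longrightarrow> (f has_derivative D y) (at y)"
    and E: "((\<lambda>y. D y u) has_derivative E) (at x)"
  shows "((\<lambda>t. (f (x + t *\<^sub>R u + t *\<^sub>R v) - f (x + t *\<^sub>R u) - f (x + t *\<^sub>R v) + f x) / t\<^sup>2) \<longlongrightarrow> E v) (at_right 0)"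
proof -
  obtain r where r: "0 < r" "ball x r \<subseteq> U" using assms(1,2) openE by blast
  \<comment> \<open>All points that occur are within distance t N of x.\<close>
  define N where "N = norm u + norm v + 1"
  have N: "0 < N" by (simp add: N_def add_nonneg_pos)
  interpret E: bounded_linear E using E by (rule has_derivative_bounded_linear)
  show ?thesis
  proof (rule tendstoI)
    fix e :: real assume e: "0 < e"
    obtain d where d: "0 < d" "\<And>y. norm (y - x) < d \<Longrightarrow> norm (D y u - D x u - E (y - x)) \<le> e / (3 * N) * norm (y - x)"
    proof -
      have "0 < e / (3 * N)" using e N by simp
      with E show thesis unfolding has_derivative_at_alt using that by metis
    qed
    have "\<forall>\<^sub>F t in at_right 0. t < min r d / N"
      using r d N by (intro eventually_at_rightI[of 0 "min r d / N"]) auto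
    moreover have "\<forall>\<^sub>F t::real in at_right 0. 0 < t" by (simp add: eventually_at_right_less)
    ultimately show "\<forall>\<^sub>F t in at_right 0. dist ((f (x + t *\<^sub>R u + t *\<^sub>R v) - f (x + t *\<^sub>R u) - f (x + t *\<^sub>R v) + f x) / t\<^sup>2) (E v) < e"
    proof eventually_elim
      case (elim t)
      then have tN: "t * N < r" "t * N < d" using N by (auto simp: field_simps)
      have nrm: "norm (s *\<^sub>R u + c *\<^sub>R v) \<le> t * N" if "0 \<le> s" "s \<le> t" "0 \<le> c" "c \<le> t" for s c
      proof -
        have "norm (s *\<^sub>R u + c *\<^sub>R v) \<le> s * norm u + c * norm v"
          using that by (intro norm_triangle_le) auto
        also have "\<dots> \<le> t * norm u + t * norm v" using that by (intro add_mono mult_right_mono) auto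
        also have "\<dots> \<le> t * N" using elim by (simp add: N_def algebra_simps)
        finally show ?thesis .
      qed
      have inU: "x + s *\<^sub>R u + c *\<^sub>R v \<in> U" if "0 \<le> s" "s \<le> t" "0 \<le> c" "c \<le> t" for s c
      proof -
        have "dist (x + s *\<^sub>R u + c *\<^sub>R v) x = norm (s *\<^sub>R u + c *\<^sub>R v)"
          by (simp add: dist_norm)
        then show ?thesis using nrm[OF that] tN r(2) by (auto simp: dist_commute)
      qed
      define \<phi> where "\<phi> s = f (x + s *\<^sub>R u + t *\<^sub>R v) - f (x + s *\<^sub>R u + 0 *\<^sub>R v)" for s
      have der: "(\<phi> has_field_derivative (D (x + s *\<^sub>R u + t *\<^sub>R v) u - D (x + s *\<^sub>R u + 0 *\<^sub>R v) u)) (at s)"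
        if "0 \<le> s" "s \<le> t" for s
      proof -
        have *: "((\<lambda>s. f (x + s *\<^sub>R u + c *\<^sub>R v)) has_field_derivative D (x + s *\<^sub>R u + c *\<^sub>R v) u) (at s)"
          if "0 \<le> c" "c \<le> t" for c
        proof -
          have U: "x + s *\<^sub>R u + c *\<^sub>R v \<in> U" using that \<open>0 \<le> s\<close> \<open>s \<le> t\<close> by (intro inU) auto
          have "((\<lambda>s. f (x + s *\<^sub>R u + c *\<^sub>R v)) has_derivative (\<lambda>h. D (x + s *\<^sub>R u + c *\<^sub>R v) (h *\<^sub>R u))) (at s)"
            by (rule has_derivative_compose[where g = f and f = "\<lambda>s. x + s *\<^sub>R u + c *\<^sub>R v", OF _ D[OF U]]) (auto intro!: derivative_eq_intros)
          moreover have "linear (D (x + s *\<^sub>R u + c *\<^sub>R v))" using D[OF U] has_derivative_linear by blast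
          then have "(\<lambda>h. D (x + s *\<^sub>R u + c *\<^sub>R v) (h *\<^sub>R u)) = (*) (D (x + s *\<^sub>R u + c *\<^sub>R v) u)"
            by (intro ext) (simp add: linear_scale)
          ultimately show ?thesis by (simp add: has_field_derivative_def)
        qed
        show ?thesis unfolding \<phi>_def using elim by (intro DERIV_diff *) auto
      qed
      obtain z where z: "0 < z" "z < t" "\<phi> t - \<phi> 0 = (t - 0) * (D (x + z *\<^sub>R u + t *\<^sub>R v) u - D (x + z *\<^sub>R u + 0 *\<^sub>R v) u)"
        using MVT2[OF elim(2), of \<phi> "\<lambda>s. D (x + s *\<^sub>R u + t *\<^sub>R v) u - D (x + s *\<^sub>R u + 0 *\<^sub>R v) u", OF der]
        by blast
      define p where "p = z *\<^sub>R u + t *\<^sub>R v"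
      define p0 where "p0 = z *\<^sub>R u + 0 *\<^sub>R v"
      have p: "norm p \<le> t * N" "norm p0 \<le> t * N" unfolding p_def p0_def using z by (auto intro!: nrm simp del: scale_zero_left add_0_right)
      have b: "norm (D (x + k) u - D x u - E k) \<le> e / 3 * t" if "norm k \<le> t * N" for k
      proof -
        have "norm (D (x + k) u - D x u - E k) \<le> e / (3 * N) * norm k"
          using d(2)[of "x + k"] that tN by auto
        also have "\<dots> \<le> e / (3 * N) * (t * N)" using that e N by (intro mult_left_mono) auto
        finally show ?thesis using N by simp
      qed
      have Ep: "E p - E p0 = t * E v" unfolding p_def p0_def by (simp add: E.add E.scaleR)
      have "\<bar>(D (x + p) u - D (x + p0) u) - t * E v\<bar> \<le> 2 * (e / 3 * t)"
        using b[OF p(1)] b[OF p(2)] Ep unfolding real_norm_def by linarith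
      then have "\<bar>(D (x + p) u - D (x + p0) u) / t - E v\<bar> \<le> 2 * e / 3"
        using elim(2) by (simp add: abs_le_iff field_simps)
      moreover have "(f (x + t *\<^sub>R u + t *\<^sub>R v) - f (x + t *\<^sub>R u) - f (x + t *\<^sub>R v) + f x) = t * (D (x + p) u - D (x + p0) u)"
        using z(3) by (simp add: \<phi>_def p_def p0_def add.assoc)
      ultimately show ?case using e elim(2) by (simp add: dist_real_def power2_eq_square)
    qed
  qed
qed

lemma second_derivative_symmetric:
  fixes f :: "'a::real_normed_vector \<Rightarrow> real"
  assumes "open U" "x \<in> U" and D: "\<And>y. y \<in> U \<Longrightarrow> (f has_derivative D y) (at y)"
    and E: "((\<lambda>y. D y u) has_derivative E) (at x)" and E': "((\<lambda>y. D y v) has_derivative E') (at x)"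
  shows "E v = E' u"
proof -
  have "((\<lambda>t. (f (x + t *\<^sub>R u + t *\<^sub>R v) - f (x + t *\<^sub>R u) - f (x + t *\<^sub>R v) + f x) / t\<^sup>2) \<longlongrightarrow> E' u) (at_right 0)"
    using second_difference_tendsto[OF assms(1,2) D E', of u] by (simp add: algebra_simps)
  then show ?thesis
    using second_difference_tendsto[OF assms(1,2) D E, of v] tendsto_unique trivial_limit_at_right_real by blast
qed

section \<open>Charts and transition maps\<close>

lemma bilinear_eq_sum_Basis:
  fixes h :: "'a::euclidean_space \<Rightarrow> 'b::euclidean_space \<Rightarrow> 'c::real_vector"
  assumes "bilinear h"
  shows "h v w = (\<Sum>i\<in>Basis. \<Sum>j\<in>Basis. ((v \<bullet> i) * (w \<bullet> j)) *\<^sub>R h i j)"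
proof -
  have "h v w = (\<Sum>i\<in>Basis. (v \<bullet> i) *\<^sub>R h i w)"
    using linear_eq_sum_Basis[of "\<lambda>v. h v w" v] assms by (simp add: bilinear_def)
  also have "\<dots> = (\<Sum>i\<in>Basis. (v \<bullet> i) *\<^sub>R (\<Sum>j\<in>Basis. (w \<bullet> j) *\<^sub>R h i j))"
    using linear_eq_sum_Basis[of "\<lambda>w. h i w" w for i] assms
    by (intro sum.cong) (auto simp: bilinear_def)
  finally show ?thesis by (simp add: scaleR_sum_right)
qed

lemma smooth_onD: "smooth_on S f \<Longrightarrow> ck_on k S f"
  by (simp add: smooth_on_def)

lemma smooth_on_has_derivative:
  assumes "smooth_on S f" "open S" "x \<in> S"
  shows "(f has_derivative frechet_derivative f (at x)) (at x)"
proof -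
  have "ck_on 1 S f" using assms(1) by (rule smooth_onD)
  then have "f differentiable at x within S" using assms(3) by (simp add: differentiable_on_def)
  then show ?thesis
    by (simp add: frechet_derivative_works[symmetric] at_within_open[OF assms(3,2)])
qed

lemma smooth_on_frechet_derivative:
  assumes "smooth_on S f" "open S"
  shows "smooth_on S (\<lambda>x. frechet_derivative f (at x) v)"
  unfolding smooth_on_def
proof
  fix k
  have "ck_on (Suc k) S f" using assms(1) by (rule smooth_onD)
  then have "ck_on k S (\<lambda>x. frechet_derivative f (at x within S) v)" by simp
  then show "ck_on k S (\<lambda>x. frechet_derivative f (at x) v)"
    by (subst ck_on_cong[where g = "\<lambda>x. frechet_derivative f (at x within S) v"])
      (simp_all add: at_within_open[OF _ assms(2)])
qed

lemma frechet_derivative_at_eqI: "(f has_derivative F) (at x) \<Longrightarrow> frechet_derivative f (at x) u = F u"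
  using frechet_derivative_at[of f F x] by simp

locale smooth_manifold =
  fixes A :: "('q::topological_space, 'e::euclidean_space) chart set"
  assumes atlas: "smooth_atlas A"
begin

abbreviation coords :: "('q, 'e) chart \<Rightarrow> 'e set" where
  "coords \<kappa> \<equiv> snd \<kappa> ` fst \<kappa>"

abbreviation overlap :: "('q, 'e) chart \<Rightarrow> ('q, 'e) chart \<Rightarrow> 'e set" where
  "overlap \<kappa> \<kappa>' \<equiv> snd \<kappa> ` (fst \<kappa> \<inter> fst \<kappa>')"

abbreviation Dtrans :: "('q, 'e) chart \<Rightarrow> ('q, 'e) chart \<Rightarrow> 'e \<Rightarrow> 'e \<Rightarrow> 'e" where
  "Dtrans \<kappa> \<kappa>' x \<equiv> frechet_derivative (transition \<kappa> \<kappa>') (at x)"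

text \<open>
  The first vector is the direction of differentiation.
\<close>

definition D2trans :: "('q, 'e) chart \<Rightarrow> ('q, 'e) chart \<Rightarrow> 'e \<Rightarrow> 'e \<Rightarrow> 'e \<Rightarrow> 'e" where
  "D2trans \<kappa> \<kappa>' x u v = frechet_derivative (\<lambda>y. Dtrans \<kappa> \<kappa>' y v) (at x) u"

lemma
  assumes "\<kappa> \<in> A"
  shows open_chart: "open (fst \<kappa>)" and open_coords: "open (coords \<kappa>)"
    and chart_homeo: "homeomorphism (fst \<kappa>) (coords \<kappa>) (snd \<kappa>) (chart_inv \<kappa>)"
  using atlas assms unfolding smooth_atlas_def by blast+

lemma chart_at: obtains \<kappa> where "\<kappa> \<in> A" "p \<in> fst \<kappa>"
  using atlas unfolding smooth_atlas_def by blast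

lemma
  assumes "\<kappa> \<in> A"
  shows chart_inv_chart: "p \<in> fst \<kappa> \<Longrightarrow> chart_inv \<kappa> (snd \<kappa> p) = p"
    and chart_chart_inv: "x \<in> coords \<kappa> \<Longrightarrow> snd \<kappa> (chart_inv \<kappa> x) = x"
    and chart_inv_in: "x \<in> coords \<kappa> \<Longrightarrow> chart_inv \<kappa> x \<in> fst \<kappa>"
    and continuous_on_chart: "continuous_on (fst \<kappa>) (snd \<kappa>)"
    and continuous_on_chart_inv: "continuous_on (coords \<kappa>) (chart_inv \<kappa>)"
  using chart_homeo[OF assms] by (auto simp: homeomorphism_def)

lemma open_overlap:
  assumes "\<kappa> \<in> A" "\<kappa>' \<in> A" shows "open (overlap \<kappa> \<kappa>')"
proof -
  have "openin (top_of_set (coords \<kappa>)) (overlap \<kappa> \<kappa>')"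
    using homeomorphism_imp_open_map[OF chart_homeo[OF assms(1)]] open_chart[OF assms(2)]
    by (auto simp: openin_open_Int)
  then show ?thesis using open_coords[OF assms(1)] openin_open_eq by blast
qed

lemma overlap_subset: "overlap \<kappa> \<kappa>' \<subseteq> coords \<kappa>" by auto

lemma transition_apply: "\<kappa> \<in> A \<Longrightarrow> p \<in> fst \<kappa> \<Longrightarrow> transition \<kappa> \<kappa>' (snd \<kappa> p) = snd \<kappa>' p"
  by (simp add: transition_def chart_inv_chart)

lemma transition_in_overlap: "\<kappa> \<in> A \<Longrightarrow> x \<in> overlap \<kappa> \<kappa>' \<Longrightarrow> transition \<kappa> \<kappa>' x \<in> overlap \<kappa>' \<kappa>"
  by (auto simp: transition_apply)

lemma transition_inverse:
  "\<kappa> \<in> A \<Longrightarrow> \<kappa>' \<in> A \<Longrightarrow> x \<in> overlap \<kappa> \<kappa>' \<Longrightarrow> transition \<kappa>' \<kappa> (transition \<kappa> \<kappa>' x) = x"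
  by (auto simp: transition_apply)

lemma transition_smooth: "\<kappa> \<in> A \<Longrightarrow> \<kappa>' \<in> A \<Longrightarrow> smooth_on (overlap \<kappa> \<kappa>') (transition \<kappa> \<kappa>')"
  using atlas unfolding smooth_atlas_def by blast

lemma transition_has_derivative:
  assumes "\<kappa> \<in> A" "\<kappa>' \<in> A" "x \<in> overlap \<kappa> \<kappa>'"
  shows "(transition \<kappa> \<kappa>' has_derivative Dtrans \<kappa> \<kappa>' x) (at x)"
  using smooth_on_has_derivative[OF transition_smooth open_overlap] assms by blast

lemma Dtrans_linear:
  assumes "\<kappa> \<in> A" "\<kappa>' \<in> A" "x \<in> overlap \<kappa> \<kappa>'"
  shows "linear (Dtrans \<kappa> \<kappa>' x)"
  using transition_has_derivative[OF assms] has_derivative_linear by blast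

lemma Dtrans_has_derivative:
  assumes "\<kappa> \<in> A" "\<kappa>' \<in> A" "x \<in> overlap \<kappa> \<kappa>'"
  shows "((\<lambda>y. Dtrans \<kappa> \<kappa>' y v) has_derivative (\<lambda>u. D2trans \<kappa> \<kappa>' x u v)) (at x)"
  unfolding D2trans_def
  using smooth_on_has_derivative[OF smooth_on_frechet_derivative[OF transition_smooth open_overlap] open_overlap]
    assms by blast

text \<open>
  The transition maps in the two directions are inverse to each other; apply the chain rule.
\<close>

lemma Dtrans_inverse:
  assumes "\<kappa> \<in> A" "\<kappa>' \<in> A" "x \<in> overlap \<kappa> \<kappa>'"
  shows "Dtrans \<kappa>' \<kappa> (transition \<kappa> \<kappa>' x) (Dtrans \<kappa> \<kappa>' x v) = v"
proof -
  have "(transition \<kappa>' \<kappa> \<circ> transition \<kappa> \<kappa>' has_derivative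
      Dtrans \<kappa>' \<kappa> (transition \<kappa> \<kappa>' x) \<circ> Dtrans \<kappa> \<kappa>' x) (at x)"
    using assms by (intro diff_chain_at transition_has_derivative transition_in_overlap)
  moreover have "(transition \<kappa>' \<kappa> \<circ> transition \<kappa> \<kappa>' has_derivative (\<lambda>v. v)) (at x)"
    using has_derivative_transform_within_open[OF has_derivative_ident[of "at x"] open_overlap[OF assms(1,2)] assms(3),
       of "transition \<kappa>' \<kappa> \<circ> transition \<kappa> \<kappa>'"] transition_inverse[OF assms(1,2)] by simp
  ultimately have "Dtrans \<kappa>' \<kappa> (transition \<kappa> \<kappa>' x) \<circ> Dtrans \<kappa> \<kappa>' x = (\<lambda>v. v)"
    by (rule has_derivative_unique)
  then show ?thesis by (metis comp_apply)
qed

lemma D2trans_bilinear: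
  assumes "\<kappa> \<in> A" "\<kappa>' \<in> A" "x \<in> overlap \<kappa> \<kappa>'"
  shows "bilinear (D2trans \<kappa> \<kappa>' x)"
proof -
  note D = Dtrans_has_derivative[OF assms]
  note tr = has_derivative_transform_within_open[OF _ open_overlap[OF assms(1,2)] assms(3)]
  have "D2trans \<kappa> \<kappa>' x u (v + w) = D2trans \<kappa> \<kappa>' x u v + D2trans \<kappa> \<kappa>' x u w" for u v w
    using frechet_derivative_at_eqI[OF tr[OF has_derivative_add[OF D[of v] D[of w]]], of "\<lambda>y. Dtrans \<kappa> \<kappa>' y (v + w)"]
      Dtrans_linear[OF assms(1,2)] by (simp add: D2trans_def linear_add)
  moreover have "D2trans \<kappa> \<kappa>' x u (c *\<^sub>R v) = c *\<^sub>R D2trans \<kappa> \<kappa>' x u v" for u c v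
    using frechet_derivative_at_eqI[OF tr[OF has_derivative_scaleR_right[OF D[of v], of c]], of "\<lambda>y. Dtrans \<kappa> \<kappa>' y (c *\<^sub>R v)"]
      Dtrans_linear[OF assms(1,2)] by (simp add: D2trans_def linear_scale)
  ultimately show ?thesis unfolding bilinear_def
    using has_derivative_linear[OF D] by (auto intro!: linearI)
qed

lemma D2trans_symmetric:
  assumes "\<kappa> \<in> A" "\<kappa>' \<in> A" "x \<in> overlap \<kappa> \<kappa>'"
  shows "D2trans \<kappa> \<kappa>' x u v = D2trans \<kappa> \<kappa>' x v u"
proof (rule euclidean_eqI)
  fix i :: 'e assume "i \<in> Basis"
  show "D2trans \<kappa> \<kappa>' x u v \<bullet> i = D2trans \<kappa> \<kappa>' x v u \<bullet> i"
    by (rule second_derivative_symmetric[OF open_overlap[OF assms(1,2)] assms(3),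
        of "\<lambda>y. transition \<kappa> \<kappa>' y \<bullet> i" "\<lambda>y v. Dtrans \<kappa> \<kappa>' y v \<bullet> i"])
      (auto intro!: has_derivative_inner_left transition_has_derivative Dtrans_has_derivative assms)
qed

end

section \<open>The Levi-Civita connection in charts\<close>

locale riemannian_manifold = smooth_manifold A
  for A :: "('q::topological_space, 'e::euclidean_space) chart set" +
  fixes g :: "('q, 'e) metric"
  assumes metric: "riemannian_metric A g"
begin

lemma
  assumes "\<kappa> \<in> A" "x \<in> coords \<kappa>"
  shows metric_bilinear: "bilinear (g \<kappa> x)"
    and metric_sym: "g \<kappa> x v w = g \<kappa> x w v"
    and metric_pos: "v \<noteq> 0 \<Longrightarrow> 0 < g \<kappa> x v v"
  using metric assms unfolding riemannian_metric_def by blast+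

lemma metric_smooth: "\<kappa> \<in> A \<Longrightarrow> smooth_on (coords \<kappa>) (\<lambda>x. g \<kappa> x v w)"
  using metric unfolding riemannian_metric_def by blast

lemma metric_transition:
  assumes "\<kappa> \<in> A" "\<kappa>' \<in> A" "x \<in> overlap \<kappa> \<kappa>'"
  shows "g \<kappa> x v w = g \<kappa>' (transition \<kappa> \<kappa>' x) (Dtrans \<kappa> \<kappa>' x v) (Dtrans \<kappa> \<kappa>' x w)"
  using metric assms unfolding riemannian_metric_def by blast

text \<open>
  The operator that represents the metric with respect to the Euclidean inner product.
\<close>

definition gram :: "('q, 'e) chart \<Rightarrow> 'e \<Rightarrow> 'e \<Rightarrow> 'e" where
  "gram \<kappa> x v = (\<Sum>i\<in>Basis. g \<kappa> x v i *\<^sub>R i)"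

lemma gram_inner: "\<kappa> \<in> A \<Longrightarrow> x \<in> coords \<kappa> \<Longrightarrow> gram \<kappa> x v \<bullet> w = g \<kappa> x v w"
  using linear_eq_sum_Basis[of "g \<kappa> x v" w] metric_bilinear[of \<kappa> x]
  by (simp add: gram_def inner_sum_left bilinear_def inner_commute[of w] mult.commute)

lemma gram_linear: "\<kappa> \<in> A \<Longrightarrow> x \<in> coords \<kappa> \<Longrightarrow> linear (gram \<kappa> x)"
  using metric_bilinear[of \<kappa> x] unfolding gram_def
  by (intro linearI)
    (auto simp: bilinear_ladd bilinear_lmul scaleR_add_left sum.distrib scaleR_sum_right)

lemma gram_pos: "\<kappa> \<in> A \<Longrightarrow> x \<in> coords \<kappa> \<Longrightarrow> v \<noteq> 0 \<Longrightarrow> 0 < gram \<kappa> x v \<bullet> v"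
  by (simp add: gram_inner metric_pos)

lemma gram_ck: "\<kappa> \<in> A \<Longrightarrow> ck_on k (coords \<kappa>) (\<lambda>x. gram \<kappa> x v)"
  unfolding gram_def
  by (intro ck_on_sum ck_on_scaleR ck_on_const unique_derivs_open open_coords smooth_onD[OF metric_smooth])

definition dg :: "('q, 'e) chart \<Rightarrow> 'e \<Rightarrow> 'e \<Rightarrow> 'e \<Rightarrow> 'e \<Rightarrow> real" where
  "dg \<kappa> x u v w = frechet_derivative (\<lambda>y. g \<kappa> y v w) (at x) u"

lemma dg_has_derivative:
  assumes "\<kappa> \<in> A" "x \<in> coords \<kappa>"
  shows "((\<lambda>y. g \<kappa> y v w) has_derivative (\<lambda>u. dg \<kappa> x u v w)) (at x)"
  unfolding dg_def using smooth_on_has_derivative[OF metric_smooth open_coords] assms by blast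

lemma dg_linear: "\<kappa> \<in> A \<Longrightarrow> x \<in> coords \<kappa> \<Longrightarrow> linear (\<lambda>u. dg \<kappa> x u v w)"
  using dg_has_derivative has_derivative_linear by blast

lemma dg_eqI:
  assumes "\<kappa> \<in> A" "x \<in> U" "open U" "\<And>y. y \<in> U \<Longrightarrow> g \<kappa> y v w = F y" "(F has_derivative F') (at x)"
  shows "dg \<kappa> x u v w = F' u"
  unfolding dg_def
  using has_derivative_transform_within_open[OF assms(5,3,2), of "\<lambda>y. g \<kappa> y v w"] assms(4)
  by (intro frechet_derivative_at_eqI) auto

text \<open>
  Bilinearity of the coefficients is only available at coordinate points, but the derivative at such
  a point depends on the coefficients near it only.
\<close>

lemma dg_bilinear:
  assumes "\<kappa> \<in> A" "x \<in> coords \<kappa>" shows "bilinear (dg \<kappa> x u)"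
proof -
  note B = metric_bilinear[OF assms(1)]
  note D = dg_has_derivative[OF assms]
  note eqI = dg_eqI[OF assms open_coords[OF assms(1)]]
  show ?thesis unfolding bilinear_def
    by (intro conjI allI linearI)
      (rule eqI, fastforce simp: bilinear_radd[OF B] bilinear_rmul[OF B] bilinear_ladd[OF B] bilinear_lmul[OF B],
        auto intro!: derivative_eq_intros D)+
qed

lemma dg_sym:
  assumes "\<kappa> \<in> A" "x \<in> coords \<kappa>" shows "dg \<kappa> x u v w = dg \<kappa> x u w v"
  by (rule dg_eqI[OF assms open_coords[OF assms(1)] metric_sym[OF assms(1)] dg_has_derivative[OF assms]])

lemma dg_ck: "\<kappa> \<in> A \<Longrightarrow> ck_on k (coords \<kappa>) (\<lambda>x. dg \<kappa> x u v w)"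
  unfolding dg_def by (intro smooth_onD smooth_on_frechet_derivative metric_smooth open_coords)

text \<open>
  Koszul's expression for \<open>g(\<Gamma>(u, v), w)\<close>, the Christoffel symbol of the first kind.
\<close>

definition koszul :: "('q, 'e) chart \<Rightarrow> 'e \<Rightarrow> 'e \<Rightarrow> 'e \<Rightarrow> 'e \<Rightarrow> real" where
  "koszul \<kappa> x u v w = (dg \<kappa> x u v w + dg \<kappa> x v u w - dg \<kappa> x w u v) / 2"

text \<open>
  The property that singles out the bilinear map in the definition of \<open>christoffel\<close>.
\<close>

definition levi_civita :: "('q, 'e) chart \<Rightarrow> 'e \<Rightarrow> ('e \<Rightarrow> 'e \<Rightarrow> 'e) \<Rightarrow> bool" where
  "levi_civita \<kappa> x \<Gamma> \<longleftrightarrow> bilinear \<Gamma> \<and> (\<forall>u w. \<Gamma> u w = \<Gamma> w u) \<and>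
     (\<forall>u v w. dg \<kappa> x u v w = g \<kappa> x (\<Gamma> u v) w + g \<kappa> x v (\<Gamma> u w))"

text \<open>
  Koszul's trick: write metric compatibility for the three cyclic arrangements of the arguments; by
  symmetry all but two of the terms cancel. Uniqueness of the connection is a consequence.
\<close>

lemma levi_civita_koszul:
  assumes "\<kappa> \<in> A" "x \<in> coords \<kappa>" "levi_civita \<kappa> x \<Gamma>"
  shows "g \<kappa> x (\<Gamma> u v) w = koszul \<kappa> x u v w"
proof -
  have c: "dg \<kappa> x u v w = g \<kappa> x (\<Gamma> u v) w + g \<kappa> x v (\<Gamma> u w)" for u v w
    using assms(3) unfolding levi_civita_def by blast
  have s: "\<Gamma> u v = \<Gamma> v u" for u v
    using assms(3) unfolding levi_civita_def by blast
  show ?thesis unfolding koszul_def c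
    using s[of v u] s[of w u] s[of w v] metric_sym[OF assms(1,2)] by simp
qed

lemma levi_civita_unique:
  assumes "\<kappa> \<in> A" "x \<in> coords \<kappa>" "levi_civita \<kappa> x \<Gamma>" "levi_civita \<kappa> x \<Gamma>'"
  shows "\<Gamma> = \<Gamma>'"
proof (intro ext)
  fix u v
  have "g \<kappa> x (\<Gamma> u v - \<Gamma>' u v) (\<Gamma> u v - \<Gamma>' u v) = 0"
    using levi_civita_koszul[OF assms(1,2)] assms(3,4) metric_bilinear[OF assms(1,2)]
    by (simp add: bilinear_lsub)
  then show "\<Gamma> u v = \<Gamma>' u v" using metric_pos[OF assms(1,2), of "\<Gamma> u v - \<Gamma>' u v"] by fastforce
qed

lemma koszul_linear:
  assumes "\<kappa> \<in> A" "x \<in> coords \<kappa>"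
  shows "linear (\<lambda>u. koszul \<kappa> x u v w)" "linear (\<lambda>v. koszul \<kappa> x u v w)" "linear (\<lambda>w. koszul \<kappa> x u v w)"
proof -
  note L = linear_add[OF dg_linear[OF assms]] linear_scale[OF dg_linear[OF assms]]
    bilinear_ladd[OF dg_bilinear[OF assms]] bilinear_lmul[OF dg_bilinear[OF assms]]
    bilinear_radd[OF dg_bilinear[OF assms]] bilinear_rmul[OF dg_bilinear[OF assms]]
  show "linear (\<lambda>u. koszul \<kappa> x u v w)" "linear (\<lambda>v. koszul \<kappa> x u v w)" "linear (\<lambda>w. koszul \<kappa> x u v w)"
    by (rule linearI; simp add: koszul_def L field_simps)+
qed

text \<open>
  Koszul's formula determines \<open>\<Gamma>(u, v)\<close> by its inner products, that is, as the solution of a linear system.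
\<close>

lemma levi_civita_exists:
  assumes "\<kappa> \<in> A" "x \<in> coords \<kappa>"
  shows "\<exists>\<Gamma>. levi_civita \<kappa> x \<Gamma>"
proof -
  define b where "b u v = (\<Sum>i\<in>Basis. koszul \<kappa> x u v i *\<^sub>R i)" for u v
  define \<Gamma> where "\<Gamma> u v = inv (gram \<kappa> x) (b u v)" for u v
  note bij = positive_linear_bij[OF gram_linear[OF assms] gram_pos[OF assms]]
  have b: "b u v \<bullet> w = koszul \<kappa> x u v w" for u v w
    using linear_eq_sum_Basis[OF koszul_linear(3)[OF assms], of u v w]
    by (simp add: b_def inner_sum_left inner_commute[of w] mult.commute)
  have "gram \<kappa> x (\<Gamma> u v) = b u v" for u v
    using bij(1) by (simp add: \<Gamma>_def bij_def surj_f_inv_f)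
  then have \<Gamma>: "g \<kappa> x (\<Gamma> u v) w = koszul \<kappa> x u v w" for u v w
    using b gram_inner[OF assms] by metis
  have "linear (\<lambda>v. b u v)" "linear (\<lambda>u. b u v)" for u v
    unfolding b_def
    by (auto intro!: linearI simp: linear_add[OF koszul_linear(1)[OF assms]] linear_scale[OF koszul_linear(1)[OF assms]]
      linear_add[OF koszul_linear(2)[OF assms]] linear_scale[OF koszul_linear(2)[OF assms]]
      scaleR_add_left sum.distrib scaleR_sum_right)
  then have "bilinear \<Gamma>" unfolding bilinear_def \<Gamma>_def
    using linear_compose[OF _ bij(2)] by (auto simp: comp_def)
  moreover have "\<Gamma> u v = \<Gamma> v u" for u v
  proof -
    have "koszul \<kappa> x u v w = koszul \<kappa> x v u w" for w
      unfolding koszul_def using dg_sym[OF assms] by simp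
    then show ?thesis by (simp add: \<Gamma>_def b_def)
  qed
  moreover have "dg \<kappa> x u v w = g \<kappa> x (\<Gamma> u v) w + g \<kappa> x v (\<Gamma> u w)" for u v w
    using metric_sym[OF assms, of v "\<Gamma> u w"] \<Gamma>[of u v w] \<Gamma>[of u w v]
      dg_sym[OF assms, of u v w] dg_sym[OF assms, of v u w] dg_sym[OF assms, of w u v]
    unfolding koszul_def by (simp only:) (simp add: field_simps)
  ultimately show ?thesis unfolding levi_civita_def by blast
qed

lemma levi_civita_christoffel:
  assumes "\<kappa> \<in> A" "x \<in> coords \<kappa>"
  shows "levi_civita \<kappa> x (christoffel g \<kappa> x)"
proof -
  have "christoffel g \<kappa> x = (THE \<Gamma>. levi_civita \<kappa> x \<Gamma>)"
    by (simp add: christoffel_def levi_civita_def dg_def)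
  moreover have "\<exists>!\<Gamma>. levi_civita \<kappa> x \<Gamma>"
    using levi_civita_exists[OF assms] levi_civita_unique[OF assms] by blast
  ultimately show ?thesis by (simp add: theI')
qed

lemma
  assumes "\<kappa> \<in> A" "x \<in> coords \<kappa>"
  shows christoffel_bilinear: "bilinear (christoffel g \<kappa> x)"
    and christoffel_sym: "christoffel g \<kappa> x u v = christoffel g \<kappa> x v u"
    and christoffel_compatible: "dg \<kappa> x u v w =
        g \<kappa> x (christoffel g \<kappa> x u v) w + g \<kappa> x v (christoffel g \<kappa> x u w)"
  using levi_civita_christoffel[OF assms] unfolding levi_civita_def by blast+

text \<open>
  The linear system that defines the Christoffel symbols has smooth coefficients and a smooth right hand side.
\<close>

lemma christoffel_ck:
  assumes "\<kappa> \<in> A"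
  shows "ck_on k (coords \<kappa>) (\<lambda>x. christoffel g \<kappa> x u v)"
proof (rule ck_on_linear_solve[where G = "gram \<kappa>"])
  show "ck_on k (coords \<kappa>) (\<lambda>x. \<Sum>i\<in>Basis. ((dg \<kappa> x u v i + dg \<kappa> x v u i - dg \<kappa> x i u v) * (1 / 2)) *\<^sub>R i)"
    using unique_derivs_open[OF open_coords[OF assms]]
    by (intro ck_on_sum ck_on_scaleR ck_on_mult ck_on_const ck_on_add ck_on_diff dg_ck assms)
  fix x assume x: "x \<in> coords \<kappa>"
  show "gram \<kappa> x (christoffel g \<kappa> x u v) =
      (\<Sum>i\<in>Basis. ((dg \<kappa> x u v i + dg \<kappa> x v u i - dg \<kappa> x i u v) * (1 / 2)) *\<^sub>R i)"
    unfolding gram_def levi_civita_koszul[OF assms x levi_civita_christoffel[OF assms x]]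
    by (simp add: koszul_def)
qed (use assms gram_linear gram_pos gram_ck open_coords in \<open>auto intro: unique_derivs_open\<close>)

lemma metric_along_has_derivative:
  assumes \<kappa>: "\<kappa> \<in> A" and U: "open U" "x \<in> U" and pU: "\<And>y. y \<in> U \<Longrightarrow> p y \<in> coords \<kappa>"
    and p: "(p has_derivative p') (at x)"
    and X: "(X has_derivative X') (at x)" and Y: "(Y has_derivative Y') (at x)"
  shows "((\<lambda>y. g \<kappa> (p y) (X y) (Y y)) has_derivative
    (\<lambda>u. dg \<kappa> (p x) (p' u) (X x) (Y x) + g \<kappa> (p x) (X' u) (Y x) + g \<kappa> (p x) (X x) (Y' u))) (at x)"
proof -
  have px: "p x \<in> coords \<kappa>" using pU U by blast
  have gp: "((\<lambda>y. g \<kappa> (p y) i j) has_derivative (\<lambda>u. dg \<kappa> (p x) (p' u) i j)) (at x)" for i j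
    using has_derivative_compose[OF p dg_has_derivative[OF \<kappa> px]] .
  have "((\<lambda>y. \<Sum>i\<in>Basis. \<Sum>j\<in>Basis. ((X y \<bullet> i) * (Y y \<bullet> j)) * g \<kappa> (p y) i j) has_derivative
     (\<lambda>u. \<Sum>i\<in>Basis. \<Sum>j\<in>Basis. ((X x \<bullet> i) * (Y x \<bullet> j)) * dg \<kappa> (p x) (p' u) i j +
        ((X x \<bullet> i) * (Y' u \<bullet> j) + (X' u \<bullet> i) * (Y x \<bullet> j)) * g \<kappa> (p x) i j)) (at x)"
    by (intro has_derivative_sum has_derivative_mult has_derivative_inner_left X Y gp)
  moreover have "(\<lambda>u. \<Sum>i\<in>Basis. \<Sum>j\<in>Basis. ((X x \<bullet> i) * (Y x \<bullet> j)) * dg \<kappa> (p x) (p' u) i j +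
        ((X x \<bullet> i) * (Y' u \<bullet> j) + (X' u \<bullet> i) * (Y x \<bullet> j)) * g \<kappa> (p x) i j) =
     (\<lambda>u. dg \<kappa> (p x) (p' u) (X x) (Y x) + g \<kappa> (p x) (X' u) (Y x) + g \<kappa> (p x) (X x) (Y' u))"
  proof
    fix u
    note B = bilinear_eq_sum_Basis[OF metric_bilinear[OF \<kappa> px]]
    show "(\<Sum>i\<in>Basis. \<Sum>j\<in>Basis. ((X x \<bullet> i) * (Y x \<bullet> j)) * dg \<kappa> (p x) (p' u) i j +
        ((X x \<bullet> i) * (Y' u \<bullet> j) + (X' u \<bullet> i) * (Y x \<bullet> j)) * g \<kappa> (p x) i j) =
      dg \<kappa> (p x) (p' u) (X x) (Y x) + g \<kappa> (p x) (X' u) (Y x) + g \<kappa> (p x) (X x) (Y' u)"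
      unfolding B[of "X' u" "Y x"] B[of "X x" "Y' u"]
        bilinear_eq_sum_Basis[OF dg_bilinear[OF \<kappa> px], of "p' u" "X x" "Y x"] sum.distrib[symmetric]
      by (intro sum.cong refl) (simp add: algebra_simps)
  qed
  ultimately have *: "((\<lambda>y. \<Sum>i\<in>Basis. \<Sum>j\<in>Basis. ((X y \<bullet> i) * (Y y \<bullet> j)) * g \<kappa> (p y) i j) has_derivative
    (\<lambda>u. dg \<kappa> (p x) (p' u) (X x) (Y x) + g \<kappa> (p x) (X' u) (Y x) + g \<kappa> (p x) (X x) (Y' u))) (at x)" by simp
  have eq: "(\<Sum>i\<in>Basis. \<Sum>j\<in>Basis. ((X y \<bullet> i) * (Y y \<bullet> j)) * g \<kappa> (p y) i j) = g \<kappa> (p y) (X y) (Y y)" if "y \<in> U" for y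
    using bilinear_eq_sum_Basis[OF metric_bilinear[OF \<kappa> pU[OF that]], of "X y" "Y y"] by simp
  show ?thesis by (rule has_derivative_transform_within_open[OF * U eq])
qed

text \<open>
  The right hand side, pulled back to the chart \<open>\<kappa>\<close>, is symmetric because second derivatives of the
  transition map are, and it is metric because the metric transforms as a tensor: differentiating
  \<open>g = g'(D\<phi>, D\<phi>)\<close> produces the compatibility of \<open>\<Gamma>'\<close> together with the second derivatives of \<open>\<phi>\<close>.
  By uniqueness of the connection it is the Christoffel symbol of \<open>\<kappa>\<close>.
\<close>

lemma christoffel_transition:
  assumes \<kappa>: "\<kappa> \<in> A" and \<kappa>': "\<kappa>' \<in> A" and x: "x \<in> overlap \<kappa> \<kappa>'"
  shows "Dtrans \<kappa> \<kappa>' x (christoffel g \<kappa> x u w) = D2trans \<kappa> \<kappa>' x u w +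
      christoffel g \<kappa>' (transition \<kappa> \<kappa>' x) (Dtrans \<kappa> \<kappa>' x u) (Dtrans \<kappa> \<kappa>' x w)"
proof -
  define \<phi> where "\<phi> = transition \<kappa> \<kappa>'"
  define D where "D = Dtrans \<kappa> \<kappa>' x"
  define J where "J = Dtrans \<kappa>' \<kappa> (\<phi> x)"
  \<comment> \<open>The right hand side of the transformation law; J, the inverse of D, pulls it back to the first chart.\<close>
  define E where "E u w = D2trans \<kappa> \<kappa>' x u w + christoffel g \<kappa>' (\<phi> x) (D u) (D w)" for u w
  have y: "\<phi> x \<in> overlap \<kappa>' \<kappa>" using transition_in_overlap[OF \<kappa> x] by (simp add: \<phi>_def)
  have x1: "x \<in> coords \<kappa>" and y1: "\<phi> x \<in> coords \<kappa>'" using x y by auto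
  have lin: "linear D" "linear J"
    using Dtrans_linear[OF \<kappa> \<kappa>' x] Dtrans_linear[OF \<kappa>' \<kappa> y] by (simp_all add: D_def J_def)
  have DJ: "D (J v) = v" for v
    using Dtrans_inverse[OF \<kappa>' \<kappa> y] transition_inverse[OF \<kappa> \<kappa>' x] by (simp add: D_def J_def \<phi>_def)
  note C = christoffel_bilinear[OF \<kappa>' y1] and D2 = D2trans_bilinear[OF \<kappa> \<kappa>' x]
  have Esym: "E u w = E w u" for u w
    using D2trans_symmetric[OF \<kappa> \<kappa>' x] christoffel_sym[OF \<kappa>' y1] by (simp add: E_def)
  have "bilinear (\<lambda>u w. J (E u w))"
    unfolding bilinear_def E_def
    using lin
    by (intro conjI allI linearI)
      (simp_all add: linear_add linear_scale bilinear_ladd[OF C] bilinear_radd[OF C] bilinear_lmul[OF C] bilinear_rmul[OF C]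
       bilinear_ladd[OF D2] bilinear_radd[OF D2] bilinear_lmul[OF D2] bilinear_rmul[OF D2] scaleR_add_right)
  moreover have "dg \<kappa> x u v w = g \<kappa> x (J (E u v)) w + g \<kappa> x v (J (E u w))" for u v w
  proof -
    have "((\<lambda>y. g \<kappa>' (\<phi> y) (Dtrans \<kappa> \<kappa>' y v) (Dtrans \<kappa> \<kappa>' y w)) has_derivative
      (\<lambda>u. dg \<kappa>' (\<phi> x) (D u) (D v) (D w) + g \<kappa>' (\<phi> x) (D2trans \<kappa> \<kappa>' x u v) (D w) +
          g \<kappa>' (\<phi> x) (D v) (D2trans \<kappa> \<kappa>' x u w))) (at x)"
      unfolding \<phi>_def D_def
      by (rule metric_along_has_derivative[OF \<kappa>' open_overlap[OF \<kappa> \<kappa>'] x _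
         transition_has_derivative Dtrans_has_derivative Dtrans_has_derivative])
       (use transition_in_overlap[OF \<kappa>] overlap_subset \<kappa> \<kappa>' x in blast)+
    from dg_eqI[OF \<kappa> x open_overlap[OF \<kappa> \<kappa>'] _ this, of v w u]
    have "dg \<kappa> x u v w = dg \<kappa>' (\<phi> x) (D u) (D v) (D w) + g \<kappa>' (\<phi> x) (D2trans \<kappa> \<kappa>' x u v) (D w) +
          g \<kappa>' (\<phi> x) (D v) (D2trans \<kappa> \<kappa>' x u w)"
      using metric_transition[OF \<kappa> \<kappa>'] by (simp add: \<phi>_def)
    also have "\<dots> = g \<kappa>' (\<phi> x) (E u v) (D w) + g \<kappa>' (\<phi> x) (D v) (E u w)"
      using metric_bilinear[OF \<kappa>' y1] christoffel_compatible[OF \<kappa>' y1]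
      by (simp add: E_def bilinear_ladd bilinear_radd)
    also have "\<dots> = g \<kappa> x (J (E u v)) w + g \<kappa> x v (J (E u w))"
      using metric_transition[OF \<kappa> \<kappa>' x] DJ by (simp add: D_def \<phi>_def)
    finally show ?thesis .
  qed
  ultimately have "levi_civita \<kappa> x (\<lambda>u w. J (E u w))"
    unfolding levi_civita_def using Esym by auto
  then have "christoffel g \<kappa> x = (\<lambda>u w. J (E u w))"
    using levi_civita_unique[OF \<kappa> x1 levi_civita_christoffel[OF \<kappa> x1]] by blast
  then show ?thesis using DJ by (simp add: E_def D_def \<phi>_def)
qed

lemma tnorm_chart:
  assumes \<kappa>: "\<kappa> \<in> A" "p \<in> fst \<kappa>" and v: "v \<in> tangent_space A p"
  shows "(tnorm A g p v)\<^sup>2 = g \<kappa> (snd \<kappa> p) (v \<kappa>) (v \<kappa>)"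
proof -
  define \<kappa>' where "\<kappa>' = (SOME \<kappa>. \<kappa> \<in> A \<and> p \<in> fst \<kappa>)"
  have \<kappa>': "\<kappa>' \<in> A" "p \<in> fst \<kappa>'" using someI[of "\<lambda>\<kappa>. \<kappa> \<in> A \<and> p \<in> fst \<kappa>"] \<kappa> by (auto simp: \<kappa>'_def)
  have "0 \<le> g \<kappa>' (snd \<kappa>' p) (v \<kappa>') (v \<kappa>')"
    using metric_pos[OF \<kappa>'(1), of "snd \<kappa>' p" "v \<kappa>'"] metric_bilinear[OF \<kappa>'(1), of "snd \<kappa>' p"] \<kappa>'(2)
    by (cases "v \<kappa>' = 0") (auto simp: bilinear_lzero)
  then have "(tnorm A g p v)\<^sup>2 = g \<kappa>' (snd \<kappa>' p) (v \<kappa>') (v \<kappa>')"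
    by (simp add: tnorm_def \<kappa>'_def[symmetric])
  moreover have "v \<kappa>' = Dtrans \<kappa> \<kappa>' (snd \<kappa> p) (v \<kappa>)"
    using v \<kappa> \<kappa>' unfolding tangent_space_def by blast
  ultimately show ?thesis
    using metric_transition[OF \<kappa>(1) \<kappa>'(1), of "snd \<kappa> p"] \<kappa> \<kappa>' by (simp add: transition_apply)
qed

end

section \<open>The Lagrangian in charts\<close>

locale variational_problem = riemannian_manifold A g
  for A :: "('q::topological_space, 'e::euclidean_space) chart set" and g +
  fixes V :: "'q \<Rightarrow> real"
  assumes potential: "smooth_function A V"
begin

definition lagrangian :: "('q, 'e) chart \<Rightarrow> 'e \<times> 'e \<times> 'e \<Rightarrow> real" where
  "lagrangian \<kappa> = (\<lambda>(x, v, a).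
     1/2 * g \<kappa> x (a + christoffel g \<kappa> x v v) (a + christoffel g \<kappa> x v v) + V (chart_inv \<kappa> x))"

text \<open>
  Expanded in a basis, the Lagrangian is built from coordinates and smooth functions of the point by sums and products.
\<close>

lemma lagrangian_smooth:
  assumes \<kappa>: "\<kappa> \<in> A"
  shows "smooth_on (coords \<kappa> \<times> UNIV) (lagrangian \<kappa>)"
  unfolding smooth_on_def
proof
  fix k
  let ?S = "coords \<kappa> \<times> (UNIV :: ('e \<times> 'e) set)"
  have S: "unique_derivs ?S" and U: "unique_derivs (coords \<kappa>)"
    using open_coords[OF \<kappa>] by (auto intro!: unique_derivs_open open_Times)
  have pr: "ck_on k ?S (\<lambda>z. fst z)" "ck_on k ?S (\<lambda>z. fst (snd z))" "ck_on k ?S (\<lambda>z. snd (snd z))"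
    using ck_on_linear[OF S bounded_linear_fst ck_on_ident[OF S]]
      ck_on_linear[OF S bounded_linear_compose[OF bounded_linear_fst bounded_linear_snd] ck_on_ident[OF S]]
      ck_on_linear[OF S bounded_linear_compose[OF bounded_linear_snd bounded_linear_snd] ck_on_ident[OF S]]
    by auto
  have ofx: "ck_on k ?S (\<lambda>z. f (fst z))" if "ck_on k (coords \<kappa>) f" for f :: "'e \<Rightarrow> 'c::real_normed_vector"
    using ck_on_compose[OF S U _ that pr(1)] by auto
  define W where "W z = snd (snd z) + (\<Sum>i\<in>Basis. \<Sum>j\<in>Basis.
     ((fst (snd z) \<bullet> i) * (fst (snd z) \<bullet> j)) *\<^sub>R christoffel g \<kappa> (fst z) i j)" for z :: "'e \<times> 'e \<times> 'e"
  have W: "ck_on k ?S W" unfolding W_def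
    by (intro ck_on_add ck_on_sum ck_on_scaleR ck_on_mult ck_on_inner ck_on_const pr S
      ofx[OF christoffel_ck[OF \<kappa>]])
  have "ck_on k ?S (\<lambda>z. 1/2 * (\<Sum>i\<in>Basis. \<Sum>j\<in>Basis. ((W z \<bullet> i) * (W z \<bullet> j)) * g \<kappa> (fst z) i j) + (V \<circ> chart_inv \<kappa>) (fst z))"
    using potential \<kappa> unfolding smooth_function_def
    by (intro ck_on_add ck_on_sum ck_on_mult ck_on_inner ck_on_const W S
      ofx[OF smooth_onD[OF metric_smooth[OF \<kappa>]]] ofx[OF smooth_onD]) blast
  moreover have "lagrangian \<kappa> z = 1/2 * (\<Sum>i\<in>Basis. \<Sum>j\<in>Basis. ((W z \<bullet> i) * (W z \<bullet> j)) * g \<kappa> (fst z) i j) + (V \<circ> chart_inv \<kappa>) (fst z)"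
    if "z \<in> ?S" for z
  proof -
    obtain x v a where z: "z = (x, v, a)" by (cases z) auto
    then have x: "x \<in> coords \<kappa>" using that by auto
    have "W z = a + christoffel g \<kappa> x v v"
      unfolding W_def z using bilinear_eq_sum_Basis[OF christoffel_bilinear[OF \<kappa> x], of v v] by simp
    then show ?thesis
      using bilinear_eq_sum_Basis[OF metric_bilinear[OF \<kappa> x], of "W z" "W z"] by (simp add: lagrangian_def z)
  qed
  ultimately show "ck_on k ?S (lagrangian \<kappa>)" by (subst ck_on_cong) auto
qed

end

section \<open>Functions of a real variable\<close>

lemma ck_on_Suc_vectorI:
  fixes f :: "real \<Rightarrow> 'b::real_normed_vector"
  assumes "unique_derivs S" "\<And>t. t \<in> S \<Longrightarrow> (f has_vector_derivative f' t) (at t within S)" "ck_on k S f'"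
  shows "ck_on (Suc k) S f"
  using assms
  by (intro ck_on_SucI[where F = "\<lambda>t v. v *\<^sub>R f' t"] ck_on_linear[OF _ bounded_linear_scaleR_right])
    (auto simp: has_vector_derivative_def)

lemma ck_on_Suc_vectorE:
  fixes f :: "real \<Rightarrow> 'b::real_normed_vector"
  assumes "ck_on (Suc k) S f"
  obtains f' where "\<And>t. t \<in> S \<Longrightarrow> (f has_vector_derivative f' t) (at t within S)" "ck_on k S f'"
proof -
  obtain F where F: "\<And>x. x \<in> S \<Longrightarrow> (f has_derivative F x) (at x within S)"
    "\<And>v. ck_on k S (\<lambda>x. F x v)" using ck_on_SucE[OF assms] by metis
  have "(f has_vector_derivative F t 1) (at t within S)" if "t \<in> S" for t
  proof -
    have "F t = (\<lambda>h. h *\<^sub>R F t 1)"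
      using has_derivative_linear[OF F(1)[OF that]] by (metis linear_scale mult.right_neutral real_scaleR_def)
    then show ?thesis using F(1)[OF that] by (simp add: has_vector_derivative_def)
  qed
  then show thesis using that[of "\<lambda>t. F t 1"] F(2) by blast
qed

text \<open>
  Instead of the chosen derivatives, a curve is accompanied by its first two derivatives on the interval.
  Values of such a triple outside of the interval are arbitrary, so that one triple can be used on
  subintervals and variations are pointwise sums of triples.
\<close>

definition two_jet :: "real \<Rightarrow> real \<Rightarrow> (real \<Rightarrow> 'b::real_normed_vector \<times> 'b \<times> 'b) \<Rightarrow> bool" where
  "two_jet a b X \<longleftrightarrow> smooth_on {a..b} (\<lambda>t. fst (X t)) \<and> (\<forall>t\<in>{a..b}.
     ((\<lambda>t. fst (X t)) has_vector_derivative fst (snd (X t))) (at t within {a..b}) \<and>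
     ((\<lambda>t. fst (snd (X t))) has_vector_derivative snd (snd (X t))) (at t within {a..b})) \<and>
     continuous_on {a..b} (\<lambda>t. snd (snd (X t)))"

abbreviation one_jet :: "(real \<Rightarrow> 'b \<times> 'b \<times> 'b) \<Rightarrow> real \<Rightarrow> 'b \<times> 'b" where
  "one_jet X t \<equiv> (fst (X t), fst (snd (X t)))"

lemma two_jetD:
  assumes "two_jet a b X"
  shows "smooth_on {a..b} (\<lambda>t. fst (X t))"
    "\<And>t. t \<in> {a..b} \<Longrightarrow> ((\<lambda>t. fst (X t)) has_vector_derivative fst (snd (X t))) (at t within {a..b})"
    "\<And>t. t \<in> {a..b} \<Longrightarrow> ((\<lambda>t. fst (snd (X t))) has_vector_derivative snd (snd (X t))) (at t within {a..b})"
    "continuous_on {a..b} (\<lambda>t. snd (snd (X t)))"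
  using assms by (auto simp: two_jet_def)

lemma two_jet_continuous:
  assumes "two_jet a b X" shows "continuous_on {a..b} X"
  using continuous_on_Pair[OF continuous_on_vector_derivative[OF two_jetD(2)[OF assms]]
      continuous_on_Pair[OF continuous_on_vector_derivative[OF two_jetD(3)[OF assms]] two_jetD(4)[OF assms]]]
  by simp

lemma two_jet_exists:
  fixes f :: "real \<Rightarrow> 'b::real_normed_vector"
  assumes "smooth_on {a..b} f"
  obtains X where "two_jet a b X" "\<And>t. fst (X t) = f t"
proof -
  let ?S = "{a..b}"
  obtain f1 where f1: "\<And>t. t \<in> ?S \<Longrightarrow> (f has_vector_derivative f1 t) (at t within ?S)" "ck_on (Suc 0) ?S f1"
    using ck_on_Suc_vectorE[OF smooth_onD[OF assms]] by metis
  obtain f2 where f2: "\<And>t. t \<in> ?S \<Longrightarrow> (f1 has_vector_derivative f2 t) (at t within ?S)" "continuous_on ?S f2"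
    using ck_on_Suc_vectorE[OF f1(2)] by (metis ck_on.simps(1))
  show thesis
    by (rule that[of "\<lambda>t. (f t, f1 t, f2 t)"]) (use assms f1(1) f2 in \<open>auto simp: two_jet_def\<close>)
qed

lemma two_jet_restrict:
  assumes X: "two_jet a b X" and "a \<le> c" "c < d" "d \<le> b"
  shows "two_jet c d X"
proof -
  have sub: "{c..d} \<subseteq> {a..b}" using assms by auto
  have "smooth_on {c..d} (\<lambda>t. fst (X t))"
    using ck_on_subset[OF unique_derivs_interval[OF assms(3)] sub] two_jetD(1)[OF X] unfolding smooth_on_def by auto
  then show ?thesis
    using two_jetD(2-4)[OF X] sub unfolding two_jet_def
    by (blast intro: has_vector_derivative_within_subset continuous_on_subset)
qed

lemma two_jet_add_scaleR:
  assumes X: "two_jet a b X" and H: "two_jet a b H" and "a < b"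
  shows "two_jet a b (\<lambda>t. X t + s *\<^sub>R H t)"
  unfolding two_jet_def fst_add snd_add fst_scaleR snd_scaleR
proof (intro conjI ballI)
  have "unique_derivs {a..b}" using unique_derivs_interval[OF \<open>a < b\<close>] by auto
  then show "smooth_on {a..b} (\<lambda>t. fst (X t) + s *\<^sub>R fst (H t))"
    using two_jetD(1)[OF X] two_jetD(1)[OF H] unfolding smooth_on_def
    by (intro allI ck_on_add ck_on_scaleR ck_on_const) auto
  show "continuous_on {a..b} (\<lambda>t. snd (snd (X t)) + s *\<^sub>R snd (snd (H t)))"
    by (intro continuous_on_add continuous_on_scaleR continuous_on_const two_jetD(4)[OF X] two_jetD(4)[OF H])
qed (rule derivative_eq_intros two_jetD(2,3)[OF X] two_jetD(2,3)[OF H] refl | assumption | simp)+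

lemma at_within_relatively_open:
  assumes "openin (top_of_set I) S" "t \<in> S"
  shows "at t within S = at t within I"
proof -
  obtain U where "open U" "S = I \<inter> U" using assms(1) by (auto simp: openin_open)
  then show ?thesis using at_within_nhd[of t U S I] assms(2) by auto
qed

lemma vector_derivative_eqI:
  fixes a b :: real
  assumes "a < b" "t \<in> {a..b}" "(f has_vector_derivative f') (at t within {a..b})"
  shows "vector_derivative f (at t within {a..b}) = f'"
  using vector_derivative_within_cbox[of a b t f f'] assms by simp

lemma has_vector_derivative_Un:
  fixes f :: "real \<Rightarrow> 'b::real_normed_vector"
  assumes "(f has_vector_derivative f') (at t within S)" "(f has_vector_derivative f') (at t within T)"
  shows "(f has_vector_derivative f') (at t within (S \<union> T))"
  using assms unfolding has_vector_derivative_def has_derivative_within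
  by (auto simp: Lim_within_Un)

text \<open>
  A derivative within a closed set at a point outside of it is a limit along the trivial filter. Together
  with \<open>has_vector_derivative_Un\<close> this glues one-sided derivatives at the common end of two intervals
  without case distinctions at the other points.
\<close>

lemma has_vector_derivative_outside:
  fixes f :: "real \<Rightarrow> 'b::real_normed_vector"
  assumes "closed T" "t \<notin> T"
  shows "(f has_vector_derivative f') (at t within T)"
proof -
  have "at t within T = bot" using assms by (simp add: at_within_eq_bot_iff)
  then show ?thesis
    by (simp add: has_vector_derivative_def has_derivative_def bounded_linear_scaleR_left)
qed

lemma has_vector_derivative_cong_on:
  assumes "t \<in> S" "\<And>s. s \<in> S \<Longrightarrow> f s = h s"
  shows "(f has_vector_derivative f') (at t within S) \<longleftrightarrow> (h has_vector_derivative f') (at t within S)"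
  unfolding has_vector_derivative_def by (rule has_derivative_cong_on[OF assms])

lemma has_vector_derivative_compose_fun:
  assumes "(f has_vector_derivative f') (at t within S)" "(h has_derivative H) (at (f t))"
  shows "((\<lambda>s. h (f s)) has_vector_derivative H f') (at t within S)"
proof -
  have "((\<lambda>s. h (f s)) has_derivative (\<lambda>d. H (d *\<^sub>R f'))) (at t within S)"
    using has_derivative_compose[OF assms(1)[unfolded has_vector_derivative_def] assms(2)] .
  then show ?thesis
    using has_derivative_linear[OF assms(2)] by (simp add: has_vector_derivative_def linear_scale)
qed

text \<open>
  The interval is split at one exceptional point after the other.
\<close>

lemma integrable_on_pieces:
  fixes f :: "real \<Rightarrow> real"
  assumes "finite P"
  shows "\<lbrakk>a \<le> b; \<And>c d. a \<le> c \<Longrightarrow> c < d \<Longrightarrow> d \<le> b \<Longrightarrow> {c<..<d} \<inter> P = {} \<Longrightarrow> f integrable_on {c..d}\<rbrakk>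
    \<Longrightarrow> f integrable_on {a..b}"
  using assms
proof (induction P arbitrary: a b rule: finite_induct)
  case empty
  then show ?case using integrable_on_refl[of f b] by (cases "a = b") auto
next
  case (insert p P)
  show ?case
  proof (cases "a < p \<and> p < b")
    case True
    have "f integrable_on {a..p}"
    proof (rule insert.IH)
      fix c d assume "a \<le> c" "c < d" "d \<le> p" "{c<..<d} \<inter> P = {}"
      then show "f integrable_on {c..d}" using True by (intro insert.prems(2)) auto
    qed (use True in simp)
    moreover have "f integrable_on {p..b}"
    proof (rule insert.IH)
      fix c d assume "p \<le> c" "c < d" "d \<le> b" "{c<..<d} \<inter> P = {}"
      then show "f integrable_on {c..d}" using True by (intro insert.prems(2)) auto
    qed (use True in simp)
    ultimately show ?thesis using True Henstock_Kurzweil_Integration.integrable_combine[of a p b f] by auto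
  next
    case False
    show ?thesis
    proof (rule insert.IH[OF insert.prems(1)])
      fix c d assume "a \<le> c" "c < d" "d \<le> b" "{c<..<d} \<inter> P = {}"
      then show "f integrable_on {c..d}" using False by (intro insert.prems(2)) auto
    qed
  qed
qed

section \<open>Curves and their velocities\<close>

context smooth_manifold
begin

text \<open>
  The notion used for admissible curves, on an arbitrary interval, so that curves can be cut and joined.
\<close>

definition piecewise_smooth :: "real \<Rightarrow> real \<Rightarrow> (real \<Rightarrow> 'q) \<Rightarrow> bool" where
  "piecewise_smooth a b \<gamma> \<longleftrightarrow> continuous_on {a..b} \<gamma> \<and>
     (\<exists>P. finite P \<and> (\<forall>c d. a \<le> c \<and> c < d \<and> d \<le> b \<and> {c<..<d} \<inter> P = {} \<longrightarrow> smooth_curve A {c..d} \<gamma>))"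

abbreviation vel :: "real \<Rightarrow> real \<Rightarrow> (real \<Rightarrow> 'q) \<Rightarrow> real \<Rightarrow> ('q, 'e) tvec" where
  "vel a b \<equiv> velocity A {a..b}"

lemma openin_chart_preimage:
  assumes "\<kappa> \<in> A" "continuous_on I \<gamma>"
  shows "openin (top_of_set I) (I \<inter> \<gamma> -` fst \<kappa>)"
  using continuous_openin_preimage_gen[OF assms(2) open_chart[OF assms(1)]] by (simp add: Int_commute)

lemma unique_derivs_chart_preimage:
  fixes a b :: real
  assumes "\<kappa> \<in> A" "a < b" "continuous_on {a..b} \<gamma>"
  shows "unique_derivs ({a..b} \<inter> \<gamma> -` fst \<kappa>)"
  using unique_derivs_interval[OF assms(2) openin_chart_preimage[OF assms(1,3)]] .

lemma ck_curve_continuous: "ck_curve A k I \<gamma> \<Longrightarrow> continuous_on I \<gamma>"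
  by (simp add: ck_curve_def)

lemma ck_curve_ck_on: "ck_curve A k I \<gamma> \<Longrightarrow> \<kappa> \<in> A \<Longrightarrow> ck_on k (I \<inter> \<gamma> -` fst \<kappa>) (snd \<kappa> \<circ> \<gamma>)"
  by (simp add: ck_curve_def)

lemma ck_curve_le: "ck_curve A k I \<gamma> \<Longrightarrow> j \<le> k \<Longrightarrow> ck_curve A j I \<gamma>"
  unfolding ck_curve_def by (meson ck_on_le)

lemma smooth_curveD: "smooth_curve A I \<gamma> \<Longrightarrow> ck_curve A k I \<gamma>"
  by (simp add: smooth_curve_def)

lemma ck_curve_cong:
  assumes "\<And>t. t \<in> I \<Longrightarrow> \<gamma> t = \<gamma>' t"
  shows "ck_curve A k I \<gamma> \<longleftrightarrow> ck_curve A k I \<gamma>'"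
proof -
  have *: "I \<inter> \<gamma> -` U = I \<inter> \<gamma>' -` U" for U using assms by auto
  have "ck_on k (I \<inter> \<gamma> -` fst \<kappa>) (snd \<kappa> \<circ> \<gamma>) \<longleftrightarrow> ck_on k (I \<inter> \<gamma>' -` fst \<kappa>) (snd \<kappa> \<circ> \<gamma>')" for \<kappa> :: "('q, 'e) chart"
    unfolding * using assms by (intro ck_on_cong) auto
  then show ?thesis using assms by (simp add: ck_curve_def cong: continuous_on_cong)
qed

lemma ck_curve_restrict:
  fixes a b c d :: real
  assumes "ck_curve A k {a..b} \<gamma>" "a \<le> c" "c < d" "d \<le> b"
  shows "ck_curve A k {c..d} \<gamma>"
proof -
  have sub: "{c..d} \<subseteq> {a..b}" using assms by auto
  have cont: "continuous_on {c..d} \<gamma>" using continuous_on_subset[OF ck_curve_continuous[OF assms(1)] sub] .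
  show ?thesis unfolding ck_curve_def
  proof (intro conjI ballI cont)
    fix \<kappa> assume \<kappa>: "\<kappa> \<in> A"
    show "ck_on k ({c..d} \<inter> \<gamma> -` fst \<kappa>) (snd \<kappa> \<circ> \<gamma>)"
      by (rule ck_on_subset[OF unique_derivs_chart_preimage[OF \<kappa> assms(3) cont] _ ck_curve_ck_on[OF assms(1) \<kappa>]])
        (use sub in auto)
  qed
qed

lemma smooth_curve_restrict:
  fixes a b c d :: real
  assumes "smooth_curve A {a..b} \<gamma>" "a \<le> c" "c < d" "d \<le> b"
  shows "smooth_curve A {c..d} \<gamma>"
  using ck_curve_restrict assms unfolding smooth_curve_def by blast

text \<open>
  The times at which a curve lies in the domain of a chart form a relatively open subset of the
  interval, so that derivatives within this subset and within the interval are the same.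
\<close>

lemma velocity_has_vector_derivative:
  fixes a b :: real
  assumes "a < b" "ck_curve A 1 {a..b} \<gamma>" "\<kappa> \<in> A" "t \<in> {a..b}" "\<gamma> t \<in> fst \<kappa>"
  shows "(snd \<kappa> \<circ> \<gamma> has_vector_derivative vel a b \<gamma> t \<kappa>) (at t within {a..b})"
proof -
  let ?S = "{a..b} \<inter> \<gamma> -` fst \<kappa>"
  have tS: "t \<in> ?S" using assms by auto
  obtain f' where "\<And>t. t \<in> ?S \<Longrightarrow> (snd \<kappa> \<circ> \<gamma> has_vector_derivative f' t) (at t within ?S)"
    using ck_curve_ck_on[OF assms(2,3)] ck_on_Suc_vectorE[of 0 ?S] by (metis One_nat_def)
  then have "(snd \<kappa> \<circ> \<gamma> has_vector_derivative f' t) (at t within {a..b})"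
    using tS at_within_relatively_open[OF openin_chart_preimage[OF assms(3) ck_curve_continuous[OF assms(2)]] tS]
    by metis
  with vector_derivative_eqI[OF assms(1,4) this] show ?thesis using assms(3,5) by (simp add: velocity_def)
qed

lemma velocity_ck_on:
  fixes a b :: real
  assumes "a < b" "ck_curve A (Suc k) {a..b} \<gamma>" "\<kappa> \<in> A"
  shows "ck_on k ({a..b} \<inter> \<gamma> -` fst \<kappa>) (\<lambda>t. vel a b \<gamma> t \<kappa>)"
proof -
  let ?S = "{a..b} \<inter> \<gamma> -` fst \<kappa>"
  have C1: "ck_curve A 1 {a..b} \<gamma>" using ck_curve_le[OF assms(2)] by simp
  obtain f' where f': "\<And>t. t \<in> ?S \<Longrightarrow> (snd \<kappa> \<circ> \<gamma> has_vector_derivative f' t) (at t within ?S)" "ck_on k ?S f'"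
    using ck_on_Suc_vectorE[OF ck_curve_ck_on[OF assms(2,3)]] by metis
  have "vel a b \<gamma> t \<kappa> = f' t" if "t \<in> ?S" for t
  proof -
    have "(snd \<kappa> \<circ> \<gamma> has_vector_derivative f' t) (at t within {a..b})"
      using f'(1)[OF that] at_within_relatively_open[OF openin_chart_preimage[OF assms(3) ck_curve_continuous[OF C1]] that]
      by metis
    then show ?thesis using vector_derivative_eqI[OF assms(1), of t "snd \<kappa> \<circ> \<gamma>"] that assms(3) by (auto simp: velocity_def)
  qed
  then show ?thesis using f'(2) ck_on_cong[of ?S "\<lambda>t. vel a b \<gamma> t \<kappa>" f'] by blast
qed

lemma c1_curveI:
  fixes a b :: real
  assumes "a < b" "continuous_on {a..b} \<gamma>"
    and d: "\<And>\<kappa> t. \<kappa> \<in> A \<Longrightarrow> t \<in> {a..b} \<Longrightarrow> \<gamma> t \<in> fst \<kappa> \<Longrightarrow>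
       (snd \<kappa> \<circ> \<gamma> has_vector_derivative f' \<kappa> t) (at t within {a..b})"
    and c: "\<And>\<kappa>. \<kappa> \<in> A \<Longrightarrow> continuous_on ({a..b} \<inter> \<gamma> -` fst \<kappa>) (f' \<kappa>)"
  shows "ck_curve A 1 {a..b} \<gamma>"
  unfolding ck_curve_def
proof (intro conjI ballI assms(2))
  fix \<kappa> assume \<kappa>: "\<kappa> \<in> A"
  have "ck_on (Suc 0) ({a..b} \<inter> \<gamma> -` fst \<kappa>) (snd \<kappa> \<circ> \<gamma>)"
  proof (rule ck_on_Suc_vectorI[OF unique_derivs_chart_preimage[OF \<kappa> assms(1,2)]])
    fix t assume "t \<in> {a..b} \<inter> \<gamma> -` fst \<kappa>"
    then show "(snd \<kappa> \<circ> \<gamma> has_vector_derivative f' \<kappa> t) (at t within {a..b} \<inter> \<gamma> -` fst \<kappa>)"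
      using has_vector_derivative_within_subset[OF d[OF \<kappa>]] by auto
  qed (use c[OF \<kappa>] in simp)
  then show "ck_on 1 ({a..b} \<inter> \<gamma> -` fst \<kappa>) (snd \<kappa> \<circ> \<gamma>)" by simp
qed

lemma velocity_eqI:
  fixes a b :: real
  assumes "a < b" "t \<in> {a..b}" "\<And>\<kappa>. \<kappa> \<in> A \<Longrightarrow> \<gamma> t \<in> fst \<kappa> \<Longrightarrow>
       (snd \<kappa> \<circ> \<gamma> has_vector_derivative v \<kappa>) (at t within {a..b})"
    "\<And>\<kappa>. \<not> (\<kappa> \<in> A \<and> \<gamma> t \<in> fst \<kappa>) \<Longrightarrow> v \<kappa> = 0"
  shows "vel a b \<gamma> t = v"
proof
  fix \<kappa> :: "('q, 'e) chart"
  show "vel a b \<gamma> t \<kappa> = v \<kappa>"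
    using vector_derivative_eqI[OF assms(1,2) assms(3)[of \<kappa>]] assms(4)[of \<kappa>] by (auto simp: velocity_def)
qed

lemma velocity_cong:
  fixes a b :: real
  assumes "t \<in> {a..b}" "\<And>t. t \<in> {a..b} \<Longrightarrow> \<gamma> t = \<gamma>' t"
  shows "vel a b \<gamma> t = vel a b \<gamma>' t"
proof -
  have "vector_derivative (snd \<kappa> \<circ> \<gamma>) (at t within {a..b}) = vector_derivative (snd \<kappa> \<circ> \<gamma>') (at t within {a..b})"
    for \<kappa> :: "('q, 'e) chart"
    using has_vector_derivative_cong_on[of t "{a..b}" "snd \<kappa> \<circ> \<gamma>" "snd \<kappa> \<circ> \<gamma>'"] assms
    by (simp add: vector_derivative_def)
  then show ?thesis using assms by (auto simp: velocity_def fun_eq_iff)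
qed

lemma tangent_lift_cong:
  fixes a b :: real
  assumes "t \<in> {a..b}" "\<And>t. t \<in> {a..b} \<Longrightarrow> \<gamma> t = \<gamma>' t"
  shows "tangent_lift A {a..b} \<gamma> t = tangent_lift A {a..b} \<gamma>' t"
  using velocity_cong[OF assms] assms by (simp add: tangent_lift_def)

lemma velocity_restrict:
  fixes a b c d :: real
  assumes "ck_curve A 1 {a..b} \<gamma>" "a \<le> c" "c < d" "d \<le> b" "t \<in> {c..d}"
  shows "vel c d \<gamma> t = vel a b \<gamma> t"
proof (rule velocity_eqI[OF assms(3,5)])
  fix \<kappa> assume "\<kappa> \<in> A" "\<gamma> t \<in> fst \<kappa>"
  then show "(snd \<kappa> \<circ> \<gamma> has_vector_derivative vel a b \<gamma> t \<kappa>) (at t within {c..d})"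
    using has_vector_derivative_within_subset[OF velocity_has_vector_derivative[OF _ assms(1), of \<kappa> t], of "{c..d}"] assms
    by auto
qed (auto simp: velocity_def)

text \<open>
  At the joint, the derivatives from the left and from the right agree in every chart, so that the
  coordinates are differentiable there and the velocity is continuous.
\<close>

lemma c1_curve_join:
  fixes a b c :: real
  assumes "a < c" "c < b" and l: "ck_curve A 1 {a..c} \<gamma>" and r: "ck_curve A 1 {c..b} \<gamma>"
    and v: "vel a c \<gamma> c = vel c b \<gamma> c"
  shows "ck_curve A 1 {a..b} \<gamma>"
proof -
  define f where "f \<kappa> t = (if t \<le> c then vel a c \<gamma> t \<kappa> else vel c b \<gamma> t \<kappa>)" for \<kappa> :: "('q, 'e) chart" and t
  have ab: "{a..b} = {a..c} \<union> {c..b}" using assms by auto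
  have cont: "continuous_on {a..b} \<gamma>" unfolding ab
    using l r by (intro continuous_on_closed_Un) (auto intro: ck_curve_continuous)
  show ?thesis
  proof (rule c1_curveI[OF _ cont, where f' = f])
    fix \<kappa> t assume *: "\<kappa> \<in> A" "t \<in> {a..b}" "\<gamma> t \<in> fst \<kappa>"
    have "(snd \<kappa> \<circ> \<gamma> has_vector_derivative f \<kappa> t) (at t within {a..c})"
    proof (cases "t \<le> c")
      case True then show ?thesis
        using velocity_has_vector_derivative[OF assms(1) l *(1) _ *(3)] * by (simp add: f_def)
    qed (auto intro: has_vector_derivative_outside)
    moreover have "(snd \<kappa> \<circ> \<gamma> has_vector_derivative f \<kappa> t) (at t within {c..b})"
    proof (cases "c \<le> t")
      case True then show ?thesis
        using velocity_has_vector_derivative[OF assms(2) r *(1) _ *(3)] * v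
        by (cases "t = c") (auto simp add: f_def)
    qed (auto intro: has_vector_derivative_outside)
    ultimately show "(snd \<kappa> \<circ> \<gamma> has_vector_derivative f \<kappa> t) (at t within {a..b})"
      unfolding ab by (rule has_vector_derivative_Un)
  next
    fix \<kappa> assume \<kappa>: "\<kappa> \<in> A"
    have l': "continuous_on ({a..c} \<inter> \<gamma> -` fst \<kappa>) (\<lambda>t. vel a c \<gamma> t \<kappa>)"
      using velocity_ck_on[OF assms(1), of 0] l \<kappa> by simp
    have r': "continuous_on ({c..b} \<inter> \<gamma> -` fst \<kappa>) (\<lambda>t. vel c b \<gamma> t \<kappa>)"
      using velocity_ck_on[OF assms(2), of 0] r \<kappa> by simp
    show "continuous_on ({a..b} \<inter> \<gamma> -` fst \<kappa>) (f \<kappa>)"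
      unfolding f_def
      by (rule continuous_on_cases_le[where h = "\<lambda>t. t" and a = c])
       (auto intro: continuous_on_subset[OF l'] continuous_on_subset[OF r'] simp: v)
  qed (use assms in auto)
qed

lemma velocity_in_tangent_space:
  fixes a b :: real
  assumes "a < b" "ck_curve A 1 {a..b} \<gamma>" "t \<in> {a..b}"
  shows "vel a b \<gamma> t \<in> tangent_space A (\<gamma> t)"
proof -
  have "vel a b \<gamma> t \<kappa>' = Dtrans \<kappa> \<kappa>' (snd \<kappa> (\<gamma> t)) (vel a b \<gamma> t \<kappa>)"
    if \<kappa>: "\<kappa> \<in> A" "\<gamma> t \<in> fst \<kappa>" and \<kappa>': "\<kappa>' \<in> A" "\<gamma> t \<in> fst \<kappa>'" for \<kappa> \<kappa>'
  proof -
    let ?S = "{a..b} \<inter> \<gamma> -` fst \<kappa>"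
    have t: "t \<in> ?S" using \<kappa> assms by auto
    have S: "at t within ?S = at t within {a..b}"
      by (rule at_within_relatively_open[OF openin_chart_preimage[OF \<kappa>(1) ck_curve_continuous[OF assms(2)]] t])
    have "((\<lambda>s. transition \<kappa> \<kappa>' ((snd \<kappa> \<circ> \<gamma>) s)) has_vector_derivative Dtrans \<kappa> \<kappa>' (snd \<kappa> (\<gamma> t)) (vel a b \<gamma> t \<kappa>)) (at t within ?S)"
      unfolding S
      by (rule has_vector_derivative_compose_fun[OF velocity_has_vector_derivative[OF assms(1,2) \<kappa>(1) assms(3) \<kappa>(2)]])
         (use transition_has_derivative[OF \<kappa>(1) \<kappa>'(1), of "snd \<kappa> (\<gamma> t)"] \<kappa> \<kappa>' in simp)
    then have "(snd \<kappa>' \<circ> \<gamma> has_vector_derivative Dtrans \<kappa> \<kappa>' (snd \<kappa> (\<gamma> t)) (vel a b \<gamma> t \<kappa>)) (at t within ?S)"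
      by (subst has_vector_derivative_cong_on[OF t, of _ "\<lambda>s. transition \<kappa> \<kappa>' ((snd \<kappa> \<circ> \<gamma>) s)"])
        (auto simp: transition_apply \<kappa>)
    then show ?thesis
      unfolding S using vector_derivative_eqI[OF assms(1,3), of "snd \<kappa>' \<circ> \<gamma>"] \<kappa>' by (simp add: velocity_def)
  qed
  moreover have "vel a b \<gamma> t \<kappa> = 0" if "\<not> (\<kappa> \<in> A \<and> \<gamma> t \<in> fst \<kappa>)" for \<kappa>
    using that by (auto simp: velocity_def)
  ultimately show ?thesis unfolding tangent_space_def by blast
qed

lemma piecewise_smooth_continuous: "piecewise_smooth a b \<gamma> \<Longrightarrow> continuous_on {a..b} \<gamma>"
  by (simp add: piecewise_smooth_def)

lemma piecewise_smooth_restrict: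
  assumes "piecewise_smooth a b \<gamma>" "a \<le> c" "d \<le> b"
  shows "piecewise_smooth c d \<gamma>"
proof -
  obtain P where "finite P"
    "\<And>c d. a \<le> c \<Longrightarrow> c < d \<Longrightarrow> d \<le> b \<Longrightarrow> {c<..<d} \<inter> P = {} \<Longrightarrow> smooth_curve A {c..d} \<gamma>"
    using assms(1) unfolding piecewise_smooth_def by blast
  then show ?thesis using assms unfolding piecewise_smooth_def
    by (auto intro!: exI[of _ P] intro: continuous_on_subset)
qed

lemma piecewise_smooth_join:
  assumes "piecewise_smooth a c \<gamma>" "piecewise_smooth c b \<gamma>" "a \<le> c" "c \<le> b"
  shows "piecewise_smooth a b \<gamma>"
proof -
  obtain P where P: "finite P"
    "\<And>c' d. a \<le> c' \<Longrightarrow> c' < d \<Longrightarrow> d \<le> c \<Longrightarrow> {c'<..<d} \<inter> P = {} \<Longrightarrow> smooth_curve A {c'..d} \<gamma>"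
    using assms(1) unfolding piecewise_smooth_def by blast
  obtain Q where Q: "finite Q"
    "\<And>c' d. c \<le> c' \<Longrightarrow> c' < d \<Longrightarrow> d \<le> b \<Longrightarrow> {c'<..<d} \<inter> Q = {} \<Longrightarrow> smooth_curve A {c'..d} \<gamma>"
    using assms(2) unfolding piecewise_smooth_def by blast
  have "{a..b} = {a..c} \<union> {c..b}" using assms by auto
  then have "continuous_on {a..b} \<gamma>"
    using assms(1,2) by (auto intro!: continuous_on_closed_Un piecewise_smooth_continuous)
  moreover have "smooth_curve A {c'..d} \<gamma>"
    if "a \<le> c'" "c' < d" "d \<le> b" "{c'<..<d} \<inter> (insert c (P \<union> Q)) = {}" for c' d
  proof -
    have "d \<le> c \<or> c \<le> c'" using that by auto
    moreover have "{c'<..<d} \<inter> P = {}" "{c'<..<d} \<inter> Q = {}" using that(4) by blast+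
    ultimately show ?thesis using P(2)[of c' d] Q(2)[of c' d] that by blast
  qed
  ultimately show ?thesis unfolding piecewise_smooth_def
    using P(1) Q(1) by (intro conjI exI[of _ "insert c (P \<union> Q)"]) auto
qed

lemma piecewise_smooth_cong:
  assumes "\<And>t. t \<in> {a..b} \<Longrightarrow> \<gamma> t = \<gamma>' t" "piecewise_smooth a b \<gamma>"
  shows "piecewise_smooth a b \<gamma>'"
proof -
  obtain P where P: "finite P"
    "\<And>c d. a \<le> c \<Longrightarrow> c < d \<Longrightarrow> d \<le> b \<Longrightarrow> {c<..<d} \<inter> P = {} \<Longrightarrow> smooth_curve A {c..d} \<gamma>"
    using assms(2) unfolding piecewise_smooth_def by blast
  have "smooth_curve A {c..d} \<gamma>'" if "a \<le> c" "c < d" "d \<le> b" "{c<..<d} \<inter> P = {}" for c d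
    using P(2)[OF that] ck_curve_cong[of "{c..d}" \<gamma> \<gamma>'] assms(1) that by (simp add: smooth_curve_def)
  moreover have "continuous_on {a..b} \<gamma>'"
    using piecewise_smooth_continuous[OF assms(2)] assms(1) continuous_on_cong[of "{a..b}" "{a..b}" \<gamma> \<gamma>'] by blast
  ultimately show ?thesis unfolding piecewise_smooth_def using P(1) by blast
qed

lemma smooth_imp_piecewise_smooth: "smooth_curve A {a..b} \<gamma> \<Longrightarrow> piecewise_smooth a b \<gamma>"
  unfolding piecewise_smooth_def
  by (auto intro!: exI[of _ "{}"] intro: smooth_curve_restrict ck_curve_continuous smooth_curveD)

lemma chart_curve_smooth:
  fixes a b :: real
  assumes \<kappa>: "\<kappa> \<in> A" and "a < b" and f: "smooth_on {a..b} f" and fU: "\<And>t. t \<in> {a..b} \<Longrightarrow> f t \<in> coords \<kappa>"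
  shows "smooth_curve A {a..b} (\<lambda>t. chart_inv \<kappa> (f t))"
  unfolding smooth_curve_def ck_curve_def
proof (intro allI conjI ballI)
  fix k
  have "continuous_on {a..b} f" using f ck_on_imp_continuous_on smooth_onD by blast
  then show cont: "continuous_on {a..b} (\<lambda>t. chart_inv \<kappa> (f t))"
    using fU by (intro continuous_on_compose2[OF continuous_on_chart_inv[OF \<kappa>]]) auto
  fix \<kappa>' assume \<kappa>': "\<kappa>' \<in> A"
  let ?S = "{a..b} \<inter> (\<lambda>t. chart_inv \<kappa> (f t)) -` fst \<kappa>'"
  have S: "unique_derivs ?S" using unique_derivs_chart_preimage[OF \<kappa>' assms(2) cont] .
  have "f t \<in> overlap \<kappa> \<kappa>'" if "t \<in> ?S" for t
    using that fU[of t] chart_chart_inv[OF \<kappa>, of "f t"] chart_inv_in[OF \<kappa>, of "f t"] by (metis IntD1 IntD2 IntI image_eqI vimageE)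
  then have "ck_on k ?S (\<lambda>t. transition \<kappa> \<kappa>' (f t))"
    using ck_on_compose[OF S unique_derivs_open[OF open_overlap[OF \<kappa> \<kappa>']] _ smooth_onD[OF transition_smooth[OF \<kappa> \<kappa>']]
        ck_on_subset[OF S _ smooth_onD[OF f]]] by blast
  then show "ck_on k ?S (snd \<kappa>' \<circ> (\<lambda>t. chart_inv \<kappa> (f t)))"
    by (simp add: transition_def comp_def)
qed

lemma velocity_chart_curve:
  fixes a b :: real
  assumes \<kappa>: "\<kappa> \<in> A" and "a < b" and "t \<in> {a..b}" and fU: "\<And>t. t \<in> {a..b} \<Longrightarrow> f t \<in> coords \<kappa>"
    and "(f has_vector_derivative v) (at t within {a..b})"
  shows "vel a b (\<lambda>t. chart_inv \<kappa> (f t)) t \<kappa> = v"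
proof -
  have "(snd \<kappa> \<circ> (\<lambda>t. chart_inv \<kappa> (f t)) has_vector_derivative v) (at t within {a..b})"
    using assms by (subst has_vector_derivative_cong_on[where h = f]) (auto simp: chart_chart_inv)
  then show ?thesis
    using vector_derivative_eqI[OF assms(2,3), of "snd \<kappa> \<circ> (\<lambda>t. chart_inv \<kappa> (f t))"] chart_inv_in[OF \<kappa> fU[OF assms(3)]] \<kappa> by (simp add: velocity_def)
qed

lemma tangent_space_eqI:
  assumes "v \<in> tangent_space A p" "w \<in> tangent_space A p" "\<kappa> \<in> A" "p \<in> fst \<kappa>" "v \<kappa> = w \<kappa>"
  shows "v = w"
proof
  fix \<kappa>'
  show "v \<kappa>' = w \<kappa>'"
  proof (cases "\<kappa>' \<in> A \<and> p \<in> fst \<kappa>'")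
    case True
    then have "v \<kappa>' = Dtrans \<kappa> \<kappa>' (snd \<kappa> p) (v \<kappa>)" "w \<kappa>' = Dtrans \<kappa> \<kappa>' (snd \<kappa> p) (w \<kappa>)"
      using assms(1-4) unfolding tangent_space_def by blast+
    then show ?thesis using assms(5) by simp
  next
    case False
    then have "v \<kappa>' = 0" "w \<kappa>' = 0" using assms(1,2) unfolding tangent_space_def by blast+
    then show ?thesis by simp
  qed
qed

end

section \<open>Covariant acceleration and action\<close>

context riemannian_manifold
begin

abbreviation acceleration :: "real \<Rightarrow> real \<Rightarrow> (real \<Rightarrow> 'q) \<Rightarrow> real \<Rightarrow> ('q, 'e) tvec" where
  "acceleration a b \<gamma> \<equiv> cov_deriv A g {a..b} \<gamma> (vel a b \<gamma>)"

lemma velocity_has_vector_derivative_2: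
  fixes a b :: real
  assumes "a < b" "ck_curve A 2 {a..b} \<gamma>" "\<kappa> \<in> A" "t \<in> {a..b}" "\<gamma> t \<in> fst \<kappa>"
  shows "((\<lambda>s. vel a b \<gamma> s \<kappa>) has_vector_derivative
    vector_derivative (\<lambda>s. vel a b \<gamma> s \<kappa>) (at t within {a..b})) (at t within {a..b})"
proof -
  let ?S = "{a..b} \<inter> \<gamma> -` fst \<kappa>"
  have t: "t \<in> ?S" using assms by auto
  have "ck_on (Suc 0) ?S (\<lambda>s. vel a b \<gamma> s \<kappa>)"
    using velocity_ck_on[OF assms(1) _ assms(3), of "Suc 0"] assms(2) by (simp add: numeral_2_eq_2)
  then obtain f' where "\<And>t. t \<in> ?S \<Longrightarrow> ((\<lambda>s. vel a b \<gamma> s \<kappa>) has_vector_derivative f' t) (at t within ?S)"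
    using ck_on_Suc_vectorE by metis
  then have *: "((\<lambda>s. vel a b \<gamma> s \<kappa>) has_vector_derivative f' t) (at t within {a..b})"
    using t at_within_relatively_open[OF openin_chart_preimage[OF assms(3) ck_curve_continuous[OF assms(2)]] t]
    by metis
  with vector_derivative_eqI[OF assms(1,4) *] show ?thesis by simp
qed

lemma acceleration_chart:
  "\<kappa> \<in> A \<Longrightarrow> \<gamma> t \<in> fst \<kappa> \<Longrightarrow> acceleration a b \<gamma> t \<kappa> =
    vector_derivative (\<lambda>s. vel a b \<gamma> s \<kappa>) (at t within {a..b}) +
       christoffel g \<kappa> (snd \<kappa> (\<gamma> t)) (vel a b \<gamma> t \<kappa>) (vel a b \<gamma> t \<kappa>)"
  by (simp add: cov_deriv_def)

text \<open>
  Differentiating \<open>y' = D\<phi>(x) x'\<close> gives \<open>y'' = D\<^sup>2\<phi>(x)(x', x') + D\<phi>(x) x''\<close>. The first term is what the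
  transformation law of the Christoffel symbols compensates.
\<close>

lemma acceleration_in_tangent_space:
  fixes a b :: real
  assumes "a < b" "ck_curve A 2 {a..b} \<gamma>" "t \<in> {a..b}"
  shows "acceleration a b \<gamma> t \<in> tangent_space A (\<gamma> t)"
proof -
  have C1: "ck_curve A 1 {a..b} \<gamma>" using ck_curve_le[OF assms(2)] by simp
  have "acceleration a b \<gamma> t \<kappa>' = Dtrans \<kappa> \<kappa>' (snd \<kappa> (\<gamma> t)) (acceleration a b \<gamma> t \<kappa>)"
    if \<kappa>: "\<kappa> \<in> A" "\<gamma> t \<in> fst \<kappa>" and \<kappa>': "\<kappa>' \<in> A" "\<gamma> t \<in> fst \<kappa>'" for \<kappa> \<kappa>'
  proof -
    let ?S = "{a..b} \<inter> \<gamma> -` (fst \<kappa> \<inter> fst \<kappa>')"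
    have t: "t \<in> ?S" using \<kappa> \<kappa>' assms by auto
    have "openin (top_of_set {a..b}) ?S"
      using openin_Int[OF openin_chart_preimage[OF \<kappa>(1) ck_curve_continuous[OF C1]]
         openin_chart_preimage[OF \<kappa>'(1) ck_curve_continuous[OF C1]]] by (simp add: Int_ac)
    then have S: "at t within ?S = at t within {a..b}"
      by (rule at_within_relatively_open[OF _ t])
    define x where "x = snd \<kappa> (\<gamma> t)"
    define v where "v = vel a b \<gamma> t \<kappa>"
    define w where "w = vector_derivative (\<lambda>s. vel a b \<gamma> s \<kappa>) (at t within {a..b})"
    define D where "D = Dtrans \<kappa> \<kappa>' x"
    have x: "x \<in> overlap \<kappa> \<kappa>'" using \<kappa> \<kappa>' by (auto simp: x_def)
    have linD: "linear D" using Dtrans_linear[OF \<kappa>(1) \<kappa>'(1) x] by (simp add: D_def)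
    have vel': "vel a b \<gamma> s \<kappa>' = (\<Sum>i\<in>Basis. (vel a b \<gamma> s \<kappa> \<bullet> i) *\<^sub>R Dtrans \<kappa> \<kappa>' ((snd \<kappa> \<circ> \<gamma>) s) i)"
      if "s \<in> ?S" for s
    proof -
      have "vel a b \<gamma> s \<in> tangent_space A (\<gamma> s)"
        using velocity_in_tangent_space[OF assms(1) C1] that by auto
      moreover have "\<gamma> s \<in> fst \<kappa>" "\<gamma> s \<in> fst \<kappa>'" using that by auto
      ultimately have "vel a b \<gamma> s \<kappa>' = Dtrans \<kappa> \<kappa>' ((snd \<kappa> \<circ> \<gamma>) s) (vel a b \<gamma> s \<kappa>)"
        using \<kappa> \<kappa>' unfolding tangent_space_def comp_def by blast
      also have "\<dots> = (\<Sum>i\<in>Basis. (vel a b \<gamma> s \<kappa> \<bullet> i) *\<^sub>R Dtrans \<kappa> \<kappa>' ((snd \<kappa> \<circ> \<gamma>) s) i)"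
        using that by (intro linear_eq_sum_Basis Dtrans_linear \<kappa> \<kappa>') auto
      finally show ?thesis .
    qed
    have d1: "((\<lambda>s. Dtrans \<kappa> \<kappa>' ((snd \<kappa> \<circ> \<gamma>) s) i) has_vector_derivative D2trans \<kappa> \<kappa>' x v i) (at t within {a..b})" for i
      unfolding v_def
      by (rule has_vector_derivative_compose_fun[OF velocity_has_vector_derivative[OF assms(1) C1 \<kappa>(1) assms(3) \<kappa>(2)]])
        (use Dtrans_has_derivative[OF \<kappa>(1) \<kappa>'(1) x] in \<open>simp add: x_def\<close>)
    have d2: "((\<lambda>s. vel a b \<gamma> s \<kappa>) has_vector_derivative w) (at t within {a..b})"
      unfolding w_def using velocity_has_vector_derivative_2[OF assms(1,2) \<kappa>(1) assms(3) \<kappa>(2)] .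
    have d3: "((\<lambda>s. vel a b \<gamma> s \<kappa> \<bullet> i) has_real_derivative w \<bullet> i) (at t within {a..b})" for i
      using bounded_linear.has_vector_derivative[OF bounded_linear_inner_left d2, of i]
      by (simp add: has_real_derivative_iff_has_vector_derivative)
    have "((\<lambda>s. \<Sum>i\<in>Basis. (vel a b \<gamma> s \<kappa> \<bullet> i) *\<^sub>R Dtrans \<kappa> \<kappa>' ((snd \<kappa> \<circ> \<gamma>) s) i) has_vector_derivative
       (\<Sum>i\<in>Basis. (vel a b \<gamma> t \<kappa> \<bullet> i) *\<^sub>R D2trans \<kappa> \<kappa>' x v i + (w \<bullet> i) *\<^sub>R Dtrans \<kappa> \<kappa>' ((snd \<kappa> \<circ> \<gamma>) t) i)) (at t within {a..b})"
      by (intro has_vector_derivative_sum has_vector_derivative_scaleR d1 d3)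
    moreover have "(\<Sum>i\<in>Basis. (vel a b \<gamma> t \<kappa> \<bullet> i) *\<^sub>R D2trans \<kappa> \<kappa>' x v i + (w \<bullet> i) *\<^sub>R Dtrans \<kappa> \<kappa>' ((snd \<kappa> \<circ> \<gamma>) t) i)
        = D2trans \<kappa> \<kappa>' x v v + D w"
      using linear_eq_sum_Basis[of "D2trans \<kappa> \<kappa>' x v" v] D2trans_bilinear[OF \<kappa>(1) \<kappa>'(1) x] linear_eq_sum_Basis[OF linD, of w]
      by (simp add: sum.distrib bilinear_def v_def D_def x_def)
    ultimately have "((\<lambda>s. \<Sum>i\<in>Basis. (vel a b \<gamma> s \<kappa> \<bullet> i) *\<^sub>R Dtrans \<kappa> \<kappa>' ((snd \<kappa> \<circ> \<gamma>) s) i) has_vector_derivative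
       D2trans \<kappa> \<kappa>' x v v + D w) (at t within ?S)" unfolding S by simp
    from has_vector_derivative_cong_on[THEN iffD2, OF t vel' this]
    have "((\<lambda>s. vel a b \<gamma> s \<kappa>') has_vector_derivative D2trans \<kappa> \<kappa>' x v v + D w) (at t within ?S)" .
    then have "vector_derivative (\<lambda>s. vel a b \<gamma> s \<kappa>') (at t within {a..b}) = D2trans \<kappa> \<kappa>' x v v + D w"
      unfolding S by (rule vector_derivative_eqI[OF assms(1,3)])
    moreover have "vel a b \<gamma> t \<kappa>' = D v"
      using velocity_in_tangent_space[OF assms(1) C1 assms(3)] \<kappa> \<kappa>' unfolding tangent_space_def D_def v_def x_def by blast
    moreover have "D (christoffel g \<kappa> x v v) = D2trans \<kappa> \<kappa>' x v v + christoffel g \<kappa>' (snd \<kappa>' (\<gamma> t)) (D v) (D v)"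
      using christoffel_transition[OF \<kappa>(1) \<kappa>'(1) x, of v v] \<kappa> by (simp add: D_def x_def transition_apply)
    ultimately have "acceleration a b \<gamma> t \<kappa>' = D (w + christoffel g \<kappa> x v v)"
      using acceleration_chart[of \<kappa>' \<gamma> t a b] \<kappa>' linD by (simp add: linear_add)
    then show ?thesis using acceleration_chart[of \<kappa> \<gamma> t a b] \<kappa> by (simp add: D_def w_def v_def x_def)
  qed
  moreover have "acceleration a b \<gamma> t \<kappa> = 0" if "\<not> (\<kappa> \<in> A \<and> \<gamma> t \<in> fst \<kappa>)" for \<kappa>
    using that by (auto simp: cov_deriv_def)
  ultimately show ?thesis unfolding tangent_space_def by blast
qed

end

context variational_problem
begin

definition energy_density :: "real \<Rightarrow> real \<Rightarrow> (real \<Rightarrow> 'q) \<Rightarrow> real \<Rightarrow> real" where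
  "energy_density a b \<gamma> t = 1/2 * (tnorm A g (\<gamma> t) (acceleration a b \<gamma> t))\<^sup>2 + V (\<gamma> t)"

text \<open>
  The action on a subinterval. All derivatives refer to that interval, so that it only depends on the restriction of the curve.
\<close>

definition act :: "real \<Rightarrow> real \<Rightarrow> (real \<Rightarrow> 'q) \<Rightarrow> real" where
  "act a b \<gamma> = integral {a..b} (energy_density a b \<gamma>)"

lemma action_eq_act: "action A g V T \<gamma> = act 0 T \<gamma>"
  by (simp add: action_def act_def energy_density_def[abs_def])

lemma energy_density_chart:
  fixes a b :: real
  assumes "a < b" "ck_curve A 2 {a..b} \<gamma>" "\<kappa> \<in> A" "t \<in> {a..b}" "\<gamma> t \<in> fst \<kappa>"
  shows "energy_density a b \<gamma> t = lagrangian \<kappa> (snd \<kappa> (\<gamma> t), vel a b \<gamma> t \<kappa>,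
     vector_derivative (\<lambda>s. vel a b \<gamma> s \<kappa>) (at t within {a..b}))"
  using tnorm_chart[OF assms(3,5) acceleration_in_tangent_space[OF assms(1,2,4)]]
    acceleration_chart[of \<kappa> \<gamma> t a b] assms(3,5)
  by (simp add: energy_density_def lagrangian_def chart_inv_chart)

text \<open>
  Near every time the density is the Lagrangian of some chart, evaluated at the coordinates of a curve
  that is smooth up to the ends of the interval.
\<close>

lemma energy_density_continuous:
  fixes a b :: real
  assumes "a < b" "smooth_curve A {a..b} \<gamma>"
  shows "continuous_on {a..b} (energy_density a b \<gamma>)"
  unfolding continuous_on_eq_continuous_within
proof
  fix t assume t: "t \<in> {a..b}"
  obtain \<kappa> where \<kappa>: "\<kappa> \<in> A" "\<gamma> t \<in> fst \<kappa>" using chart_at by blast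
  let ?S = "{a..b} \<inter> \<gamma> -` fst \<kappa>"
  let ?v = "\<lambda>s. vel a b \<gamma> s \<kappa>"
  let ?w = "\<lambda>s. vector_derivative ?v (at s within {a..b})"
  note C = smooth_curveD[OF assms(2)]
  have op: "openin (top_of_set {a..b}) ?S" by (rule openin_chart_preimage[OF \<kappa>(1) ck_curve_continuous[OF C]])
  have tS: "t \<in> ?S" using t \<kappa> by auto
  have v2: "ck_on (Suc 0) ?S ?v" using velocity_ck_on[OF assms(1) C \<kappa>(1)] .
  obtain w' where w': "\<And>s. s \<in> ?S \<Longrightarrow> (?v has_vector_derivative w' s) (at s within ?S)" "continuous_on ?S w'"
    using ck_on_Suc_vectorE[OF v2] by (metis ck_on.simps(1))
  have w: "?w s = w' s" if "s \<in> ?S" for s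
  proof -
    have "(?v has_vector_derivative w' s) (at s within {a..b})"
      using w'(1)[OF that] at_within_relatively_open[OF op that] by metis
    then show ?thesis using vector_derivative_eqI[OF assms(1), of s ?v] that by auto
  qed
  have "continuous_on ?S (\<lambda>s. lagrangian \<kappa> ((snd \<kappa> \<circ> \<gamma>) s, ?v s, w' s))"
    using ck_on_imp_continuous_on[OF ck_curve_ck_on[OF C[of 0] \<kappa>(1)]] w'(2)
      ck_on_imp_continuous_on[OF v2]
    by (intro continuous_on_compose2[OF ck_on_imp_continuous_on[OF smooth_onD[OF lagrangian_smooth[OF \<kappa>(1)]]]]
       continuous_on_Pair) auto
  moreover have "energy_density a b \<gamma> s = lagrangian \<kappa> ((snd \<kappa> \<circ> \<gamma>) s, ?v s, w' s)" if "s \<in> ?S" for s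
    using energy_density_chart[OF assms(1) C \<kappa>(1)] that w[OF that] by auto
  ultimately have "continuous_on ?S (energy_density a b \<gamma>)"
    using continuous_on_cong[of ?S ?S "energy_density a b \<gamma>" "\<lambda>s. lagrangian \<kappa> ((snd \<kappa> \<circ> \<gamma>) s, ?v s, w' s)"] by blast
  then have "continuous (at t within ?S) (energy_density a b \<gamma>)"
    using tS continuous_on_eq_continuous_within by blast
  then show "continuous (at t within {a..b}) (energy_density a b \<gamma>)"
    using at_within_relatively_open[OF op tS] by metis
qed

text \<open>
  At interior times of the smaller interval all derivatives are two-sided. Changing the interval of
  reference therefore changes the density at the ends only, which is harmless for integrals.
\<close>

lemma energy_density_local:
  fixes a b c d :: real
  assumes t: "c < t" "t < d" "a \<le> c" "d \<le> b" "\<And>s. s \<in> {c<..<d} \<Longrightarrow> \<gamma> s = \<gamma>' s"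
  shows "energy_density a b \<gamma> t = energy_density c d \<gamma>' t"
proof -
  have at: "at s within {a..b} = at s" "at s within {c..d} = at s" if "s \<in> {c<..<d}" for s
    using that t by (auto intro!: at_within_interior)
  have nh: "eventually (\<lambda>s. s \<in> {c<..<d}) (nhds s)" if "s \<in> {c<..<d}" for s
    using that by (intro eventually_nhds_in_open) auto
  have vel_eq: "vel a b \<gamma> s = vel c d \<gamma>' s" if "s \<in> {c<..<d}" for s
  proof
    fix \<kappa> :: "('q, 'e) chart"
    have "vector_derivative (snd \<kappa> \<circ> \<gamma>) (at s within {a..b}) = vector_derivative (snd \<kappa> \<circ> \<gamma>') (at s within {c..d})"
      unfolding at[OF that]
      by (rule vector_derivative_cong_eq) (use nh[OF that] assms(5) in \<open>auto elim!: eventually_mono\<close>)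
    then show "vel a b \<gamma> s \<kappa> = vel c d \<gamma>' s \<kappa>" using assms(5)[OF that] by (simp add: velocity_def)
  qed
  have tc: "t \<in> {c<..<d}" using t by auto
  have "acceleration a b \<gamma> t = acceleration c d \<gamma>' t"
  proof
    fix \<kappa> :: "('q, 'e) chart"
    have "vector_derivative (\<lambda>s. vel a b \<gamma> s \<kappa>) (at t within {a..b}) = vector_derivative (\<lambda>s. vel c d \<gamma>' s \<kappa>) (at t within {c..d})"
      unfolding at[OF tc]
      by (rule vector_derivative_cong_eq) (use nh[OF tc] vel_eq in \<open>auto elim!: eventually_mono\<close>)
    then show "acceleration a b \<gamma> t \<kappa> = acceleration c d \<gamma>' t \<kappa>"
      using assms(5)[OF tc] vel_eq[OF tc] by (simp add: cov_deriv_def)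
  qed
  then show ?thesis using assms(5)[OF tc] by (simp add: energy_density_def)
qed

lemma energy_density_integrable:
  assumes "piecewise_smooth a b \<gamma>" "a \<le> b"
  shows "energy_density a b \<gamma> integrable_on {a..b}"
proof -
  obtain P where P: "finite P"
    "\<And>c d. a \<le> c \<Longrightarrow> c < d \<Longrightarrow> d \<le> b \<Longrightarrow> {c<..<d} \<inter> P = {} \<Longrightarrow> smooth_curve A {c..d} \<gamma>"
    using assms(1) unfolding piecewise_smooth_def by blast
  show ?thesis
  proof (rule integrable_on_pieces[OF P(1) assms(2)])
    fix c d assume *: "a \<le> c" "c < d" "d \<le> b" "{c<..<d} \<inter> P = {}"
    have "energy_density c d \<gamma> integrable_on {c..d}"
      using energy_density_continuous[OF *(2) P(2)[OF *]] by (rule integrable_continuous_real)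
    then show "energy_density a b \<gamma> integrable_on {c..d}"
      by (rule integrable_spike_finite[of "{c, d}", rotated 2])
        (use * energy_density_local[of c _ d a b \<gamma> \<gamma>] in \<open>auto simp: less_le\<close>)
  qed
qed

lemma integral_energy_density_restrict:
  assumes "a \<le> c" "d \<le> b" "\<And>t. t \<in> {c<..<d} \<Longrightarrow> \<gamma> t = \<gamma>' t"
  shows "integral {c..d} (energy_density a b \<gamma>) = act c d \<gamma>'"
  unfolding act_def
  by (rule integral_spike[of "{c, d}"])
    (use energy_density_local[of c _ d a b \<gamma> \<gamma>'] assms in \<open>auto simp: less_le\<close>)

lemma act_cong:
  assumes "\<And>t. t \<in> {a..b} \<Longrightarrow> \<gamma> t = \<gamma>' t"
  shows "act a b \<gamma> = act a b \<gamma>'"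
  using integral_energy_density_restrict[of a a b b \<gamma> \<gamma>'] assms by (simp add: act_def)

lemma act_split:
  assumes "piecewise_smooth a b \<gamma>" "a \<le> c" "c \<le> b"
  shows "act a b \<gamma> = act a c \<gamma> + act c b \<gamma>"
proof -
  have "act a b \<gamma> = integral {a..c} (energy_density a b \<gamma>) + integral {c..b} (energy_density a b \<gamma>)"
    unfolding act_def
    using Henstock_Kurzweil_Integration.integral_combine[OF assms(2,3) energy_density_integrable[OF assms(1)]] assms
    by simp
  then show ?thesis using integral_energy_density_restrict[of a a c b \<gamma> \<gamma>] integral_energy_density_restrict[of a c b b \<gamma> \<gamma>] assms by simp
qed

lemma act_chart_curve:
  assumes \<kappa>: "\<kappa> \<in> A" and ab: "a < b" and X: "two_jet a b X" and in_coords: "\<And>t. t \<in> {a..b} \<Longrightarrow> fst (X t) \<in> coords \<kappa>"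
  shows "act a b (\<lambda>t. chart_inv \<kappa> (fst (X t))) = integral {a..b} (\<lambda>t. lagrangian \<kappa> (X t))"
  unfolding act_def
proof (rule integral_cong)
  fix t assume t: "t \<in> {a..b}"
  let ?\<gamma> = "\<lambda>t. chart_inv \<kappa> (fst (X t))"
  have v: "vel a b ?\<gamma> s \<kappa> = fst (snd (X s))" if "s \<in> {a..b}" for s
    by (rule velocity_chart_curve[OF \<kappa> ab that in_coords two_jetD(2)[OF X that]])
  from has_vector_derivative_cong_on[THEN iffD2, OF t v two_jetD(3)[OF X t]]
  have "vector_derivative (\<lambda>s. vel a b ?\<gamma> s \<kappa>) (at t within {a..b}) = snd (snd (X t))"
    by (rule vector_derivative_eqI[OF ab t])
  then show "energy_density a b ?\<gamma> t = lagrangian \<kappa> (X t)"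
    using energy_density_chart[OF ab smooth_curveD[OF chart_curve_smooth[OF \<kappa> ab two_jetD(1)[OF X] in_coords]]
        \<kappa> t chart_inv_in[OF \<kappa> in_coords[OF t]]]
      v[OF t] chart_chart_inv[OF \<kappa> in_coords[OF t]] by simp
qed

end

section \<open>Rigidity for elliptic Lagrangians\<close>

lemma ck_on_Suc_lipschitz:
  fixes f :: "'a::euclidean_space \<Rightarrow> 'b::real_normed_vector"
  assumes "ck_on (Suc 0) U f" "open U" "compact K" "convex K" "K \<subseteq> U"
  obtains C where "0 \<le> C" "\<And>x y. x \<in> K \<Longrightarrow> y \<in> K \<Longrightarrow> norm (f x - f y) \<le> C * norm (x - y)"
proof -
  obtain F where F: "\<And>x. x \<in> U \<Longrightarrow> (f has_derivative F x) (at x within U)" "\<And>v. continuous_on U (\<lambda>x. F x v)"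
    using ck_on_SucE[OF assms(1)] by (metis ck_on.simps(1))
  have "\<exists>M. \<forall>x\<in>K. norm (F x v) \<le> M" for v
  proof -
    have "compact ((\<lambda>x. F x v) ` K)"
      using continuous_on_subset[OF F(2) assms(5)] assms(3) by (rule compact_continuous_image)
    then show ?thesis using compact_imp_bounded bounded_iff by (metis image_eqI)
  qed
  then obtain M where M: "\<And>x v. x \<in> K \<Longrightarrow> norm (F x v) \<le> M v" by metis
  define C where "C = (\<Sum>i\<in>Basis. \<bar>M i\<bar>)"
  show thesis
  proof (rule that[of C])
    show "0 \<le> C" by (simp add: C_def sum_nonneg)
    fix x y assume "x \<in> K" "y \<in> K"
    show "norm (f x - f y) \<le> C * norm (x - y)"
    proof (rule differentiable_bound[OF assms(4) _ _ \<open>x \<in> K\<close> \<open>y \<in> K\<close>])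
      fix z assume z: "z \<in> K"
      then have d: "(f has_derivative F z) (at z within U)" using F(1) assms(5) by blast
      then show "(f has_derivative F z) (at z within K)" using assms(5) by (rule has_derivative_subset)
      show "onorm (F z) \<le> C"
      proof (rule onorm_bound)
        fix v
        have "norm (F z v) = norm (\<Sum>i\<in>Basis. (v \<bullet> i) *\<^sub>R F z i)"
          using linear_eq_sum_Basis[OF has_derivative_linear[OF d]] by metis
        also have "\<dots> \<le> (\<Sum>i\<in>Basis. \<bar>M i\<bar> * norm v)"
        proof (rule order_trans[OF norm_sum], rule sum_mono)
          fix i :: 'a assume "i \<in> Basis"
          have "\<bar>v \<bullet> i\<bar> * norm (F z i) \<le> norm v * \<bar>M i\<bar>"
            using M[OF z, of i] Basis_le_norm[OF \<open>i \<in> Basis\<close>, of v] by (intro mult_mono) auto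
          then show "norm ((v \<bullet> i) *\<^sub>R F z i) \<le> \<bar>M i\<bar> * norm v" by (simp add: mult.commute)
        qed
        finally show "norm (F z v) \<le> C * norm v" by (simp add: C_def sum_distrib_right)
      qed (simp add: C_def sum_nonneg)
    qed
  qed
qed

lemma smooth_on_derivative_lipschitz:
  fixes f :: "'a::euclidean_space \<Rightarrow> real"
  assumes "smooth_on U f" "open U" "compact K" "convex K" "K \<subseteq> U"
  obtains C where "0 \<le> C" "\<And>x y v. x \<in> K \<Longrightarrow> y \<in> K \<Longrightarrow>
    \<bar>frechet_derivative f (at x) v - frechet_derivative f (at y) v\<bar> \<le> C * norm (x - y) * norm v"
proof -
  let ?D = "\<lambda>x. frechet_derivative f (at x)"
  have "\<exists>C\<ge>0. \<forall>x\<in>K. \<forall>y\<in>K. norm (?D x i - ?D y i) \<le> C * norm (x - y)" for i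
    using ck_on_Suc_lipschitz[OF smooth_onD[OF smooth_on_frechet_derivative[OF assms(1,2)]] assms(2-5)]
    by metis
  then obtain c where c: "\<And>i. 0 \<le> c i" "\<And>i x y. x \<in> K \<Longrightarrow> y \<in> K \<Longrightarrow> norm (?D x i - ?D y i) \<le> c i * norm (x - y)"
    by metis
  show thesis
  proof (rule that[of "\<Sum>i\<in>Basis. c i"])
    show "0 \<le> (\<Sum>i\<in>Basis. c i)" using c(1) by (simp add: sum_nonneg)
    fix x y v assume xy: "x \<in> K" "y \<in> K"
    then have "linear (?D x)" "linear (?D y)"
      using smooth_on_has_derivative[OF assms(1,2)] assms(5) has_derivative_linear by blast+
    then have "?D x v - ?D y v = (\<Sum>i\<in>Basis. (v \<bullet> i) * (?D x i - ?D y i))"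
      using linear_eq_sum_Basis[of "?D x" v] linear_eq_sum_Basis[of "?D y" v]
      by (simp add: sum_subtractf right_diff_distrib)
    then have "\<bar>?D x v - ?D y v\<bar> \<le> (\<Sum>i\<in>Basis. \<bar>(v \<bullet> i) * (?D x i - ?D y i)\<bar>)"
      using sum_abs by metis
    also have "\<dots> \<le> (\<Sum>i\<in>Basis. norm v * (c i * norm (x - y)))"
      using c(2)[OF xy] by (intro sum_mono) (auto simp: abs_mult Basis_le_norm intro!: mult_mono)
    finally show "\<bar>?D x v - ?D y v\<bar> \<le> (\<Sum>i\<in>Basis. c i) * norm (x - y) * norm v"
      by (simp add: sum_distrib_left sum_distrib_right mult_ac)
  qed
qed

lemma taylor_quadratic:
  fixes f :: "'a::euclidean_space \<Rightarrow> real"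
  assumes "smooth_on U f" "open U" "convex K" "K \<subseteq> U" "0 \<le> C"
    and lip: "\<And>x y v. x \<in> K \<Longrightarrow> y \<in> K \<Longrightarrow>
      \<bar>frechet_derivative f (at x) v - frechet_derivative f (at y) v\<bar> \<le> C * norm (x - y) * norm v"
    and x: "x \<in> K" "x + v \<in> K"
  shows "\<bar>f (x + v) - f x - frechet_derivative f (at x) v\<bar> \<le> C * (norm v)\<^sup>2"
proof -
  let ?S = "closed_segment x (x + v)"
  have S: "?S \<subseteq> K" using assms(3) x by (simp add: closed_segment_subset)
  have "norm (f (x + v) - f x - frechet_derivative f (at x) (x + v - x)) \<le> norm (x + v - x) * (C * norm v)"
  proof (rule differentiable_bound_linearization)
    show "x + t *\<^sub>R (x + v - x) \<in> ?S" if "t \<in> {0..1}" for t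
      using that by (auto simp: in_segment algebra_simps intro!: exI[of _ t])
    fix y assume y: "y \<in> ?S"
    then show "(f has_derivative frechet_derivative f (at y)) (at y within ?S)"
      using smooth_on_has_derivative[OF assms(1,2)] S assms(4) has_derivative_at_withinI by blast
    show "onorm (frechet_derivative f (at y) - frechet_derivative f (at x)) \<le> C * norm v"
    proof (rule onorm_bound)
      fix w
      have "\<bar>frechet_derivative f (at y) w - frechet_derivative f (at x) w\<bar> \<le> C * norm (y - x) * norm w"
        using y S x by (intro lip) auto
      also have "\<dots> \<le> C * norm v * norm w"
        using segment_bound1[OF y] assms(5) by (intro mult_right_mono mult_left_mono) auto
      finally show "norm ((frechet_derivative f (at y) - frechet_derivative f (at x)) w) \<le> C * norm v * norm w"
        by simp
    qed (use assms(5) in simp)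
  qed simp
  then show ?thesis by (simp add: power2_eq_square mult_ac)
qed

lemma norm_le_integral_derivative:
  fixes f :: "real \<Rightarrow> 'b::euclidean_space"
  assumes f: "\<And>t. t \<in> {a..b} \<Longrightarrow> (f has_vector_derivative f' t) (at t within {a..b})"
    and c: "continuous_on {a..b} f'" and p: "p \<in> {a..b}" "f p = 0" and t: "t \<in> {a..b}"
  shows "norm (f t) \<le> integral {a..b} (\<lambda>s. norm (f' s))"
proof -
  have main: "norm (f v - f u) \<le> integral {a..b} (\<lambda>s. norm (f' s))" if uv: "a \<le> u" "u \<le> v" "v \<le> b" for u v
  proof -
    have sub: "{u..v} \<subseteq> {a..b}" using uv by auto
    have "(f' has_integral (f v - f u)) {u..v}"
      using uv by (intro fundamental_theorem_of_calculus has_vector_derivative_within_subset[OF f sub]) auto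
    then have "norm (f v - f u) = norm (integral {u..v} f')" by (simp add: integral_unique)
    also have "\<dots> \<le> integral {u..v} (\<lambda>s. norm (f' s))"
      using continuous_on_subset[OF c sub] by (intro integral_norm_bound_integral integrable_continuous_real continuous_on_norm) auto
    also have "\<dots> \<le> integral {a..b} (\<lambda>s. norm (f' s))"
      using continuous_on_subset[OF c sub] c sub
      by (intro integral_subset_le integrable_continuous_real continuous_on_norm) auto
    finally show ?thesis .
  qed
  show ?thesis
  proof (cases "p \<le> t")
    case True then show ?thesis using main[of p t] p t by auto
  next
    case False then show ?thesis using main[of t p] p t by auto
  qed
qed

text \<open>
  Integrate twice from the common zero \<open>p\<close>. The interval has length at most 1, so the same constant
  serves for the function and for its first derivative.
\<close>

lemma norm_le_integral_second_derivative:
  fixes f :: "real \<Rightarrow> 'b::euclidean_space"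
  assumes f: "\<And>t. t \<in> {a..b} \<Longrightarrow> (f has_vector_derivative f1 t) (at t within {a..b})"
    and f1: "\<And>t. t \<in> {a..b} \<Longrightarrow> (f1 has_vector_derivative f2 t) (at t within {a..b})"
    and c: "continuous_on {a..b} f2" and p: "p \<in> {a..b}" "f p = 0" "f1 p = 0" and "b - a \<le> 1"
    and t: "t \<in> {a..b}"
  shows "norm (f1 t) \<le> integral {a..b} (\<lambda>s. norm (f2 s))"
    and "norm (f t) \<le> integral {a..b} (\<lambda>s. norm (f2 s))"
proof -
  define M where "M = integral {a..b} (\<lambda>s. norm (f2 s))"
  have 1: "norm (f1 t) \<le> M" if "t \<in> {a..b}" for t
    unfolding M_def by (rule norm_le_integral_derivative[OF f1 c p(1,3) that])
  then show "norm (f1 t) \<le> integral {a..b} (\<lambda>s. norm (f2 s))" using t by (simp add: M_def)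
  have "0 \<le> M" using norm_ge_zero 1[OF t] by (rule order_trans)
  have c1: "continuous_on {a..b} f1"
    by (rule continuous_on_vector_derivative[OF f1])
  have "norm (f t) \<le> integral {a..b} (\<lambda>s. norm (f1 s))"
    by (rule norm_le_integral_derivative[OF f c1 p(1,2) t])
  also have "\<dots> \<le> integral {a..b} (\<lambda>s. M)"
    using 1 c1 by (intro integral_le integrable_continuous_real continuous_on_norm continuous_on_const) auto
  also have "\<dots> = (b - a) * M" using t by simp
  also have "\<dots> \<le> M" using \<open>b - a \<le> 1\<close> \<open>0 \<le> M\<close> mult_right_mono[of "b - a" 1 M] by simp
  finally show "norm (f t) \<le> integral {a..b} (\<lambda>s. norm (f2 s))" by (simp add: M_def)
qed

text \<open>
  Minimality, along rays of variations, of a pair of curves: \<open>X\<close> on \<open>[a, b]\<close> and \<open>Z\<close> on \<open>[a', b']\<close>. The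
  variations vanish to first order at the times \<open>e\<close> and \<open>e'\<close> and match to first order at the time \<open>p\<close>.
  In the application the two intervals are adjacent at \<open>p\<close>, and \<open>e\<close> and \<open>e'\<close> are their outer ends.
  No order of the two intervals is fixed, so that the past and the future of \<open>p\<close> are treated alike.
\<close>

definition broken_minimal ::
  "('e::euclidean_space \<times> 'e \<times> 'e \<Rightarrow> real) \<Rightarrow> real \<Rightarrow>
   real \<Rightarrow> real \<Rightarrow> real \<Rightarrow> (real \<Rightarrow> 'e \<times> 'e \<times> 'e) \<Rightarrow> real \<Rightarrow> real \<Rightarrow> real \<Rightarrow> (real \<Rightarrow> 'e \<times> 'e \<times> 'e) \<Rightarrow> bool" where
  "broken_minimal L p a b e X a' b' e' Z \<longleftrightarrow>
     (\<forall>H G. two_jet a b H \<and> two_jet a' b' G \<and> one_jet H e = 0 \<and> one_jet G e' = 0 \<and> one_jet H p = one_jet G p \<longrightarrow>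
       (\<exists>s0>0. \<forall>s. \<bar>s\<bar> < s0 \<longrightarrow>
         integral {a..b} (\<lambda>t. L (X t)) + integral {a'..b'} (\<lambda>t. L (Z t)) \<le>
         integral {a..b} (\<lambda>t. L (X t + s *\<^sub>R H t)) + integral {a'..b'} (\<lambda>t. L (Z t + s *\<^sub>R G t))))"

lemma broken_minimal_commute:
  fixes X Z :: "real \<Rightarrow> 'e::euclidean_space \<times> 'e \<times> 'e"
  assumes "broken_minimal L p a b e X a' b' e' Z"
  shows "broken_minimal L p a' b' e' Z a b e X"
  unfolding broken_minimal_def add.commute[of "integral {a'..b'} _"]
proof (intro allI impI, elim conjE)
  fix G H :: "real \<Rightarrow> 'e \<times> 'e \<times> 'e"
  assume "two_jet a' b' G" "two_jet a b H" "one_jet G e' = 0" "one_jet H e = 0" "one_jet G p = one_jet H p"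
  then show "\<exists>s0>0. \<forall>s. \<bar>s\<bar> < s0 \<longrightarrow>
      integral {a..b} (\<lambda>t. L (X t)) + integral {a'..b'} (\<lambda>t. L (Z t)) \<le>
      integral {a..b} (\<lambda>t. L (X t + s *\<^sub>R H t)) + integral {a'..b'} (\<lambda>t. L (Z t + s *\<^sub>R G t))"
    using assms[unfolded broken_minimal_def, THEN spec[of _ H], THEN spec[of _ G]] by (blast intro: sym)
qed

text \<open>
  The two quantitative properties of the Lagrangian that enter the argument, on a compact convex set of
  jets: its differential is Lipschitz continuous, and in the direction of the second derivative it is
  uniformly monotone.
\<close>

locale elliptic_lagrangian =
  fixes L :: "'e::euclidean_space \<times> 'e \<times> 'e \<Rightarrow> real" and U :: "('e \<times> 'e \<times> 'e) set"
    and x0 :: 'e and r R C m :: real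
  assumes L_smooth: "smooth_on U L" and U_open: "open U"
    and r_pos: "0 < r"
    and K_U: "cball x0 r \<times> cball 0 (R + 1) \<times> cball 0 (R + 1) \<subseteq> U"
    and C_nonneg: "0 \<le> C" and m_pos: "0 < m"
    and lip: "\<And>z z' k. \<lbrakk>z \<in> cball x0 r \<times> cball 0 (R + 1) \<times> cball 0 (R + 1);
         z' \<in> cball x0 r \<times> cball 0 (R + 1) \<times> cball 0 (R + 1)\<rbrakk> \<Longrightarrow>
      \<bar>frechet_derivative L (at z) k - frechet_derivative L (at z') k\<bar> \<le> C * norm (z - z') * norm k"
    and ellip: "\<And>x v a b. \<lbrakk>x \<in> cball x0 r; norm v \<le> R + 1; norm a \<le> R + 1; norm b \<le> R + 1\<rbrakk> \<Longrightarrow>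
      m * (norm (a - b))\<^sup>2 \<le> frechet_derivative L (at (x, v, a)) (0, 0, a - b)
         - frechet_derivative L (at (x, v, b)) (0, 0, a - b)"
begin

abbreviation K :: "('e \<times> 'e \<times> 'e) set" where
  "K \<equiv> cball x0 r \<times> cball 0 (R + 1) \<times> cball 0 (R + 1)"

text \<open>
  Curves with jets in this smaller set can be varied a little inside \<open>K\<close>.
\<close>

abbreviation K0 :: "('e \<times> 'e \<times> 'e) set" where
  "K0 \<equiv> cball x0 (r / 2) \<times> cball 0 R \<times> cball 0 R"

abbreviation DL :: "'e \<times> 'e \<times> 'e \<Rightarrow> 'e \<times> 'e \<times> 'e \<Rightarrow> real" where
  "DL z \<equiv> frechet_derivative L (at z)"

lemma K0_K: "K0 \<subseteq> K" using r_pos by (intro Sigma_mono subset_cball) auto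

lemma DL_linear: "z \<in> K \<Longrightarrow> linear (DL z)"
  using smooth_on_has_derivative[OF L_smooth U_open] K_U has_derivative_linear by blast

lemma L_continuous: "continuous_on K L"
  using continuous_on_subset[OF ck_on_imp_continuous_on[OF smooth_onD[OF L_smooth]] K_U] .

lemma DL_continuous:
  assumes "continuous_on S z" "continuous_on S k" "\<And>t. t \<in> S \<Longrightarrow> z t \<in> K"
  shows "continuous_on S (\<lambda>t. DL (z t) (k t))"
proof -
  have "continuous_on U (\<lambda>z. DL z i)" for i
    using ck_on_imp_continuous_on[OF smooth_onD[OF smooth_on_frechet_derivative[OF L_smooth U_open]]] .
  then have "continuous_on S (\<lambda>t. DL (z t) i)" for i
    by (rule continuous_on_compose2[OF _ assms(1)]) (use assms(3) K_U in blast)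
  then have "continuous_on S (\<lambda>t. \<Sum>i\<in>Basis. (k t \<bullet> i) *\<^sub>R DL (z t) i)"
    using assms(2) by (intro continuous_intros)
  then show ?thesis
    using continuous_on_cong[of S S "\<lambda>t. DL (z t) (k t)" "\<lambda>t. \<Sum>i\<in>Basis. (k t \<bullet> i) *\<^sub>R DL (z t) i"]
      linear_eq_sum_Basis[OF DL_linear[OF assms(3)]] by blast
qed

lemma norm_triple: "norm (x, y, z) \<le> norm x + norm y + norm z"
  using norm_Pair_le[of x "(y, z)"] norm_Pair_le[of y z] by linarith

text \<open>
  The pairing of the differentials is split into three parts. Changing \<open>a\<close> to \<open>b\<close> with \<open>x\<close> and \<open>v\<close> fixed
  gives the coercive term by ellipticity. Changing \<open>x\<close> and \<open>v\<close> afterwards, and the components \<open>h\<close> and \<open>k\<close> of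
  the variation, give errors that contain a factor \<open>M\<close> by Lipschitz continuity.
\<close>

lemma monotone_jets:
  assumes X: "(x, v, a) \<in> K" and Y: "(y, u, b) \<in> K"
    and M: "norm (x - y) \<le> M" "norm (v - u) \<le> M" "norm h \<le> M" "norm k \<le> M"
  shows "m * (norm (a - b))\<^sup>2 - 4 * C * M * norm (a - b) - 4 * C * M\<^sup>2
    \<le> DL (x, v, a) (h, k, a - b) - DL (y, u, b) (h, k, a - b)"
proof -
  define n where "n = norm (a - b)"
  have M0: "0 \<le> M" using M(1) norm_ge_zero order_trans by blast
  have split: "DL z (h, k, a - b) = DL z (h, k, 0) + DL z (0, 0, a - b)" if "z \<in> K" for z
    using linear_add[OF DL_linear[OF that], of "(h, k, 0)" "(0, 0, a - b)"] by simp
  have "\<bar>DL (x, v, a) (h, k, 0) - DL (y, u, b) (h, k, 0)\<bar> \<le> C * norm ((x, v, a) - (y, u, b)) * norm (h, k, 0::'e)"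
    by (rule lip[OF X Y])
  also have "\<dots> \<le> C * (2 * M + n) * (2 * M)"
    using norm_triple[of "x - y" "v - u" "a - b"] norm_triple[of h k "0::'e"] M C_nonneg M0
    by (intro mult_mono mult_nonneg_nonneg) (auto simp: n_def)
  finally have 1: "- (C * (2 * M + n) * (2 * M)) \<le> DL (x, v, a) (h, k, 0) - DL (y, u, b) (h, k, 0)" by linarith
  have 2: "m * n\<^sup>2 \<le> DL (x, v, a) (0, 0, a - b) - DL (x, v, b) (0, 0, a - b)"
    unfolding n_def using X Y by (intro ellip) auto
  have "\<bar>DL (x, v, b) (0, 0, a - b) - DL (y, u, b) (0, 0, a - b)\<bar>
      \<le> C * norm ((x, v, b) - (y, u, b)) * norm (0::'e, 0::'e, a - b)"
    using X Y by (intro lip) auto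
  also have "\<dots> \<le> C * (2 * M) * n"
    using norm_triple[of "x - y" "v - u" "0::'e"] norm_triple[of "0::'e" "0::'e" "a - b"] M C_nonneg M0
    by (intro mult_mono mult_nonneg_nonneg) (auto simp: n_def)
  finally have 3: "- (C * (2 * M) * n) \<le> DL (x, v, b) (0, 0, a - b) - DL (y, u, b) (0, 0, a - b)" by linarith
  show ?thesis
    using 1 2 3 split[OF X] split[OF Y]
    by (simp add: n_def[symmetric] algebra_simps power2_eq_square)
qed

text \<open>
  Let \<open>M\<close> be the integral of \<open>n = |x'' - y''|\<close>. The previous estimate bounds the integral from below by
  \<open>m \<integral> n\<^sup>2\<close> minus a multiple of \<open>M\<^sup>2\<close>, and \<open>\<integral> n\<^sup>2\<close> is at least \<open>M\<^sup>2 / (b - a)\<close>. On a short interval this forces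
  \<open>M = 0\<close>, and \<open>M\<close> bounds the difference of the curves.
\<close>

lemma jets_coincide:
  assumes ab: "a < b" "b - a \<le> 1" "8 * C * (b - a) < m"
    and X: "two_jet a b X" and Y: "two_jet a b Y" and H: "two_jet a b H"
    and H2: "\<And>t. snd (snd (H t)) = snd (snd (X t)) - snd (snd (Y t))"
    and p: "p \<in> {a..b}" "one_jet X p = one_jet Y p" and e: "e \<in> {a..b}" "one_jet H e = 0"
    and K: "\<And>t. t \<in> {a..b} \<Longrightarrow> X t \<in> K" "\<And>t. t \<in> {a..b} \<Longrightarrow> Y t \<in> K"
    and I: "integral {a..b} (\<lambda>t. DL (X t) (H t) - DL (Y t) (H t)) \<le> 0"
    and t: "t \<in> {a..b}"
  shows "fst (X t) = fst (Y t)"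
proof -
  define d where "d = b - a"
  define n where "n t = norm (snd (snd (X t)) - snd (snd (Y t)))" for t
  define M where "M = integral {a..b} n"
  have c2: "continuous_on {a..b} (\<lambda>t. snd (snd (X t)) - snd (snd (Y t)))"
    by (intro continuous_on_diff two_jetD(4)[OF X] two_jetD(4)[OF Y])
  then have cn: "continuous_on {a..b} n" unfolding n_def by (rule continuous_on_norm)
  have w: "norm (fst (X t) - fst (Y t)) \<le> M" "norm (fst (snd (X t)) - fst (snd (Y t))) \<le> M" if "t \<in> {a..b}" for t
    using norm_le_integral_second_derivative[OF has_vector_derivative_diff[OF two_jetD(2)[OF X] two_jetD(2)[OF Y]]
        has_vector_derivative_diff[OF two_jetD(3)[OF X] two_jetD(3)[OF Y]] c2 p(1) _ _ ab(2) that] p(2)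
    by (auto simp: M_def n_def[abs_def])
  have hM: "norm (fst (H t)) \<le> M" "norm (fst (snd (H t))) \<le> M" if "t \<in> {a..b}" for t
    using norm_le_integral_second_derivative[OF two_jetD(2-4)[OF H] e(1) _ _ ab(2) that] e(2)
    by (auto simp: M_def n_def[abs_def] H2 zero_prod_def)
  have M0: "0 \<le> M" using w(1)[OF t] norm_ge_zero order_trans by blast
  define l where "l = M / d"
  have d0: "0 < d" using ab by (simp add: d_def)
  have "integral {a..b} (\<lambda>t. (2 * m * l - 4 * C * M) * n t + (- m * l\<^sup>2 - 4 * C * M\<^sup>2))
     \<le> integral {a..b} (\<lambda>t. DL (X t) (H t) - DL (Y t) (H t))"
  proof (rule integral_le)
    show "(\<lambda>t. (2 * m * l - 4 * C * M) * n t + (- m * l\<^sup>2 - 4 * C * M\<^sup>2)) integrable_on {a..b}"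
      using cn by (intro integrable_continuous_real continuous_intros)
    show "(\<lambda>t. DL (X t) (H t) - DL (Y t) (H t)) integrable_on {a..b}"
      using two_jet_continuous[OF X] two_jet_continuous[OF Y] two_jet_continuous[OF H] K
      by (intro integrable_continuous_real continuous_on_diff DL_continuous) auto
    fix s assume s: "s \<in> {a..b}"
    \<comment> \<open>A tangent to the parabola replaces the Cauchy-Schwarz inequality: l is the mean value of n.\<close>
    have "m * (2 * l * n s - l\<^sup>2) \<le> m * (n s)\<^sup>2"
      using m_pos zero_le_power2[of "n s - l"] by (intro mult_left_mono) (auto simp: power2_diff algebra_simps)
    moreover have "H s = (fst (H s), fst (snd (H s)), snd (snd (X s)) - snd (snd (Y s)))"
      using H2[of s] by (simp add: prod_eq_iff)
    then have "m * (n s)\<^sup>2 - 4 * C * M * n s - 4 * C * M\<^sup>2 \<le> DL (X s) (H s) - DL (Y s) (H s)"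
      using monotone_jets[OF _ _ w[OF s] hM[OF s], of "snd (snd (X s))" "snd (snd (Y s))"] K(1,2)[OF s] by (simp add: n_def)
    ultimately show "(2 * m * l - 4 * C * M) * n s + (- m * l\<^sup>2 - 4 * C * M\<^sup>2) \<le> DL (X s) (H s) - DL (Y s) (H s)"
      by (simp add: algebra_simps)
  qed
  also note I
  also have "integral {a..b} (\<lambda>t. (2 * m * l - 4 * C * M) * n t + (- m * l\<^sup>2 - 4 * C * M\<^sup>2))
    = (2 * m * l - 4 * C * M) * M + d * (- m * l\<^sup>2 - 4 * C * M\<^sup>2)"
    using cn ab(1) by (subst integral_add) (auto intro!: integrable_continuous_real continuous_intros simp: M_def d_def)
  finally have "(2 * m * l - 4 * C * M) * M + d * (- m * l\<^sup>2 - 4 * C * M\<^sup>2) \<le> 0" .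
  moreover have "d * l\<^sup>2 = l * M" using d0 by (simp add: l_def power2_eq_square)
  then have "(2 * m * l - 4 * C * M) * M + d * (- m * l\<^sup>2 - 4 * C * M\<^sup>2)
      = m * (l * M) - 4 * C * (M * M) - 4 * C * (M * M) * d" by algebra
  ultimately have "m * (l * M) \<le> 4 * C * (M * M) + 4 * C * (M * M) * d" by simp
  also have "\<dots> \<le> 4 * C * (M * M) + 4 * C * (M * M) * 1"
    using C_nonneg M0 ab(2) by (intro add_left_mono mult_left_mono) (auto simp: d_def)
  finally have "m * (l * M) * d \<le> 8 * C * (M * M) * d" using d0 by (simp add: mult_right_mono)
  moreover have "m * (l * M) * d = m * (M * M)" using d0 by (simp add: l_def)
  ultimately have "m * (M * M) \<le> 8 * C * (M * M) * d" by simp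
  then have "(m - 8 * C * d) * (M * M) \<le> 0" by (simp add: algebra_simps)
  moreover have "0 < m - 8 * C * d" using ab(3) by (simp add: d_def)
  ultimately have "M * M \<le> 0" by (simp add: mult_le_0_iff)
  then have "M = 0" using M0 by (simp add: mult_le_0_iff)
  then show ?thesis using w(1)[OF t] by simp
qed

text \<open>
  The curves \<open>X\<close> and \<open>Y\<close> are varied in opposite directions, together with \<open>Z\<close>, which continues both of
  them. In the sum of the two inequalities for the action, the terms of first order of \<open>Z\<close> cancel and
  those of \<open>X\<close> and \<open>Y\<close> give \<open>- s\<close> times the integral; Taylor's theorem bounds the rest by a multiple of \<open>s\<^sup>2\<close>.
  Dividing by \<open>s\<close> avoids differentiation under the integral sign.
\<close>

lemma first_variation_nonpos:
  fixes a b a' b' :: real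
  assumes c: "continuous_on {a..b} X" "continuous_on {a..b} Y" "continuous_on {a..b} H"
      "continuous_on {a'..b'} Z" "continuous_on {a'..b'} G"
    and K0: "\<And>t. t \<in> {a..b} \<Longrightarrow> X t \<in> K0" "\<And>t. t \<in> {a..b} \<Longrightarrow> Y t \<in> K0" "\<And>t. t \<in> {a'..b'} \<Longrightarrow> Z t \<in> K0"
    and s1: "0 < s1" "\<And>s. \<bar>s\<bar> < s1 \<Longrightarrow> integral {a..b} (\<lambda>t. L (X t)) + integral {a'..b'} (\<lambda>t. L (Z t))
      \<le> integral {a..b} (\<lambda>t. L (X t + s *\<^sub>R H t)) + integral {a'..b'} (\<lambda>t. L (Z t + s *\<^sub>R G t))"
    and s2: "0 < s2" "\<And>s. \<bar>s\<bar> < s2 \<Longrightarrow> integral {a..b} (\<lambda>t. L (Y t)) + integral {a'..b'} (\<lambda>t. L (Z t))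
      \<le> integral {a..b} (\<lambda>t. L (Y t + s *\<^sub>R H t)) + integral {a'..b'} (\<lambda>t. L (Z t + s *\<^sub>R G t))"
  shows "integral {a..b} (\<lambda>t. DL (X t) (H t) - DL (Y t) (H t)) \<le> 0"
proof -
  define I where "I = integral {a..b} (\<lambda>t. DL (X t) (H t) - DL (Y t) (H t))"
  have "bounded (H ` {a..b} \<union> G ` {a'..b'})"
    using compact_imp_bounded[OF compact_continuous_image[OF c(3) compact_Icc]]
      compact_imp_bounded[OF compact_continuous_image[OF c(5) compact_Icc]]
    by simp
  then obtain N where "\<And>w. w \<in> H ` {a..b} \<union> G ` {a'..b'} \<Longrightarrow> norm w \<le> N"
    unfolding bounded_iff by blast
  then have N: "\<And>t. t \<in> {a..b} \<Longrightarrow> norm (H t) \<le> N" "\<And>t. t \<in> {a'..b'} \<Longrightarrow> norm (G t) \<le> N" by auto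
  \<comment> \<open>For parameters below s0 the varied jets stay in K and both inequalities are available.\<close>
  define s0 where "s0 = min (min s1 s2) (min (r / 2) 1 / (\<bar>N\<bar> + 1))"
  have s0: "0 < s0" using s1(1) s2(1) r_pos by (simp add: s0_def)
  have inK: "z + s *\<^sub>R w \<in> K" if "z \<in> K0" "\<bar>s\<bar> < s0" "norm w \<le> N" for z w s
  proof -
    obtain x v a where z: "z = (x, v, a)" by (cases z) auto
    obtain h k l where w: "w = (h, k, l)" by (cases w) auto
    have "\<bar>s\<bar> * norm w \<le> (min (r / 2) 1 / (\<bar>N\<bar> + 1)) * (\<bar>N\<bar> + 1)"
      using that r_pos by (intro mult_mono) (auto simp: s0_def)
    then have sw: "\<bar>s\<bar> * norm w \<le> r / 2" "\<bar>s\<bar> * norm w \<le> 1" by auto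
    have hw: "norm h \<le> norm w" "norm k \<le> norm w" "norm l \<le> norm w"
      unfolding w by (rule norm_fst_le order_trans[OF norm_fst_le norm_snd_le] order_trans[OF norm_snd_le norm_snd_le])+
    have b: "norm (s *\<^sub>R h) \<le> r / 2" "norm (s *\<^sub>R k) \<le> 1" "norm (s *\<^sub>R l) \<le> 1"
      using sw mult_left_mono[OF hw(1), of "\<bar>s\<bar>"] mult_left_mono[OF hw(2), of "\<bar>s\<bar>"] mult_left_mono[OF hw(3), of "\<bar>s\<bar>"]
      by auto
    have "dist x0 (x + s *\<^sub>R h) \<le> dist x0 x + norm (s *\<^sub>R h)"
      using dist_triangle[of x0 "x + s *\<^sub>R h" x] by (simp add: dist_norm)
    then have "dist x0 (x + s *\<^sub>R h) \<le> r" using b(1) that(1) z by auto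
    moreover have "norm (v + s *\<^sub>R k) \<le> R + 1" "norm (a + s *\<^sub>R l) \<le> R + 1"
      using norm_triangle_ineq[of v "s *\<^sub>R k"] norm_triangle_ineq[of a "s *\<^sub>R l"] b that(1) z by auto
    ultimately show ?thesis by (simp add: z w)
  qed
  have taylor: "L (z + s *\<^sub>R w) \<le> L z + s * DL z w + s\<^sup>2 * (C * N\<^sup>2)" if "z \<in> K0" "\<bar>s\<bar> < s0" "norm w \<le> N" for z w s
  proof -
    have "z \<in> K" using that(1) K0_K by blast
    have "\<bar>L (z + s *\<^sub>R w) - L z - DL z (s *\<^sub>R w)\<bar> \<le> C * (norm (s *\<^sub>R w))\<^sup>2"
      by (rule taylor_quadratic[OF L_smooth U_open _ K_U C_nonneg lip \<open>z \<in> K\<close> inK[OF that]])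
        (auto intro: convex_Times)
    also have "\<dots> \<le> C * (\<bar>s\<bar> * N)\<^sup>2"
      using that(3) C_nonneg by (intro mult_left_mono power_mono) (auto intro: mult_left_mono)
    also have "\<dots> = s\<^sup>2 * (C * N\<^sup>2)" by (simp add: power_mult_distrib)
    finally show ?thesis using linear_scale[OF DL_linear[OF \<open>z \<in> K\<close>], of s w] by simp
  qed
  define Q where "Q = 2 * C * N\<^sup>2 * (\<bar>b - a\<bar> + \<bar>b' - a'\<bar>)"
  have cL: "continuous_on {c..d} (\<lambda>t. L (z t))" if "continuous_on {c..d} z" "\<And>t. t \<in> {c..d} \<Longrightarrow> z t \<in> K" for c d :: real and z
    by (rule continuous_on_compose2[OF L_continuous that(1)]) (use that(2) in blast)
  have key: "s * I \<le> s\<^sup>2 * Q" if s: "0 < s" "s < s0" for s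
  proof -
    have K: "\<And>t. t \<in> {a..b} \<Longrightarrow> X t \<in> K" "\<And>t. t \<in> {a..b} \<Longrightarrow> Y t \<in> K" "\<And>t. t \<in> {a'..b'} \<Longrightarrow> Z t \<in> K"
      using K0 K0_K by blast+
    have Ks: "\<And>t. t \<in> {a..b} \<Longrightarrow> X t + (- s) *\<^sub>R H t \<in> K" "\<And>t. t \<in> {a..b} \<Longrightarrow> Y t + s *\<^sub>R H t \<in> K"
       "\<And>t. t \<in> {a'..b'} \<Longrightarrow> Z t + (- s) *\<^sub>R G t \<in> K" "\<And>t. t \<in> {a'..b'} \<Longrightarrow> Z t + s *\<^sub>R G t \<in> K"
      using s by (auto intro!: inK K0 N simp del: scaleR_minus_left)
    have i: "(\<lambda>t. L (X t)) integrable_on {a..b}" "(\<lambda>t. L (Y t)) integrable_on {a..b}"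
      "(\<lambda>t. L (Z t)) integrable_on {a'..b'}"
      "(\<lambda>t. L (X t + (- s) *\<^sub>R H t)) integrable_on {a..b}" "(\<lambda>t. L (Y t + s *\<^sub>R H t)) integrable_on {a..b}"
      "(\<lambda>t. L (Z t + (- s) *\<^sub>R G t)) integrable_on {a'..b'}" "(\<lambda>t. L (Z t + s *\<^sub>R G t)) integrable_on {a'..b'}"
      using c K Ks by (auto intro!: integrable_continuous_real cL continuous_intros simp del: scaleR_minus_left)
    have iD: "(\<lambda>t. DL (X t) (H t) - DL (Y t) (H t)) integrable_on {a..b}"
      using c K by (intro integrable_continuous_real continuous_on_diff DL_continuous) auto
    have "integral {a..b} (\<lambda>t. L (X t + (- s) *\<^sub>R H t) + L (Y t + s *\<^sub>R H t))
       \<le> integral {a..b} (\<lambda>t. (L (X t) + L (Y t)) + ((- s) * (DL (X t) (H t) - DL (Y t) (H t)) + 2 * s\<^sup>2 * (C * N\<^sup>2)))"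
    proof (rule integral_le)
      fix t assume t: "t \<in> {a..b}"
      show "L (X t + (- s) *\<^sub>R H t) + L (Y t + s *\<^sub>R H t) \<le>
        (L (X t) + L (Y t)) + ((- s) * (DL (X t) (H t) - DL (Y t) (H t)) + 2 * s\<^sup>2 * (C * N\<^sup>2))"
        using taylor[OF K0(1)[OF t] _ N(1)[OF t], of "- s"] taylor[OF K0(2)[OF t] _ N(1)[OF t], of s] s
        by (simp add: algebra_simps)
    qed (intro integrable_add integrable_on_mult_right i iD integrable_const_ivl)+
    also have "\<dots> = integral {a..b} (\<lambda>t. L (X t)) + integral {a..b} (\<lambda>t. L (Y t)) - s * I + integral {a..b} (\<lambda>t. 2 * s\<^sup>2 * (C * N\<^sup>2))"
      unfolding I_def
        integral_add[OF integrable_add[OF i(1,2)] integrable_add[OF integrable_on_mult_right[OF iD] integrable_const_ivl]]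
        integral_add[OF i(1,2)] integral_add[OF integrable_on_mult_right[OF iD] integrable_const_ivl] integral_mult_right
      by linarith
    also have "integral {a..b} (\<lambda>t. 2 * s\<^sup>2 * (C * N\<^sup>2)) \<le> 2 * s\<^sup>2 * (C * N\<^sup>2) * \<bar>b - a\<bar>"
    proof (cases "a \<le> b")
      case True then show ?thesis by (simp add: algebra_simps)
    next
      case False then show ?thesis using C_nonneg by simp
    qed
    finally have 1: "integral {a..b} (\<lambda>t. L (X t + (- s) *\<^sub>R H t)) + integral {a..b} (\<lambda>t. L (Y t + s *\<^sub>R H t))
      \<le> integral {a..b} (\<lambda>t. L (X t)) + integral {a..b} (\<lambda>t. L (Y t)) - s * I + 2 * s\<^sup>2 * (C * N\<^sup>2) * \<bar>b - a\<bar>"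
      unfolding integral_add[OF i(4,5)] by linarith
    have "integral {a'..b'} (\<lambda>t. L (Z t + (- s) *\<^sub>R G t) + L (Z t + s *\<^sub>R G t))
       \<le> integral {a'..b'} (\<lambda>t. (L (Z t) + L (Z t)) + 2 * s\<^sup>2 * (C * N\<^sup>2))"
    proof (rule integral_le)
      fix t assume t: "t \<in> {a'..b'}"
      show "L (Z t + (- s) *\<^sub>R G t) + L (Z t + s *\<^sub>R G t) \<le> (L (Z t) + L (Z t)) + 2 * s\<^sup>2 * (C * N\<^sup>2)"
        using taylor[OF K0(3)[OF t] _ N(2)[OF t], of "- s"] taylor[OF K0(3)[OF t] _ N(2)[OF t], of s] s
        by (simp add: algebra_simps)
    qed (intro integrable_add integrable_on_mult_right i iD integrable_const_ivl)+
    also have "\<dots> = integral {a'..b'} (\<lambda>t. L (Z t)) + integral {a'..b'} (\<lambda>t. L (Z t)) + integral {a'..b'} (\<lambda>t. 2 * s\<^sup>2 * (C * N\<^sup>2))"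
      unfolding integral_add[OF integrable_add[OF i(3,3)] integrable_const_ivl] integral_add[OF i(3,3)] ..
    also have "integral {a'..b'} (\<lambda>t. 2 * s\<^sup>2 * (C * N\<^sup>2)) \<le> 2 * s\<^sup>2 * (C * N\<^sup>2) * \<bar>b' - a'\<bar>"
    proof (cases "a' \<le> b'")
      case True then show ?thesis by (simp add: algebra_simps)
    next
      case False then show ?thesis using C_nonneg by simp
    qed
    finally have 2: "integral {a'..b'} (\<lambda>t. L (Z t + (- s) *\<^sub>R G t)) + integral {a'..b'} (\<lambda>t. L (Z t + s *\<^sub>R G t))
      \<le> integral {a'..b'} (\<lambda>t. L (Z t)) + integral {a'..b'} (\<lambda>t. L (Z t)) + 2 * s\<^sup>2 * (C * N\<^sup>2) * \<bar>b' - a'\<bar>"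
      unfolding integral_add[OF i(6,7)] by linarith
    have ss: "\<bar>- s\<bar> < s1" "\<bar>s\<bar> < s2" using s by (auto simp: s0_def)
    show ?thesis
      using 1 2 s1(2)[OF ss(1)] s2(2)[OF ss(2)] by (simp add: Q_def algebra_simps)
  qed
  have "I \<le> 0"
  proof (rule field_le_epsilon)
    fix e :: real assume e: "0 < e"
    define s where "s = min (s0 / 2) (e / (\<bar>Q\<bar> + 1))"
    have "0 < e / (\<bar>Q\<bar> + 1)" using e by (intro divide_pos_pos) auto
    then have s: "0 < s" "s < s0" using s0 unfolding s_def by linarith+
    have "I \<le> s * Q" using key[OF s] s(1) by (simp add: power2_eq_square)
    also have "\<dots> \<le> s * (\<bar>Q\<bar> + 1)" using s by (intro mult_left_mono) auto
    also have "\<dots> \<le> e / (\<bar>Q\<bar> + 1) * (\<bar>Q\<bar> + 1)" by (intro mult_right_mono) (auto simp: s_def)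
    finally show "I \<le> 0 + e" by simp
  qed
  then show ?thesis by (simp add: I_def)
qed

text \<open>
  The variation is the difference of the two curves, minus its Taylor polynomial of degree 1 at \<open>e\<close>, so that
  it vanishes to first order there without change of its second derivative. On the other interval it
  is continued by the cubic Hermite polynomial with the same value and slope at \<open>p\<close> that vanishes to
  first order at \<open>e'\<close>.
\<close>

lemma endpoint_rigidity:
  assumes ab: "a < b" "b - a \<le> 1" "8 * C * (b - a) < m" and ab': "a' < b'"
    and X: "two_jet a b X" and Y: "two_jet a b Y" and Z: "two_jet a' b' Z"
    and p: "p \<in> {a..b}" "one_jet X p = one_jet Y p" and e: "e \<in> {a..b}" and e': "e' \<noteq> p"
    and K0: "\<And>t. t \<in> {a..b} \<Longrightarrow> X t \<in> K0" "\<And>t. t \<in> {a..b} \<Longrightarrow> Y t \<in> K0" "\<And>t. t \<in> {a'..b'} \<Longrightarrow> Z t \<in> K0"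
    and XZ: "broken_minimal L p a b e X a' b' e' Z" and YZ: "broken_minimal L p a b e Y a' b' e' Z"
    and t: "t \<in> {a..b}"
  shows "fst (X t) = fst (Y t)"
proof -
  define c0 where "c0 = fst (X e) - fst (Y e)"
  define c1 where "c1 = fst (snd (X e)) - fst (snd (Y e))"
  define h where "h t = (fst (X t) - fst (Y t)) - c0 - (t - e) *\<^sub>R c1" for t
  define h1 where "h1 t = (fst (snd (X t)) - fst (snd (Y t))) - c1" for t
  define h2 where "h2 t = snd (snd (X t)) - snd (snd (Y t))" for t
  define l where "l = e' - p"
  \<comment> \<open>The coefficients of the Hermite polynomial in powers of t - p.\<close>
  define d2 where "d2 = - (1 / l\<^sup>2) *\<^sub>R (3 *\<^sub>R h p + (2 * l) *\<^sub>R h1 p)"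
  define d3 where "d3 = (1 / l ^ 3) *\<^sub>R (2 *\<^sub>R h p + l *\<^sub>R h1 p)"
  define k where "k t = h p + (t - p) *\<^sub>R h1 p + ((t - p) * (t - p)) *\<^sub>R d2 + ((t - p) * (t - p) * (t - p)) *\<^sub>R d3" for t
  define k1 where "k1 t = h1 p + (2 * (t - p)) *\<^sub>R d2 + (3 * ((t - p) * (t - p))) *\<^sub>R d3" for t
  define k2 where "k2 t = 2 *\<^sub>R d2 + (6 * (t - p)) *\<^sub>R d3" for t
  have l0: "l \<noteq> 0" using e' by (simp add: l_def)
  have S: "unique_derivs {a..b}" "unique_derivs {a'..b'}"
    using unique_derivs_interval[OF ab(1)] unique_derivs_interval[OF ab'] by auto
  have hs: "smooth_on {a..b} h" unfolding smooth_on_def h_def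
    using S smooth_onD[OF two_jetD(1)[OF X]] smooth_onD[OF two_jetD(1)[OF Y]]
    by (intro allI ck_on_diff ck_on_const ck_on_scaleR ck_on_ident)
  have ks: "smooth_on {a'..b'} k" unfolding smooth_on_def k_def
    using S by (intro allI ck_on_add ck_on_const ck_on_scaleR ck_on_mult ck_on_diff ck_on_ident)
  have hd: "(h has_vector_derivative h1 t) (at t within {a..b})" if "t \<in> {a..b}" for t
    unfolding h_def h1_def by (rule derivative_eq_intros two_jetD(2)[OF X that] two_jetD(2)[OF Y that] refl | simp)+
  have h1d: "(h1 has_vector_derivative h2 t) (at t within {a..b})" if "t \<in> {a..b}" for t
    unfolding h1_def h2_def by (rule derivative_eq_intros two_jetD(3)[OF X that] two_jetD(3)[OF Y that] refl | simp)+
  have kd: "(k has_vector_derivative k1 t) (at t within {a'..b'})" for t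
    unfolding k_def k1_def has_vector_derivative_def
    by (auto intro!: derivative_eq_intros simp: algebra_simps fun_eq_iff)
  have k1d: "(k1 has_vector_derivative k2 t) (at t within {a'..b'})" for t
    unfolding k1_def k2_def has_vector_derivative_def
    by (auto intro!: derivative_eq_intros simp: algebra_simps fun_eq_iff)
  have k_eq: "k p = h p" "k1 p = h1 p" by (simp_all add: k_def k1_def)
  have "k e' = h p + l *\<^sub>R h1 p + (l * l) *\<^sub>R d2 + (l * l * l) *\<^sub>R d3" by (simp add: k_def l_def)
  also have "\<dots> = 0"
  proof -
    have "(l * l) *\<^sub>R d2 = - (3 *\<^sub>R h p + (2 * l) *\<^sub>R h1 p)"
      using l0 by (simp add: d2_def power2_eq_square)
    moreover have "(l * l * l) *\<^sub>R d3 = 2 *\<^sub>R h p + l *\<^sub>R h1 p"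
      using l0 by (simp add: d3_def power3_eq_cube)
    moreover have "3 *\<^sub>R h p = h p + 2 *\<^sub>R h p" "(2 * l) *\<^sub>R h1 p = l *\<^sub>R h1 p + l *\<^sub>R h1 p"
      using scaleR_add_left[of 1 2 "h p"] scaleR_add_left[of l l "h1 p"] by simp_all
    ultimately show ?thesis by simp
  qed
  finally have k0: "k e' = 0" .
  have "k1 e' = h1 p + (2 * l) *\<^sub>R d2 + (3 * (l * l)) *\<^sub>R d3" by (simp add: k1_def l_def)
  also have "\<dots> = 0"
  proof -
    have "(2 * l) *\<^sub>R d2 = - ((6 / l) *\<^sub>R h p + 4 *\<^sub>R h1 p)"
      using l0 by (simp add: d2_def power2_eq_square scaleR_add_right scaleR_diff_right)
    moreover have "(3 * (l * l)) *\<^sub>R d3 = (6 / l) *\<^sub>R h p + 3 *\<^sub>R h1 p"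
      using l0 by (simp add: d3_def power3_eq_cube scaleR_add_right)
    moreover have "4 *\<^sub>R h1 p = h1 p + 3 *\<^sub>R h1 p"
      using scaleR_add_left[of 1 3 "h1 p"] by simp
    ultimately show ?thesis by simp
  qed
  finally have k10: "k1 e' = 0" .
  have he: "h e = 0" "h1 e = 0" by (simp_all add: h_def h1_def c0_def c1_def)
  define H where "H t = (h t, h1 t, h2 t)" for t
  define G where "G t = (k t, k1 t, k2 t)" for t
  have H: "two_jet a b H" unfolding two_jet_def H_def
    using hs hd h1d two_jetD(4)[OF X] two_jetD(4)[OF Y] by (auto simp: h2_def intro!: continuous_on_diff)
  have G: "two_jet a' b' G" unfolding two_jet_def G_def
    using ks kd k1d by (auto simp: k2_def intro!: continuous_intros)
  have jets: "one_jet H e = 0" "one_jet G e' = 0" "one_jet H p = one_jet G p"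
    using he k0 k10 k_eq by (simp_all add: H_def G_def zero_prod_def)
  obtain s1 where s1: "0 < s1" "\<And>s. \<bar>s\<bar> < s1 \<Longrightarrow> integral {a..b} (\<lambda>t. L (X t)) + integral {a'..b'} (\<lambda>t. L (Z t))
      \<le> integral {a..b} (\<lambda>t. L (X t + s *\<^sub>R H t)) + integral {a'..b'} (\<lambda>t. L (Z t + s *\<^sub>R G t))"
    using XZ H G jets unfolding broken_minimal_def by blast
  obtain s2 where s2: "0 < s2" "\<And>s. \<bar>s\<bar> < s2 \<Longrightarrow> integral {a..b} (\<lambda>t. L (Y t)) + integral {a'..b'} (\<lambda>t. L (Z t))
      \<le> integral {a..b} (\<lambda>t. L (Y t + s *\<^sub>R H t)) + integral {a'..b'} (\<lambda>t. L (Z t + s *\<^sub>R G t))"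
    using YZ H G jets unfolding broken_minimal_def by blast
  have I: "integral {a..b} (\<lambda>t. DL (X t) (H t) - DL (Y t) (H t)) \<le> 0"
    by (rule first_variation_nonpos[OF two_jet_continuous[OF X] two_jet_continuous[OF Y] two_jet_continuous[OF H]
        two_jet_continuous[OF Z] two_jet_continuous[OF G] K0 s1 s2])
  show ?thesis
    by (rule jets_coincide[OF ab X Y H _ p e jets(1) _ _ I t]) (use K0 K0_K in \<open>auto simp: H_def h2_def\<close>)
qed

end

section \<open>Ellipticity of the Lagrangian\<close>

context variational_problem
begin

text \<open>
  The smallest value of the quadratic forms, over a compact set of points and unit vectors, is attained
  and hence positive.
\<close>

lemma metric_coercive:
  assumes \<kappa>: "\<kappa> \<in> A" and S: "compact S" "S \<noteq> {}" "S \<subseteq> coords \<kappa>"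
  obtains m where "0 < m" "\<And>x c. x \<in> S \<Longrightarrow> m * (norm c)\<^sup>2 \<le> g \<kappa> x c c"
proof -
  let ?B = "S \<times> sphere (0::'e) 1"
  obtain i :: 'e where i: "i \<in> Basis" using nonempty_Basis by blast
  then have "sphere (0::'e) 1 \<noteq> {}" by (auto simp: ex_in_conv[symmetric] intro!: exI[of _ i])
  then have B: "compact ?B" "?B \<noteq> {}" using S by (auto intro: compact_Times)
  have gc: "continuous_on ?B (\<lambda>z. g \<kappa> (fst z) i j)" for i j
    by (rule continuous_on_compose2[OF ck_on_imp_continuous_on[OF smooth_onD[OF metric_smooth[OF \<kappa>]]]
          continuous_on_fst[OF continuous_on_id]]) (use S(3) in auto)
  have "continuous_on ?B (\<lambda>z. \<Sum>i\<in>Basis. \<Sum>j\<in>Basis. ((snd z \<bullet> i) * (snd z \<bullet> j)) *\<^sub>R g \<kappa> (fst z) i j)"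
    by (intro continuous_on_sum continuous_on_scaleR continuous_on_mult continuous_on_inner
      continuous_on_snd continuous_on_id continuous_on_const gc)
  moreover have "(\<Sum>i\<in>Basis. \<Sum>j\<in>Basis. ((snd z \<bullet> i) * (snd z \<bullet> j)) *\<^sub>R g \<kappa> (fst z) i j)
     = g \<kappa> (fst z) (snd z) (snd z)" if "z \<in> ?B" for z
  proof -
    have "fst z \<in> coords \<kappa>" using that S(3) by auto
    then show ?thesis using bilinear_eq_sum_Basis[OF metric_bilinear[OF \<kappa>], of "fst z" "snd z" "snd z"] by simp
  qed
  ultimately have "continuous_on ?B (\<lambda>z. g \<kappa> (fst z) (snd z) (snd z))"
    using continuous_on_cong[of ?B ?B "\<lambda>z. g \<kappa> (fst z) (snd z) (snd z)"
      "\<lambda>z. \<Sum>i\<in>Basis. \<Sum>j\<in>Basis. ((snd z \<bullet> i) * (snd z \<bullet> j)) *\<^sub>R g \<kappa> (fst z) i j"] by simp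
  then obtain z where z: "z \<in> ?B" "\<And>y. y \<in> ?B \<Longrightarrow> g \<kappa> (fst z) (snd z) (snd z) \<le> g \<kappa> (fst y) (snd y) (snd y)"
    using continuous_attains_inf[OF B, of "\<lambda>z. g \<kappa> (fst z) (snd z) (snd z)"] by blast
  define m where "m = g \<kappa> (fst z) (snd z) (snd z)"
  show thesis
  proof (rule that[of m])
    have "snd z \<noteq> 0" "fst z \<in> coords \<kappa>" using z(1) S(3) by auto
    then show "0 < m" unfolding m_def using metric_pos[OF \<kappa>] by blast
    fix x c assume x: "x \<in> S"
    then have xc: "x \<in> coords \<kappa>" using S(3) by blast
    note Bx = metric_bilinear[OF \<kappa> xc]
    show "m * (norm c)\<^sup>2 \<le> g \<kappa> x c c"
    proof (cases "c = 0")
      case False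
      have "m \<le> g \<kappa> x (c /\<^sub>R norm c) (c /\<^sub>R norm c)"
        using z(2)[of "(x, c /\<^sub>R norm c)"] x False by (simp add: m_def)
      also have "\<dots> = g \<kappa> x c c / (norm c)\<^sup>2"
        by (simp add: bilinear_lmul[OF Bx] bilinear_rmul[OF Bx] power2_eq_square divide_simps)
      finally show ?thesis using False by (simp add: field_simps)
    qed (simp add: bilinear_lzero[OF Bx])
  qed
qed

text \<open>
  Along a line in the direction of the second derivative, the Lagrangian is a quadratic polynomial.
\<close>

lemma lagrangian_derivative_acceleration:
  assumes \<kappa>: "\<kappa> \<in> A" and x: "x \<in> coords \<kappa>"
  shows "frechet_derivative (lagrangian \<kappa>) (at (x, v, a)) (0, 0, c) = g \<kappa> x (a + christoffel g \<kappa> x v v) c"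
proof -
  note B = metric_bilinear[OF \<kappa> x]
  define w where "w = a + christoffel g \<kappa> x v v"
  define p where "p t = (x, v, a + t *\<^sub>R c)" for t :: real
  have D: "(lagrangian \<kappa> has_derivative frechet_derivative (lagrangian \<kappa>) (at (x, v, a))) (at (p 0))"
    unfolding p_def using smooth_on_has_derivative[OF lagrangian_smooth[OF \<kappa>] open_Times[OF open_coords[OF \<kappa>] open_UNIV], of "(x, v, a)"] x
    by simp
  have "(p has_derivative (\<lambda>h. (0, 0, h *\<^sub>R c))) (at 0)"
    unfolding p_def by (auto intro!: derivative_eq_intros)
  from has_derivative_compose[OF this D]
  have "((\<lambda>t. lagrangian \<kappa> (p t)) has_derivative (\<lambda>h. frechet_derivative (lagrangian \<kappa>) (at (x, v, a)) (0, 0, h *\<^sub>R c))) (at 0)" .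
  moreover have "frechet_derivative (lagrangian \<kappa>) (at (x, v, a)) (0, 0, h *\<^sub>R c)
      = h * frechet_derivative (lagrangian \<kappa>) (at (x, v, a)) (0, 0, c)" for h
    using linear_scale[OF has_derivative_linear[OF D], of h "(0, 0, c)"] by simp
  ultimately have 1: "((\<lambda>t. lagrangian \<kappa> (p t)) has_real_derivative frechet_derivative (lagrangian \<kappa>) (at (x, v, a)) (0, 0, c)) (at 0)"
    by (simp add: has_field_derivative_def mult_commute_abs)
  have eq: "lagrangian \<kappa> (p t) = (1/2 * g \<kappa> x w w + V (chart_inv \<kappa> x)) + t * g \<kappa> x w c + t\<^sup>2 * (1/2 * g \<kappa> x c c)" for t
  proof -
    have "a + t *\<^sub>R c + christoffel g \<kappa> x v v = w + t *\<^sub>R c" by (simp add: w_def)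
    then have "lagrangian \<kappa> (p t) = 1/2 * g \<kappa> x (w + t *\<^sub>R c) (w + t *\<^sub>R c) + V (chart_inv \<kappa> x)"
      unfolding lagrangian_def p_def prod.case by (simp only:)
    then show ?thesis
      using metric_sym[OF \<kappa> x, of c w]
      by (simp add: bilinear_ladd[OF B] bilinear_radd[OF B] bilinear_lmul[OF B] bilinear_rmul[OF B] power2_eq_square field_simps)
  qed
  have "((\<lambda>t. (1/2 * g \<kappa> x w w + V (chart_inv \<kappa> x)) + t * g \<kappa> x w c + t\<^sup>2 * (1/2 * g \<kappa> x c c))
     has_real_derivative g \<kappa> x w c) (at 0)"
    by (auto intro!: derivative_eq_intros)
  then have "((\<lambda>t. lagrangian \<kappa> (p t)) has_real_derivative g \<kappa> x w c) (at 0)"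
    by (simp only: eq)
  with 1 show ?thesis unfolding w_def by (rule DERIV_unique)
qed

text \<open>
  The derivative in the direction of the second derivative is affine, with the metric as its linear
  part. So monotonicity is coercivity of the metric.
\<close>

lemma lagrangian_elliptic:
  assumes \<kappa>: "\<kappa> \<in> A" and r: "0 < r" "cball x0 r \<subseteq> coords \<kappa>"
  obtains C m where "elliptic_lagrangian (lagrangian \<kappa>) (coords \<kappa> \<times> UNIV) x0 r R C m"
proof -
  let ?K = "cball x0 r \<times> cball (0::'e) (R + 1) \<times> cball (0::'e) (R + 1)"
  have op: "open (coords \<kappa> \<times> (UNIV :: ('e \<times> 'e) set))" using open_coords[OF \<kappa>] by (intro open_Times) auto
  have K: "compact ?K" "convex ?K" "?K \<subseteq> coords \<kappa> \<times> UNIV"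
    using r by (auto intro!: compact_Times convex_Times)
  obtain C where C: "0 \<le> C" "\<And>x y v. x \<in> ?K \<Longrightarrow> y \<in> ?K \<Longrightarrow>
    \<bar>frechet_derivative (lagrangian \<kappa>) (at x) v - frechet_derivative (lagrangian \<kappa>) (at y) v\<bar> \<le> C * norm (x - y) * norm v"
    using smooth_on_derivative_lipschitz[OF lagrangian_smooth[OF \<kappa>] op K] by metis
  obtain m where m: "0 < m" "\<And>x c. x \<in> cball x0 r \<Longrightarrow> m * (norm c)\<^sup>2 \<le> g \<kappa> x c c"
    using metric_coercive[OF \<kappa> compact_cball _ r(2)] r(1) by (metis cball_eq_empty not_less_iff_gr_or_eq)
  show thesis
  proof (rule that[of C m], unfold_locales)
    fix x v a b :: 'e assume x: "x \<in> cball x0 r"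
    then have xc: "x \<in> coords \<kappa>" using r(2) by blast
    have "frechet_derivative (lagrangian \<kappa>) (at (x, v, a)) (0, 0, a - b) - frechet_derivative (lagrangian \<kappa>) (at (x, v, b)) (0, 0, a - b)
      = g \<kappa> x (a - b) (a - b)"
      unfolding lagrangian_derivative_acceleration[OF \<kappa> xc]
      by (simp add: bilinear_lsub[OF metric_bilinear[OF \<kappa> xc], symmetric])
    then show "m * (norm (a - b))\<^sup>2 \<le> frechet_derivative (lagrangian \<kappa>) (at (x, v, a)) (0, 0, a - b)
         - frechet_derivative (lagrangian \<kappa>) (at (x, v, b)) (0, 0, a - b)" using m(2)[OF x] by simp
  qed (use lagrangian_smooth[OF \<kappa>] op r K C m(1) in \<open>simp_all\<close>)
qed

end

section \<open>Curves in a tube\<close>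

context smooth_manifold
begin

abbreviation lift :: "real \<Rightarrow> real \<Rightarrow> (real \<Rightarrow> 'q) \<Rightarrow> real \<Rightarrow> 'q \<times> ('q, 'e) tvec" where
  "lift a b \<equiv> tangent_lift A {a..b}"

text \<open>
  The local part of being a member of a \<open>C\<^sup>1\<close> neighborhood, which is inherited by subintervals and by joined curves.
\<close>

definition tube_path :: "(real \<times> 'q \<times> ('q, 'e) tvec) set \<Rightarrow> real \<Rightarrow> real \<Rightarrow> (real \<Rightarrow> 'q) \<Rightarrow> bool" where
  "tube_path W a b \<gamma> \<longleftrightarrow> piecewise_smooth a b \<gamma> \<and> ck_curve A 1 {a..b} \<gamma> \<and>
     (\<forall>t\<in>{a..b}. (t, lift a b \<gamma> t) \<in> W)"

lemma lift_restrict: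
  fixes a b c d :: real
  assumes "ck_curve A 1 {a..b} \<gamma>" "a \<le> c" "c < d" "d \<le> b" "t \<in> {c..d}"
  shows "lift c d \<gamma> t = lift a b \<gamma> t"
  using velocity_restrict[OF assms] by (simp add: tangent_lift_def)

lemma lift_eqD:
  "lift a b \<gamma> t = lift c d \<gamma>' s \<Longrightarrow> \<gamma> t = \<gamma>' s \<and> vel a b \<gamma> t = vel c d \<gamma>' s"
  by (simp add: tangent_lift_def)

lemma tube_path_restrict:
  assumes "tube_path W a b \<gamma>" "a \<le> c" "c < d" "d \<le> b"
  shows "tube_path W c d \<gamma>"
  using assms piecewise_smooth_restrict[of a b \<gamma> c d] ck_curve_restrict[of 1 a b \<gamma> c d]
    lift_restrict[of a b \<gamma> c d]
  by (auto simp: tube_path_def)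

lemma tube_path_cong:
  assumes "\<And>t. t \<in> {a..b} \<Longrightarrow> \<gamma> t = \<gamma>' t" "tube_path W a b \<gamma>"
  shows "tube_path W a b \<gamma>'"
  using assms piecewise_smooth_cong[of a b \<gamma> \<gamma>'] ck_curve_cong[of "{a..b}" \<gamma> \<gamma>'] tangent_lift_cong[of _ a b \<gamma> \<gamma>']
  by (auto simp: tube_path_def)

lemma tube_path_join:
  assumes "a < c" "c < b" and l: "tube_path W a c \<gamma>" and r: "tube_path W c b \<gamma>"
    and eq: "vel a c \<gamma> c = vel c b \<gamma> c"
  shows "tube_path W a b \<gamma>"
proof -
  have c1: "ck_curve A 1 {a..b} \<gamma>"
    using l r by (intro c1_curve_join[OF assms(1,2) _ _ eq]) (auto simp: tube_path_def)
  moreover have "(t, lift a b \<gamma> t) \<in> W" if t: "t \<in> {a..b}" for t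
  proof (cases "t \<le> c")
    case True
    then have "(t, lift a c \<gamma> t) \<in> W" using l t by (auto simp: tube_path_def)
    then show ?thesis using lift_restrict[OF c1, of a c t] True t assms(1,2) by simp
  next
    case False
    then have "(t, lift c b \<gamma> t) \<in> W" using r t by (auto simp: tube_path_def)
    then show ?thesis using lift_restrict[OF c1, of c b t] False t assms(1,2) by simp
  qed
  ultimately show ?thesis
    using l r piecewise_smooth_join[of a c \<gamma> b] assms(1,2) by (auto simp: tube_path_def)
qed

lemma tube_path_C1: "tube_path W a b \<gamma> \<Longrightarrow> ck_curve A 1 {a..b} \<gamma>"
  by (simp add: tube_path_def)

lemma tube_path_piecewise: "tube_path W a b \<gamma> \<Longrightarrow> piecewise_smooth a b \<gamma>"
  by (simp add: tube_path_def)

lemma tube_path_concat: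
  assumes "a < c" "c < b" and l: "tube_path W a c \<alpha>" and r: "tube_path W c b \<beta>"
    and eq: "lift a c \<alpha> c = lift c b \<beta> c"
  defines "\<gamma> \<equiv> \<lambda>t. if t \<le> c then \<alpha> t else \<beta> t"
  shows "tube_path W a b \<gamma>"
    and "\<And>t. t \<in> {a..c} \<Longrightarrow> \<gamma> t = \<alpha> t" and "\<And>t. t \<in> {c..b} \<Longrightarrow> \<gamma> t = \<beta> t"
    and "lift a b \<gamma> a = lift a c \<alpha> a" and "lift a b \<gamma> b = lift c b \<beta> b"
proof -
  have c: "\<alpha> c = \<beta> c" "vel a c \<alpha> c = vel c b \<beta> c" using lift_eqD[OF eq] by auto
  show \<alpha>: "\<And>t. t \<in> {a..c} \<Longrightarrow> \<gamma> t = \<alpha> t" and \<beta>: "\<And>t. t \<in> {c..b} \<Longrightarrow> \<gamma> t = \<beta> t"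
    using c by (auto simp: \<gamma>_def)
  have l': "tube_path W a c \<gamma>" by (rule tube_path_cong[OF \<alpha>[symmetric] l])
  have r': "tube_path W c b \<gamma>" by (rule tube_path_cong[OF \<beta>[symmetric] r])
  have v: "vel a c \<gamma> c = vel c b \<gamma> c"
    using velocity_cong[of c a c \<gamma> \<alpha>] velocity_cong[of c c b \<gamma> \<beta>] \<alpha> \<beta> c assms(1,2) by simp
  show tp: "tube_path W a b \<gamma>" by (rule tube_path_join[OF assms(1,2) l' r' v])
  show "lift a b \<gamma> a = lift a c \<alpha> a"
    using lift_restrict[OF tube_path_C1[OF tp], of a c a] tangent_lift_cong[of a a c \<gamma> \<alpha>] \<alpha> assms(1,2) by simp
  show "lift a b \<gamma> b = lift c b \<beta> b"
    using lift_restrict[OF tube_path_C1[OF tp], of c b b] tangent_lift_cong[of b c b \<gamma> \<beta>] \<beta> assms(1,2) by simp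
qed

text \<open>
  This unfolds the product topology and the topology of the tangent bundle to an ordinary open set of
  times, coordinates and coordinate velocities.
\<close>

lemma tube_open_in_chart:
  assumes W: "openin (prod_topology (top_of_set {0..T}) (tangent_topology A)) W"
    and \<kappa>: "\<kappa> \<in> A" and p: "p \<in> fst \<kappa>" "(t, p, v) \<in> W"
  obtains N where "open N" "(t, snd \<kappa> p, v \<kappa>) \<in> N"
    "\<And>t' x w. \<lbrakk>(t', x, w \<kappa>) \<in> N; t' \<in> {0..T}; x \<in> coords \<kappa>; w \<in> tangent_space A (chart_inv \<kappa> x)\<rbrakk>
        \<Longrightarrow> (t', chart_inv \<kappa> x, w) \<in> W"
proof -
  obtain I O' where IO: "openin (top_of_set {0..T}) I" "openin (tangent_topology A) O'" "t \<in> I" "(p, v) \<in> O'" "I \<times> O' \<subseteq> W"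
    using W p(2) unfolding openin_prod_topology_alt by metis
  obtain J where J: "open J" "I = {0..T} \<inter> J" using IO(1) by (auto simp: openin_open)
  have O': "tangent_open A O'" using IO(2) by (simp add: openin_tangent_topology)
  then obtain M where M: "open M"
     "\<forall>(p, v)\<in>tangent_bundle A. p \<in> fst \<kappa> \<longrightarrow> ((p, v) \<in> O' \<longleftrightarrow> (snd \<kappa> p, v \<kappa>) \<in> M)"
    using \<kappa> unfolding tangent_open_def by blast
  have "(p, v) \<in> tangent_bundle A" using O' IO(4) unfolding tangent_open_def by blast
  show thesis
  proof (rule that[of "J \<times> M"])
    show "open (J \<times> M)" using J M by (simp add: open_Times)
    show "(t, snd \<kappa> p, v \<kappa>) \<in> J \<times> M" using M(2) p \<open>(p, v) \<in> tangent_bundle A\<close> IO J by auto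
    fix t' x w assume *: "(t', x, w \<kappa>) \<in> J \<times> M" "t' \<in> {0..T}" "x \<in> coords \<kappa>" "w \<in> tangent_space A (chart_inv \<kappa> x)"
    then have "(chart_inv \<kappa> x, w) \<in> tangent_bundle A" by (simp add: tangent_bundle_def)
    then have "(chart_inv \<kappa> x, w) \<in> O'"
      using M(2) * chart_inv_in[OF \<kappa> *(3)] chart_chart_inv[OF \<kappa> *(3)] by auto
    then show "(t', chart_inv \<kappa> x, w) \<in> W" using IO(5) * J by auto
  qed
qed

text \<open>
  The graph of the coordinates and the coordinate velocity is compact and contained in an open set
  that describes the tube, so a whole neighborhood of fixed radius of the graph is.
\<close>

lemma tube_path_small_variation:
  fixes a b :: real
  assumes W: "openin (prod_topology (top_of_set {0..T}) (tangent_topology A)) W"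
    and \<kappa>: "\<kappa> \<in> A" and ab: "a < b" "{a..b} \<subseteq> {0..T}"
    and \<gamma>: "tube_path W a b \<gamma>" "\<And>t. t \<in> {a..b} \<Longrightarrow> \<gamma> t \<in> fst \<kappa> \<and> snd \<kappa> (\<gamma> t) = fst (X t)"
    and X: "two_jet a b X" and H: "two_jet a b H"
  shows "\<exists>s0>0. \<forall>s. \<bar>s\<bar> < s0 \<longrightarrow> (\<forall>t\<in>{a..b}. fst (X t + s *\<^sub>R H t) \<in> coords \<kappa>) \<and>
     tube_path W a b (\<lambda>t. chart_inv \<kappa> (fst (X t + s *\<^sub>R H t)))"
proof -
  have X_in: "fst (X t) \<in> coords \<kappa>" if "t \<in> {a..b}" for t using \<gamma>(2)[OF that] by (metis imageI)
  have vel: "vel a b \<gamma> t \<kappa> = fst (snd (X t))" if t: "t \<in> {a..b}" for t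
    using velocity_cong[OF t, of \<gamma> "\<lambda>t. chart_inv \<kappa> (fst (X t))"] \<gamma>(2) chart_inv_chart[OF \<kappa>]
      velocity_chart_curve[OF \<kappa> ab(1) t X_in two_jetD(2)[OF X t]] by (metis (no_types, lifting))
  \<comment> \<open>Open sets of times, coordinates and coordinate velocities that belong to the tube.\<close>
  define good where "good N \<longleftrightarrow> open N \<and> (\<forall>t' x w. (t', x, w \<kappa>) \<in> N \<longrightarrow> t' \<in> {0..T} \<longrightarrow> x \<in> coords \<kappa> \<longrightarrow>
       w \<in> tangent_space A (chart_inv \<kappa> x) \<longrightarrow> (t', chart_inv \<kappa> x, w) \<in> W)" for N
  define G where "G = (\<Union>{N. good N}) \<inter> (UNIV \<times> coords \<kappa> \<times> UNIV)"
  have "open G" unfolding G_def good_def using open_coords[OF \<kappa>] by (intro open_Int open_Union open_Times) auto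
  have G: "(t', chart_inv \<kappa> x, w) \<in> W" if "(t', x, w \<kappa>) \<in> G" "t' \<in> {0..T}" "x \<in> coords \<kappa>"
       "w \<in> tangent_space A (chart_inv \<kappa> x)" for t' x w
    using that unfolding G_def good_def by blast
  define Gr where "Gr = (\<lambda>t. (t, one_jet X t)) ` {a..b}"
  have "compact Gr" unfolding Gr_def using two_jet_continuous[OF X]
    by (intro compact_continuous_image continuous_on_Pair continuous_on_id continuous_on_fst continuous_on_snd) auto
  have "Gr \<subseteq> G"
  proof
    fix z assume "z \<in> Gr"
    then obtain t where t: "t \<in> {a..b}" "z = (t, one_jet X t)" by (auto simp: Gr_def)
    have "(t, \<gamma> t, vel a b \<gamma> t) \<in> W" using \<gamma>(1) t(1) by (auto simp: tube_path_def tangent_lift_def)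
    then obtain N where N: "open N" "(t, snd \<kappa> (\<gamma> t), vel a b \<gamma> t \<kappa>) \<in> N"
      "\<And>t' x w. \<lbrakk>(t', x, w \<kappa>) \<in> N; t' \<in> {0..T}; x \<in> coords \<kappa>; w \<in> tangent_space A (chart_inv \<kappa> x)\<rbrakk>
        \<Longrightarrow> (t', chart_inv \<kappa> x, w) \<in> W"
      using tube_open_in_chart[OF W \<kappa>, of "\<gamma> t" t "vel a b \<gamma> t"] \<gamma>(2)[OF t(1)] by metis
    then have "good N" "z \<in> N" unfolding good_def using \<gamma>(2)[OF t(1)] vel[OF t(1)] t(2) by auto
    then show "z \<in> G" unfolding G_def using X_in[OF t(1)] t(2) by auto
  qed
  obtain e where e: "0 < e" "(\<Union>z\<in>Gr. ball z e) \<subseteq> G"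
    using compact_subset_open_imp_ball_epsilon_subset[OF \<open>compact Gr\<close> \<open>open G\<close> \<open>Gr \<subseteq> G\<close>] by blast
  obtain M where "\<And>w. w \<in> H ` {a..b} \<Longrightarrow> norm w \<le> M"
    using compact_imp_bounded[OF compact_continuous_image[OF two_jet_continuous[OF H] compact_Icc]]
    unfolding bounded_iff by blast
  then have M: "norm (H t) \<le> M" if "t \<in> {a..b}" for t using that by blast
  define s0 where "s0 = e / (2 * \<bar>M\<bar> + 1)"
  have "0 < s0" using e by (simp add: s0_def)
  have main: "(\<forall>t\<in>{a..b}. fst (X t + s *\<^sub>R H t) \<in> coords \<kappa>) \<and>
      tube_path W a b (\<lambda>t. chart_inv \<kappa> (fst (X t + s *\<^sub>R H t)))" if s: "\<bar>s\<bar> < s0" for s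
  proof -
    let ?X = "\<lambda>t. X t + s *\<^sub>R H t"
    have inG: "(t, one_jet ?X t) \<in> G" if t: "t \<in> {a..b}" for t
    proof -
      have hM: "norm (fst (H t)) \<le> M" "norm (fst (snd (H t))) \<le> M"
        using M[OF t] by (metis norm_fst_le norm_snd_le order_trans prod.collapse)+
      have "dist (t, one_jet X t) (t, one_jet ?X t) = norm (s *\<^sub>R fst (H t), s *\<^sub>R fst (snd (H t)))"
        by (simp add: dist_norm norm_Pair)
      also have "\<dots> \<le> norm (s *\<^sub>R fst (H t)) + norm (s *\<^sub>R fst (snd (H t)))" by (rule norm_Pair_le)
      also have "\<dots> \<le> \<bar>s\<bar> * (2 * \<bar>M\<bar>)"
        using mult_left_mono[OF hM(1), of "\<bar>s\<bar>"] mult_left_mono[OF hM(2), of "\<bar>s\<bar>"]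
          mult_left_mono[OF abs_ge_self[of M] abs_ge_zero[of s]] by simp
      also have "\<dots> \<le> \<bar>s\<bar> * (2 * \<bar>M\<bar> + 1)" by (intro mult_left_mono) auto
      also have "\<dots> < s0 * (2 * \<bar>M\<bar> + 1)" using s by (intro mult_strict_right_mono) auto
      also have "\<dots> = e" by (simp add: s0_def)
      finally have "(t, one_jet ?X t) \<in> ball (t, one_jet X t) e" by (simp only: mem_ball)
      moreover have "(t, one_jet X t) \<in> Gr" using t by (auto simp: Gr_def)
      ultimately show ?thesis using e(2) by blast
    qed
    note J = two_jet_add_scaleR[OF X H ab(1), of s]
    have co: "fst (?X t) \<in> coords \<kappa>" if "t \<in> {a..b}" for t using inG[OF that] unfolding G_def by blast
    let ?\<gamma> = "\<lambda>t. chart_inv \<kappa> (fst (?X t))"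
    have sc: "smooth_curve A {a..b} ?\<gamma>" by (rule chart_curve_smooth[OF \<kappa> ab(1) two_jetD(1)[OF J] co])
    have "(t, lift a b ?\<gamma> t) \<in> W" if t: "t \<in> {a..b}" for t
    proof -
      have "vel a b ?\<gamma> t \<kappa> = fst (snd (?X t))"
        by (rule velocity_chart_curve[OF \<kappa> ab(1) t co two_jetD(2)[OF J t]])
      moreover have "vel a b ?\<gamma> t \<in> tangent_space A (?\<gamma> t)"
        by (rule velocity_in_tangent_space[OF ab(1) smooth_curveD[OF sc] t])
      ultimately show ?thesis
        using G[of t "fst (?X t)" "vel a b ?\<gamma> t"] inG[OF t] co[OF t] ab(2) t by (auto simp: tangent_lift_def)
    qed
    then show ?thesis using co sc smooth_imp_piecewise_smooth smooth_curveD by (auto simp: tube_path_def)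
  qed
  show ?thesis using \<open>0 < s0\<close> main by blast
qed

end

context smooth_manifold
begin

lemma smooth_curve_in_chart:
  assumes "smooth_curve A I \<gamma>" "\<kappa> \<in> A" "\<And>t. t \<in> I \<Longrightarrow> \<gamma> t \<in> fst \<kappa>"
  shows "smooth_on I (snd \<kappa> \<circ> \<gamma>)"
proof -
  have "I \<inter> \<gamma> -` fst \<kappa> = I" using assms(3) by auto
  then show ?thesis using ck_curve_ck_on[OF smooth_curveD[OF assms(1)] assms(2)] by (simp add: smooth_on_def)
qed

text \<open>
  The break points other than \<open>\<sigma>\<close> are finite in number and keep a positive distance from \<open>\<sigma>\<close>.
\<close>

lemma piecewise_smooth_near:
  assumes "piecewise_smooth 0 T \<gamma>" "0 < \<sigma>" "\<sigma> < T"
  obtains e where "0 < e" "\<And>c. \<sigma> - e < c \<Longrightarrow> c < \<sigma> \<Longrightarrow> 0 < c \<and> smooth_curve A {c..\<sigma>} \<gamma>"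
    "\<And>d. \<sigma> < d \<Longrightarrow> d < \<sigma> + e \<Longrightarrow> d < T \<and> smooth_curve A {\<sigma>..d} \<gamma>"
proof -
  obtain P where P: "finite P"
    "\<And>c d. 0 \<le> c \<Longrightarrow> c < d \<Longrightarrow> d \<le> T \<Longrightarrow> {c<..<d} \<inter> P = {} \<Longrightarrow> smooth_curve A {c..d} \<gamma>"
    using assms(1) unfolding piecewise_smooth_def by blast
  obtain e where e: "0 < e" "\<And>x. x \<in> P \<Longrightarrow> x \<noteq> \<sigma> \<Longrightarrow> e \<le> dist \<sigma> x"
    using finite_set_avoid[OF P(1), of \<sigma>] by blast
  define e' where "e' = min e (min \<sigma> (T - \<sigma>))"
  show thesis
  proof (rule that[of e'])
    show "0 < e'" using e assms by (simp add: e'_def)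
    fix c assume c: "\<sigma> - e' < c" "c < \<sigma>"
    have "{c<..<\<sigma>} \<inter> P = {}" using e(2) c by (force simp: dist_real_def e'_def)
    then show "0 < c \<and> smooth_curve A {c..\<sigma>} \<gamma>" using P(2)[of c \<sigma>] c assms by (auto simp: e'_def)
  next
    fix d assume d: "\<sigma> < d" "d < \<sigma> + e'"
    have "{\<sigma><..<d} \<inter> P = {}" using e(2) d by (force simp: dist_real_def e'_def)
    then show "d < T \<and> smooth_curve A {\<sigma>..d} \<gamma>" using P(2)[of \<sigma> d] d assms by (auto simp: e'_def)
  qed
qed

lemma curve_in_open_near:
  fixes \<sigma> :: real
  assumes "continuous_on {a..b} \<gamma>" "open N" "\<gamma> \<sigma> \<in> N" "\<sigma> \<in> {a..b}"
  obtains e where "0 < e" "\<And>t. t \<in> {a..b} \<Longrightarrow> \<bar>t - \<sigma>\<bar> < e \<Longrightarrow> \<gamma> t \<in> N"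
proof -
  have "openin (top_of_set {a..b}) ({a..b} \<inter> \<gamma> -` N)"
    using continuous_openin_preimage_gen[OF assms(1,2)] .
  then obtain U where U: "open U" "{a..b} \<inter> \<gamma> -` N = {a..b} \<inter> U" by (auto simp: openin_open)
  have "\<sigma> \<in> {a..b} \<inter> \<gamma> -` N" using assms by simp
  then have "\<sigma> \<in> U" using U(2) by blast
  then obtain e where e: "0 < e" "ball \<sigma> e \<subseteq> U" using U(1) openE by blast
  show thesis
  proof (rule that[OF e(1)])
    fix t assume t: "t \<in> {a..b}" "\<bar>t - \<sigma>\<bar> < e"
    then have "t \<in> ball \<sigma> e" by (simp add: dist_real_def abs_minus_commute)
    then have "t \<in> {a..b} \<inter> \<gamma> -` N" using e(2) t(1) U(2) by blast
    then show "\<gamma> t \<in> N" by simp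
  qed
qed

text \<open>
  The coordinate vector in one chart determines a tangent vector.
\<close>

lemma lift_chart_eqI:
  fixes a b c d :: real
  assumes "a < b" "ck_curve A 1 {a..b} \<alpha>" "t \<in> {a..b}" "c < d" "ck_curve A 1 {c..d} \<beta>" "s \<in> {c..d}"
    and "\<kappa> \<in> A" "\<alpha> t \<in> fst \<kappa>" "\<alpha> t = \<beta> s" "vel a b \<alpha> t \<kappa> = vel c d \<beta> s \<kappa>"
  shows "lift a b \<alpha> t = lift c d \<beta> s"
proof -
  have "vel a b \<alpha> t = vel c d \<beta> s"
    by (rule tangent_space_eqI[where p = "\<alpha> t" and \<kappa> = \<kappa>])
      (use velocity_in_tangent_space[OF assms(1-3)] velocity_in_tangent_space[OF assms(4-6)] assms(7-10) in simp_all)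
  then show ?thesis using assms(9) by (simp add: tangent_lift_def)
qed

end

section \<open>Minimizers and their concatenations\<close>

text \<open>
  The \<open>C\<^sup>1\<close> neighborhood is represented by its tube \<open>W\<close>, because membership in a tube can be tested on
  each piece of a curve separately.
\<close>

locale minimization = variational_problem A g V
  for A :: "('q::topological_space, 'e::euclidean_space) chart set" and g V +
  fixes T :: real and W :: "(real \<times> 'q \<times> ('q, 'e) tvec) set" and \<xi> \<eta> :: "'q \<times> ('q, 'e) tvec"
  assumes T_pos: "0 < T"
    and W_open: "openin (prod_topology (top_of_set {0..T}) (tangent_topology A)) W"
begin

definition competitors :: "(real \<Rightarrow> 'q) set" where
  "competitors = {\<gamma>. tube_path W 0 T \<gamma> \<and> lift 0 T \<gamma> 0 = \<xi> \<and> lift 0 T \<gamma> T = \<eta>}"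

definition minimal :: "(real \<Rightarrow> 'q) \<Rightarrow> bool" where
  "minimal \<gamma> \<longleftrightarrow> \<gamma> \<in> competitors \<and> (\<forall>\<beta>\<in>competitors. act 0 T \<gamma> \<le> act 0 T \<beta>)"

lemma
  assumes "minimal \<gamma>"
  shows minimal_tube: "tube_path W 0 T \<gamma>" and minimal_C1: "ck_curve A 1 {0..T} \<gamma>"
    and minimal_piecewise: "piecewise_smooth 0 T \<gamma>"
    and minimal_start: "lift 0 T \<gamma> 0 = \<xi>" and minimal_end: "lift 0 T \<gamma> T = \<eta>"
    and minimal_le: "\<beta> \<in> competitors \<Longrightarrow> act 0 T \<gamma> \<le> act 0 T \<beta>"
  using assms by (auto simp: minimal_def competitors_def tube_path_def)

text \<open>
  A better curve on the subinterval could be inserted, since the tangent lifts match at its ends.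
\<close>

lemma minimal_segment:
  assumes min: "minimal \<gamma>" and cd: "0 < c" "c < d" "d < T" and \<beta>: "tube_path W c d \<beta>"
    "lift c d \<beta> c = lift c d \<gamma> c" "lift c d \<beta> d = lift c d \<gamma> d"
  shows "act c d \<gamma> \<le> act c d \<beta>"
proof -
  note tube = minimal_tube[OF min] and C1 = minimal_C1[OF min]
  define \<alpha> where "\<alpha> t = (if t \<le> c then \<gamma> t else \<beta> t)" for t
  define \<zeta> where "\<zeta> t = (if t \<le> d then \<alpha> t else \<gamma> t)" for t
  have t1: "tube_path W 0 c \<gamma>" "tube_path W d T \<gamma>" using tube_path_restrict[OF tube] cd by auto
  have e1: "lift 0 c \<gamma> c = lift c d \<beta> c"
    using lift_restrict[OF C1, of 0 c c] lift_restrict[OF C1, of c d c] \<beta>(2) cd by simp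
  note \<alpha> = tube_path_concat[OF cd(1,2) t1(1) \<beta>(1) e1, folded \<alpha>_def]
  have e2: "lift 0 d \<alpha> d = lift d T \<gamma> d"
    using \<alpha>(5) \<beta>(3) lift_restrict[OF C1, of c d d] lift_restrict[OF C1, of d T d] cd by simp
  have "0 < d" using cd by simp
  note \<zeta> = tube_path_concat[OF \<open>0 < d\<close> cd(3) \<alpha>(1) t1(2) e2, folded \<zeta>_def]
  have "\<zeta> \<in> competitors"
    using \<zeta>(1,4,5) \<alpha>(4) minimal_start[OF min] minimal_end[OF min]
      lift_restrict[OF C1, of 0 c 0] lift_restrict[OF C1, of d T T] cd
    by (simp add: competitors_def)
  then have "act 0 T \<gamma> \<le> act 0 T \<zeta>" by (rule minimal_le[OF min])
  also have "act 0 T \<zeta> = act 0 d \<zeta> + act d T \<zeta>"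
    using act_split[OF tube_path_piecewise[OF \<zeta>(1)], of d] cd by simp
  also have "act 0 d \<zeta> = act 0 d \<alpha>" using \<zeta>(2) by (intro act_cong) auto
  also have "act 0 d \<alpha> = act 0 c \<alpha> + act c d \<alpha>"
    using act_split[OF tube_path_piecewise[OF \<alpha>(1)], of c] cd by simp
  also have "act 0 c \<alpha> = act 0 c \<gamma>" using \<alpha>(2) by (intro act_cong) auto
  also have "act c d \<alpha> = act c d \<beta>" using \<alpha>(3) by (intro act_cong) auto
  also have "act d T \<zeta> = act d T \<gamma>" using \<zeta>(3) by (intro act_cong) auto
  also have "act 0 T \<gamma> = act 0 c \<gamma> + act c d \<gamma> + act d T \<gamma>"
    using act_split[OF minimal_piecewise[OF min], of d] cd
      act_split[OF piecewise_smooth_restrict[OF minimal_piecewise[OF min], of 0 d], of c] by simp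
  finally show ?thesis by simp
qed

text \<open>
  Together, the two possible concatenations consist of the same pieces as \<open>\<alpha>\<close> and \<open>\<beta>\<close>, so the sum of
  their actions is twice the minimum, and neither of them is below the minimum.
\<close>

lemma minimal_concat:
  assumes \<alpha>: "minimal \<alpha>" and \<beta>: "minimal \<beta>" and \<sigma>: "0 < \<sigma>" "\<sigma> < T"
    and eq: "lift 0 T \<alpha> \<sigma> = lift 0 T \<beta> \<sigma>"
  shows "minimal (\<lambda>t. if t \<le> \<sigma> then \<alpha> t else \<beta> t)"
proof -
  have glue: "(\<lambda>t. if t \<le> \<sigma> then \<alpha> t else \<beta> t) \<in> competitors \<and>
      act 0 T (\<lambda>t. if t \<le> \<sigma> then \<alpha> t else \<beta> t) = act 0 \<sigma> \<alpha> + act \<sigma> T \<beta>"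
    if \<alpha>: "minimal \<alpha>" and \<beta>: "minimal \<beta>" and eq: "lift 0 T \<alpha> \<sigma> = lift 0 T \<beta> \<sigma>" for \<alpha> \<beta>
  proof -
    define \<zeta> where "\<zeta> t = (if t \<le> \<sigma> then \<alpha> t else \<beta> t)" for t
    note rl = lift_restrict[OF minimal_C1[OF \<alpha>], of 0 \<sigma>] and rr = lift_restrict[OF minimal_C1[OF \<beta>], of \<sigma> T]
    have "tube_path W 0 \<sigma> \<alpha>" "tube_path W \<sigma> T \<beta>"
      using tube_path_restrict[OF minimal_tube[OF \<alpha>]] tube_path_restrict[OF minimal_tube[OF \<beta>]] \<sigma> by auto
    moreover have "lift 0 \<sigma> \<alpha> \<sigma> = lift \<sigma> T \<beta> \<sigma>" using rl[of \<sigma>] rr[of \<sigma>] eq \<sigma> by simp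
    ultimately have \<zeta>: "tube_path W 0 T \<zeta>" "\<And>t. t \<in> {0..\<sigma>} \<Longrightarrow> \<zeta> t = \<alpha> t" "\<And>t. t \<in> {\<sigma>..T} \<Longrightarrow> \<zeta> t = \<beta> t"
        "lift 0 T \<zeta> 0 = lift 0 \<sigma> \<alpha> 0" "lift 0 T \<zeta> T = lift \<sigma> T \<beta> T"
      using tube_path_concat[OF \<sigma>, of W \<alpha> \<beta>, folded \<zeta>_def] by auto
    have "\<zeta> \<in> competitors"
      using \<zeta>(1,4,5) rl[of 0] rr[of T] minimal_start[OF \<alpha>] minimal_end[OF \<beta>] \<sigma> by (simp add: competitors_def)
    moreover have "act 0 T \<zeta> = act 0 \<sigma> \<alpha> + act \<sigma> T \<beta>"
      using act_split[OF tube_path_piecewise[OF \<zeta>(1)], of \<sigma>] \<sigma> act_cong[OF \<zeta>(2)] act_cong[OF \<zeta>(3)] by simp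
    ultimately show ?thesis by (simp add: \<zeta>_def[abs_def])
  qed
  note 1 = glue[OF \<alpha> \<beta> eq] and 2 = glue[OF \<beta> \<alpha> eq[symmetric]]
  have "act 0 T \<alpha> = act 0 T \<beta>"
    using minimal_le[OF \<alpha>] minimal_le[OF \<beta>] \<alpha> \<beta> by (simp add: minimal_def order_antisym)
  moreover have "act 0 T \<alpha> = act 0 \<sigma> \<alpha> + act \<sigma> T \<alpha>" "act 0 T \<beta> = act 0 \<sigma> \<beta> + act \<sigma> T \<beta>"
    using act_split[OF minimal_piecewise[OF \<alpha>], of \<sigma>] act_split[OF minimal_piecewise[OF \<beta>], of \<sigma>] \<sigma> by auto
  ultimately have "act 0 T (\<lambda>t. if t \<le> \<sigma> then \<alpha> t else \<beta> t) \<le> act 0 T \<alpha>"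
    using 1 2 minimal_le[OF \<beta>] by force
  then show ?thesis
    using 1 minimal_le[OF \<alpha>] unfolding minimal_def by (blast intro: order_trans)
qed

text \<open>
  Variations of the coordinates that vanish to first order at the outer ends and match at \<open>\<sigma>\<close> define \<open>C\<^sup>1\<close>
  curves with the same boundary data, and small ones stay in the tube. So they do not decrease the
  action, which is the integral of the Lagrangian in the chart.
\<close>

lemma minimal_broken_minimal:
  assumes min: "minimal \<gamma>" and ord: "0 < c" "c < \<sigma>" "\<sigma> < d" "d < T" and \<kappa>: "\<kappa> \<in> A"
    and X: "\<And>t. t \<in> {c..\<sigma>} \<Longrightarrow> \<gamma> t \<in> fst \<kappa> \<and> snd \<kappa> (\<gamma> t) = fst (X t)" "two_jet c \<sigma> X"
    and Z: "\<And>t. t \<in> {\<sigma>..d} \<Longrightarrow> \<gamma> t \<in> fst \<kappa> \<and> snd \<kappa> (\<gamma> t) = fst (Z t)" "two_jet \<sigma> d Z"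
  shows "broken_minimal (lagrangian \<kappa>) \<sigma> c \<sigma> c X \<sigma> d d Z"
  unfolding broken_minimal_def
proof (intro allI impI, elim conjE)
  fix H G :: "real \<Rightarrow> 'e \<times> 'e \<times> 'e"
  assume H: "two_jet c \<sigma> H" and G: "two_jet \<sigma> d G"
    and bd: "one_jet H c = 0" "one_jet G d = 0" "one_jet H \<sigma> = one_jet G \<sigma>"
  note tube = minimal_tube[OF min] and C1 = minimal_C1[OF min]
  have tl: "tube_path W c \<sigma> \<gamma>" and tr: "tube_path W \<sigma> d \<gamma>" and tcd: "tube_path W c d \<gamma>"
    using tube_path_restrict[OF tube] ord by auto
  have m: "c \<in> {c..\<sigma>}" "\<sigma> \<in> {c..\<sigma>}" "\<sigma> \<in> {\<sigma>..d}" "d \<in> {\<sigma>..d}" using ord by auto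
  have piece: "fst (Y t) \<in> coords \<kappa>" "\<gamma> t = chart_inv \<kappa> (fst (Y t))" "vel a b \<gamma> t \<kappa> = fst (snd (Y t))"
    if ab: "a < b" and Y: "\<forall>t\<in>{a..b}. \<gamma> t \<in> fst \<kappa> \<and> snd \<kappa> (\<gamma> t) = fst (Y t)" "two_jet a b Y" and t: "t \<in> {a..b}"
    for a b t and Y :: "real \<Rightarrow> 'e \<times> 'e \<times> 'e"
  proof -
    have in_coords: "fst (Y t) \<in> coords \<kappa>" if "t \<in> {a..b}" for t using bspec[OF Y(1) that] by (metis imageI)
    have eq: "\<gamma> t = chart_inv \<kappa> (fst (Y t))" if "t \<in> {a..b}" for t
      using bspec[OF Y(1) that] chart_inv_chart[OF \<kappa>] by metis
    show "fst (Y t) \<in> coords \<kappa>" "\<gamma> t = chart_inv \<kappa> (fst (Y t))" using in_coords eq t by auto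
    show "vel a b \<gamma> t \<kappa> = fst (snd (Y t))"
      using velocity_cong[OF t, of \<gamma> "\<lambda>t. chart_inv \<kappa> (fst (Y t))"] eq
        velocity_chart_curve[OF \<kappa> ab t in_coords two_jetD(2)[OF Y(2) t]] by simp
  qed
  have "\<forall>t\<in>{c..\<sigma>}. \<gamma> t \<in> fst \<kappa> \<and> snd \<kappa> (\<gamma> t) = fst (X t)" "\<forall>t\<in>{\<sigma>..d}. \<gamma> t \<in> fst \<kappa> \<and> snd \<kappa> (\<gamma> t) = fst (Z t)"
    using X(1) Z(1) by blast+
  note l = piece[OF ord(2) this(1) X(2)] and r = piece[OF ord(3) this(2) Z(2)]
  have "vel c \<sigma> \<gamma> \<sigma> = vel \<sigma> d \<gamma> \<sigma>"
    using velocity_restrict[OF C1, of c \<sigma> \<sigma>] velocity_restrict[OF C1, of \<sigma> d \<sigma>] ord by simp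
  then have XZ: "one_jet X \<sigma> = one_jet Z \<sigma>" using l(3)[OF m(2)] r(3)[OF m(3)] X(1)[OF m(2)] Z(1)[OF m(3)] by simp
  have subl: "{c..\<sigma>} \<subseteq> {0..T}" and subr: "{\<sigma>..d} \<subseteq> {0..T}" using ord by auto
  obtain sl where sl: "0 < sl" "\<And>s. \<bar>s\<bar> < sl \<Longrightarrow> (\<forall>t\<in>{c..\<sigma>}. fst (X t + s *\<^sub>R H t) \<in> coords \<kappa>) \<and>
      tube_path W c \<sigma> (\<lambda>t. chart_inv \<kappa> (fst (X t + s *\<^sub>R H t)))"
    using tube_path_small_variation[OF W_open \<kappa> ord(2) subl tl X H] by blast
  obtain sr where sr: "0 < sr" "\<And>s. \<bar>s\<bar> < sr \<Longrightarrow> (\<forall>t\<in>{\<sigma>..d}. fst (Z t + s *\<^sub>R G t) \<in> coords \<kappa>) \<and>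
      tube_path W \<sigma> d (\<lambda>t. chart_inv \<kappa> (fst (Z t + s *\<^sub>R G t)))"
    using tube_path_small_variation[OF W_open \<kappa> ord(3) subr tr Z G] by blast
  have main: "integral {c..\<sigma>} (\<lambda>t. lagrangian \<kappa> (X t)) + integral {\<sigma>..d} (\<lambda>t. lagrangian \<kappa> (Z t)) \<le>
     integral {c..\<sigma>} (\<lambda>t. lagrangian \<kappa> (X t + s *\<^sub>R H t)) + integral {\<sigma>..d} (\<lambda>t. lagrangian \<kappa> (Z t + s *\<^sub>R G t))"
    if s: "\<bar>s\<bar> < sl" "\<bar>s\<bar> < sr" for s
  proof -
    let ?X = "\<lambda>t. X t + s *\<^sub>R H t" and ?Z = "\<lambda>t. Z t + s *\<^sub>R G t"
    let ?\<alpha> = "\<lambda>t. chart_inv \<kappa> (fst (?X t))" and ?\<beta> = "\<lambda>t. chart_inv \<kappa> (fst (?Z t))"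
    have \<alpha>: "\<And>t. t \<in> {c..\<sigma>} \<Longrightarrow> fst (?X t) \<in> coords \<kappa>" "tube_path W c \<sigma> ?\<alpha>" using sl(2)[OF s(1)] by auto
    have \<beta>: "\<And>t. t \<in> {\<sigma>..d} \<Longrightarrow> fst (?Z t) \<in> coords \<kappa>" "tube_path W \<sigma> d ?\<beta>" using sr(2)[OF s(2)] by auto
    note JX = two_jet_add_scaleR[OF X(2) H ord(2), of s] and JZ = two_jet_add_scaleR[OF Z(2) G ord(3), of s]
    have v\<alpha>: "vel c \<sigma> ?\<alpha> t \<kappa> = fst (snd (?X t))" if t: "t \<in> {c..\<sigma>}" for t
      by (rule velocity_chart_curve[OF \<kappa> ord(2) t \<alpha>(1) two_jetD(2)[OF JX t]])
    have v\<beta>: "vel \<sigma> d ?\<beta> t \<kappa> = fst (snd (?Z t))" if t: "t \<in> {\<sigma>..d}" for t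
      by (rule velocity_chart_curve[OF \<kappa> ord(3) t \<beta>(1) two_jetD(2)[OF JZ t]])
    have in\<alpha>: "?\<alpha> t \<in> fst \<kappa>" if "t \<in> {c..\<sigma>}" for t by (rule chart_inv_in[OF \<kappa> \<alpha>(1)[OF that]])
    have in\<beta>: "?\<beta> t \<in> fst \<kappa>" if "t \<in> {\<sigma>..d}" for t by (rule chart_inv_in[OF \<kappa> \<beta>(1)[OF that]])
    have e\<sigma>: "lift c \<sigma> ?\<alpha> \<sigma> = lift \<sigma> d ?\<beta> \<sigma>"
      by (rule lift_chart_eqI[OF ord(2) tube_path_C1[OF \<alpha>(2)] m(2) ord(3) tube_path_C1[OF \<beta>(2)] m(3) \<kappa> in\<alpha>[OF m(2)]])
        (use v\<alpha>[OF m(2)] v\<beta>[OF m(3)] XZ bd(3) in simp_all)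
    define \<zeta> where "\<zeta> t = (if t \<le> \<sigma> then ?\<alpha> t else ?\<beta> t)" for t
    note \<zeta> = tube_path_concat[OF ord(2,3) \<alpha>(2) \<beta>(2) e\<sigma>, folded \<zeta>_def]
    have ec: "lift c \<sigma> ?\<alpha> c = lift c \<sigma> \<gamma> c"
      by (rule lift_chart_eqI[OF ord(2) tube_path_C1[OF \<alpha>(2)] m(1) ord(2) tube_path_C1[OF tl] m(1) \<kappa> in\<alpha>[OF m(1)]])
        (use v\<alpha>[OF m(1)] l(2,3)[OF m(1)] bd(1) in \<open>simp_all add: zero_prod_def\<close>)
    have ed: "lift \<sigma> d ?\<beta> d = lift \<sigma> d \<gamma> d"
      by (rule lift_chart_eqI[OF ord(3) tube_path_C1[OF \<beta>(2)] m(4) ord(3) tube_path_C1[OF tr] m(4) \<kappa> in\<beta>[OF m(4)]])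
        (use v\<beta>[OF m(4)] r(2,3)[OF m(4)] bd(2) in \<open>simp_all add: zero_prod_def\<close>)
    have "lift c d \<zeta> c = lift c d \<gamma> c" "lift c d \<zeta> d = lift c d \<gamma> d"
      using \<zeta>(4,5) ec ed lift_restrict[OF tube_path_C1[OF tcd], of c \<sigma> c] lift_restrict[OF tube_path_C1[OF tcd], of \<sigma> d d] ord
      by simp_all
    then have "act c d \<gamma> \<le> act c d \<zeta>" using ord by (intro minimal_segment[OF min _ _ _ \<zeta>(1)]) auto
    also have "act c d \<zeta> = act c \<sigma> \<zeta> + act \<sigma> d \<zeta>"
      using act_split[OF tube_path_piecewise[OF \<zeta>(1)], of \<sigma>] ord by simp
    also have "act c \<sigma> \<zeta> = integral {c..\<sigma>} (\<lambda>t. lagrangian \<kappa> (?X t))"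
      using act_cong[of c \<sigma> \<zeta> ?\<alpha>] \<zeta>(2) act_chart_curve[OF \<kappa> ord(2) JX] \<alpha>(1) by simp
    also have "act \<sigma> d \<zeta> = integral {\<sigma>..d} (\<lambda>t. lagrangian \<kappa> (?Z t))"
      using act_cong[of \<sigma> d \<zeta> ?\<beta>] \<zeta>(3) act_chart_curve[OF \<kappa> ord(3) JZ] \<beta>(1) by simp
    also have "act c d \<gamma> = act c \<sigma> \<gamma> + act \<sigma> d \<gamma>"
      using act_split[OF tube_path_piecewise[OF tcd], of \<sigma>] ord by simp
    also have "act c \<sigma> \<gamma> = integral {c..\<sigma>} (\<lambda>t. lagrangian \<kappa> (X t))"
      using act_cong[of c \<sigma> \<gamma> "\<lambda>t. chart_inv \<kappa> (fst (X t))"] act_chart_curve[OF \<kappa> ord(2) X(2)] l(1,2) by simp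
    also have "act \<sigma> d \<gamma> = integral {\<sigma>..d} (\<lambda>t. lagrangian \<kappa> (Z t))"
      using act_cong[of \<sigma> d \<gamma> "\<lambda>t. chart_inv \<kappa> (fst (Z t))"] act_chart_curve[OF \<kappa> ord(3) Z(2)] r(1,2) by simp
    finally show ?thesis .
  qed
  show "\<exists>s0>0. \<forall>s. \<bar>s\<bar> < s0 \<longrightarrow>
     integral {c..\<sigma>} (\<lambda>t. lagrangian \<kappa> (X t)) + integral {\<sigma>..d} (\<lambda>t. lagrangian \<kappa> (Z t)) \<le>
     integral {c..\<sigma>} (\<lambda>t. lagrangian \<kappa> (X t + s *\<^sub>R H t)) + integral {\<sigma>..d} (\<lambda>t. lagrangian \<kappa> (Z t + s *\<^sub>R G t))"
  proof (intro exI[of _ "min sl sr"] conjI allI impI)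
    show "0 < min sl sr" using sl(1) sr(1) by simp
  qed (rule main; simp)
qed

end

section \<open>Local and global coincidence of minimizers\<close>

context smooth_manifold
begin

lemma two_jet_of_curve:
  assumes "smooth_curve A {a..b} \<gamma>" "\<kappa> \<in> A" "\<And>t. t \<in> {a..b} \<Longrightarrow> \<gamma> t \<in> fst \<kappa>"
  obtains X M where "two_jet a b X" "\<And>t. fst (X t) = snd \<kappa> (\<gamma> t)" "\<And>t. t \<in> {a..b} \<Longrightarrow> norm (X t) \<le> M"
proof -
  obtain X where X: "two_jet a b X" "\<And>t. fst (X t) = (snd \<kappa> \<circ> \<gamma>) t"
    using two_jet_exists[OF smooth_curve_in_chart[OF assms]] by metis
  have "bounded (X ` {a..b})"
    using compact_imp_bounded[OF compact_continuous_image[OF two_jet_continuous[OF X(1)] compact_Icc]] .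
  then obtain M where "\<And>w. w \<in> X ` {a..b} \<Longrightarrow> norm w \<le> M" unfolding bounded_iff by blast
  then have "norm (X t) \<le> M" if "t \<in> {a..b}" for t using that by blast
  then show thesis by (rule that[OF X(1) X(2)[unfolded comp_def]])
qed

lemma velocity_in_chart_eqI:
  fixes a b c d :: real
  assumes "ck_curve A 1 {a..b} \<gamma>" "a \<le> c" "c < d" "d \<le> b" "t \<in> {c..d}" "\<kappa> \<in> A" "\<gamma> t \<in> fst \<kappa>"
    and "(snd \<kappa> \<circ> \<gamma> has_vector_derivative v) (at t within {c..d})"
  shows "vel a b \<gamma> t \<kappa> = v"
proof -
  have "vel c d \<gamma> t \<kappa> = v"
    using vector_derivative_eqI[OF assms(3,5,8)] assms(6,7) by (simp add: velocity_def)
  then show ?thesis using velocity_restrict[OF assms(1-5)] by simp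
qed

end

context minimization
begin

text \<open>
  Near \<open>\<sigma>\<close> neither curve has a break point other than \<open>\<sigma>\<close>, and both stay in one chart. To the left of \<open>\<sigma>\<close>,
  the curve \<open>p\<close> is compared with the minimizer that follows \<open>q\<close> up to \<open>\<sigma>\<close> and \<open>p\<close> afterwards; to the right
  with the minimizer that follows \<open>p\<close> up to \<open>\<sigma>\<close> and \<open>q\<close> afterwards.
\<close>

lemma local_coincidence:
  assumes p: "minimal p" and q: "minimal q" and \<sigma>: "0 < \<sigma>" "\<sigma> < T"
    and eq: "lift 0 T p \<sigma> = lift 0 T q \<sigma>"
  shows "\<exists>e>0. \<forall>t. \<bar>t - \<sigma>\<bar> < e \<longrightarrow> p t = q t"
proof -
  have eq': "p \<sigma> = q \<sigma>" "vel 0 T p \<sigma> = vel 0 T q \<sigma>" using lift_eqD[OF eq] by auto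
  obtain \<kappa> where \<kappa>: "\<kappa> \<in> A" "p \<sigma> \<in> fst \<kappa>" using chart_at by blast
  define x0 where "x0 = snd \<kappa> (p \<sigma>)"
  have "x0 \<in> coords \<kappa>" using \<kappa> by (simp add: x0_def)
  then obtain r where r: "0 < r" "cball x0 r \<subseteq> coords \<kappa>"
    using open_coords[OF \<kappa>(1)] open_contains_cball by metis
  define N where "N = fst \<kappa> \<inter> snd \<kappa> -` ball x0 (r / 2)"
  have N: "open N" unfolding N_def
    by (rule continuous_open_preimage[OF continuous_on_chart[OF \<kappa>(1)] open_chart[OF \<kappa>(1)] open_ball])
  have N\<sigma>: "p \<sigma> \<in> N" "q \<sigma> \<in> N" using \<kappa> r(1) eq'(1) by (auto simp: N_def x0_def)
  have \<sigma>T: "\<sigma> \<in> {0..T}" using \<sigma> by simp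
  obtain e1 where e1: "0 < e1" "\<And>t. t \<in> {0..T} \<Longrightarrow> \<bar>t - \<sigma>\<bar> < e1 \<Longrightarrow> p t \<in> N"
    using curve_in_open_near[OF piecewise_smooth_continuous[OF minimal_piecewise[OF p]] N N\<sigma>(1) \<sigma>T] by blast
  obtain e2 where e2: "0 < e2" "\<And>t. t \<in> {0..T} \<Longrightarrow> \<bar>t - \<sigma>\<bar> < e2 \<Longrightarrow> q t \<in> N"
    using curve_in_open_near[OF piecewise_smooth_continuous[OF minimal_piecewise[OF q]] N N\<sigma>(2) \<sigma>T] by blast
  obtain e3 where e3: "0 < e3" "\<And>c. \<sigma> - e3 < c \<Longrightarrow> c < \<sigma> \<Longrightarrow> 0 < c \<and> smooth_curve A {c..\<sigma>} p"
    "\<And>d. \<sigma> < d \<Longrightarrow> d < \<sigma> + e3 \<Longrightarrow> d < T \<and> smooth_curve A {\<sigma>..d} p"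
    using piecewise_smooth_near[OF minimal_piecewise[OF p] \<sigma>] by blast
  obtain e4 where e4: "0 < e4" "\<And>c. \<sigma> - e4 < c \<Longrightarrow> c < \<sigma> \<Longrightarrow> 0 < c \<and> smooth_curve A {c..\<sigma>} q"
    "\<And>d. \<sigma> < d \<Longrightarrow> d < \<sigma> + e4 \<Longrightarrow> d < T \<and> smooth_curve A {\<sigma>..d} q"
    using piecewise_smooth_near[OF minimal_piecewise[OF q] \<sigma>] by blast
  \<comment> \<open>Half of this distance is used, so that the closed interval [c0, d0] is inside all four neighborhoods.\<close>
  define e0 where "e0 = min (min e1 e2) (min e3 e4)"
  define c0 where "c0 = \<sigma> - e0 / 2"
  define d0 where "d0 = \<sigma> + e0 / 2"
  have e0: "0 < e0" using e1(1) e2(1) e3(1) e4(1) by (simp add: e0_def)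
  then have e0': "e0 / 2 < e1" "e0 / 2 < e2" "e0 / 2 < e3" "e0 / 2 < e4" by (auto simp: e0_def)
  have cd0: "0 < c0" "c0 < \<sigma>" "\<sigma> < d0" "d0 < T"
    using e3(2)[of c0] e3(3)[of d0] e0 e0' by (auto simp: c0_def d0_def)
  have sm: "smooth_curve A {c0..\<sigma>} p" "smooth_curve A {\<sigma>..d0} p" "smooth_curve A {c0..\<sigma>} q" "smooth_curve A {\<sigma>..d0} q"
    using e3(2)[of c0] e3(3)[of d0] e4(2)[of c0] e4(3)[of d0] e0 e0' by (auto simp: c0_def d0_def)
  have inN: "p t \<in> N" "q t \<in> N" if "t \<in> {c0..d0}" for t
    using e1(2)[of t] e2(2)[of t] that cd0 e0' by (auto simp: c0_def d0_def abs_le_iff)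
  have inl: "p t \<in> fst \<kappa>" "q t \<in> fst \<kappa>" if "t \<in> {c0..\<sigma>}" for t using inN[of t] that cd0 by (auto simp: N_def)
  have inr: "p t \<in> fst \<kappa>" "q t \<in> fst \<kappa>" if "t \<in> {\<sigma>..d0}" for t using inN[of t] that cd0 by (auto simp: N_def)
  obtain Xl M1 where Xl0: "two_jet c0 \<sigma> Xl" "\<And>t. fst (Xl t) = snd \<kappa> (p t)" "\<And>t. t \<in> {c0..\<sigma>} \<Longrightarrow> norm (Xl t) \<le> M1"
    using two_jet_of_curve[OF sm(1) \<kappa>(1) inl(1)] by blast
  obtain Xr M2 where Xr0: "two_jet \<sigma> d0 Xr" "\<And>t. fst (Xr t) = snd \<kappa> (p t)" "\<And>t. t \<in> {\<sigma>..d0} \<Longrightarrow> norm (Xr t) \<le> M2"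
    using two_jet_of_curve[OF sm(2) \<kappa>(1) inr(1)] by blast
  obtain Yl M3 where Yl0: "two_jet c0 \<sigma> Yl" "\<And>t. fst (Yl t) = snd \<kappa> (q t)" "\<And>t. t \<in> {c0..\<sigma>} \<Longrightarrow> norm (Yl t) \<le> M3"
    using two_jet_of_curve[OF sm(3) \<kappa>(1) inl(2)] by blast
  obtain Yr M4 where Yr0: "two_jet \<sigma> d0 Yr" "\<And>t. fst (Yr t) = snd \<kappa> (q t)" "\<And>t. t \<in> {\<sigma>..d0} \<Longrightarrow> norm (Yr t) \<le> M4"
    using two_jet_of_curve[OF sm(4) \<kappa>(1) inr(2)] by blast
  define R where "R = max (max M1 M2) (max M3 M4)"
  have R: "M1 \<le> R" "M2 \<le> R" "M3 \<le> R" "M4 \<le> R" by (auto simp: R_def)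
  obtain C m where ell: "elliptic_lagrangian (lagrangian \<kappa>) (coords \<kappa> \<times> UNIV) x0 r R C m"
    using lagrangian_elliptic[OF \<kappa>(1) r] by blast
  interpret ell: elliptic_lagrangian "lagrangian \<kappa>" "coords \<kappa> \<times> UNIV" x0 r R C m by (rule ell)
  \<comment> \<open>The constants C and m come from the jets on [c0, d0], so the interval may be shortened
    afterwards to the length required for rigidity.\<close>
  define \<delta> where "\<delta> = min 1 (m / (8 * C + 1))"
  have \<delta>: "0 < \<delta>" using ell.m_pos ell.C_nonneg by (simp add: \<delta>_def)
  have small: "l \<le> 1 \<and> 8 * C * l < m" if "l \<le> \<delta>" for l
  proof -
    have "8 * C * l \<le> 8 * C * (m / (8 * C + 1))"
      using that ell.C_nonneg by (intro mult_left_mono) (auto simp: \<delta>_def)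
    also have "\<dots> < m" using ell.C_nonneg ell.m_pos by (simp add: field_simps)
    finally show ?thesis using that by (auto simp: \<delta>_def)
  qed
  define c where "c = max c0 (\<sigma> - \<delta>)"
  define d where "d = min d0 (\<sigma> + \<delta>)"
  have ord: "0 < c" "c < \<sigma>" "\<sigma> < d" "d < T" and cd: "c0 \<le> c" "d \<le> d0" and len: "\<sigma> - c \<le> \<delta>" "d - \<sigma> \<le> \<delta>"
    using cd0 \<delta> by (auto simp: c_def d_def)
  have \<sigma>m: "\<sigma> \<in> {c..\<sigma>}" "\<sigma> \<in> {\<sigma>..d}" "c \<in> {c..\<sigma>}" "d \<in> {\<sigma>..d}" using ord by auto
  have K0I: "w \<in> ell.K0" if "fst w \<in> cball x0 (r / 2)" "norm w \<le> R" for w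
  proof -
    have "norm (fst (snd w)) \<le> norm w" "norm (snd (snd w)) \<le> norm w"
      by (metis norm_fst_le norm_snd_le order_trans prod.collapse)+
    then show ?thesis using that by (simp add: mem_Times_iff)
  qed
  have Xl: "two_jet c \<sigma> Xl" and Yl: "two_jet c \<sigma> Yl" and Xr: "two_jet \<sigma> d Xr" and Yr: "two_jet \<sigma> d Yr"
    using two_jet_restrict[OF Xl0(1) cd(1) ord(2)] two_jet_restrict[OF Yl0(1) cd(1) ord(2)]
      two_jet_restrict[OF Xr0(1) _ ord(3) cd(2)] two_jet_restrict[OF Yr0(1) _ ord(3) cd(2)] by auto
  have in_ball: "snd \<kappa> (p t) \<in> cball x0 (r / 2)" "snd \<kappa> (q t) \<in> cball x0 (r / 2)" if "t \<in> {c..d}" for t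
    using inN[of t] that cd by (auto simp: N_def)
  have lK: "Xl t \<in> ell.K0" "Yl t \<in> ell.K0" if "t \<in> {c..\<sigma>}" for t
    using in_ball[of t] Xl0(2,3)[of t] Yl0(2,3)[of t] R that cd ord by (auto intro!: K0I intro: order_trans simp del: mem_cball)
  have rK: "Xr t \<in> ell.K0" "Yr t \<in> ell.K0" if "t \<in> {\<sigma>..d}" for t
    using in_ball[of t] Xr0(2,3)[of t] Yr0(2,3)[of t] R that cd ord by (auto intro!: K0I intro: order_trans simp del: mem_cball)
  have dl: "(snd \<kappa> \<circ> p has_vector_derivative fst (snd (Xl \<sigma>))) (at \<sigma> within {c..\<sigma>})"
      "(snd \<kappa> \<circ> q has_vector_derivative fst (snd (Yl \<sigma>))) (at \<sigma> within {c..\<sigma>})"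
    using two_jetD(2)[OF Xl \<sigma>m(1)] two_jetD(2)[OF Yl \<sigma>m(1)] by (simp_all add: Xl0(2) Yl0(2) comp_def)
  have dr: "(snd \<kappa> \<circ> p has_vector_derivative fst (snd (Xr \<sigma>))) (at \<sigma> within {\<sigma>..d})"
      "(snd \<kappa> \<circ> q has_vector_derivative fst (snd (Yr \<sigma>))) (at \<sigma> within {\<sigma>..d})"
    using two_jetD(2)[OF Xr \<sigma>m(2)] two_jetD(2)[OF Yr \<sigma>m(2)] by (simp_all add: Xr0(2) Yr0(2) comp_def)
  have "vel 0 T p \<sigma> \<kappa> = fst (snd (Xl \<sigma>))"
    by (rule velocity_in_chart_eqI[OF minimal_C1[OF p] _ ord(2) _ \<sigma>m(1) \<kappa> dl(1)]) (use ord in simp_all)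
  moreover have "vel 0 T q \<sigma> \<kappa> = fst (snd (Yl \<sigma>))"
    by (rule velocity_in_chart_eqI[OF minimal_C1[OF q] _ ord(2) _ \<sigma>m(1) \<kappa>(1) _ dl(2)]) (use \<kappa> eq'(1) ord in simp_all)
  moreover have "vel 0 T p \<sigma> \<kappa> = fst (snd (Xr \<sigma>))"
    by (rule velocity_in_chart_eqI[OF minimal_C1[OF p] _ ord(3) _ \<sigma>m(2) \<kappa> dr(1)]) (use ord in simp_all)
  moreover have "vel 0 T q \<sigma> \<kappa> = fst (snd (Yr \<sigma>))"
    by (rule velocity_in_chart_eqI[OF minimal_C1[OF q] _ ord(3) _ \<sigma>m(2) \<kappa>(1) _ dr(2)]) (use \<kappa> eq'(1) ord in simp_all)
  ultimately have jets: "one_jet Xl \<sigma> = one_jet Yl \<sigma>" "one_jet Xr \<sigma> = one_jet Yr \<sigma>"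
    using eq' Xl0(2) Yl0(2) Xr0(2) Yr0(2) by auto
  have in\<kappa>: "p t \<in> fst \<kappa>" "q t \<in> fst \<kappa>" if "t \<in> {c..d}" for t using inN[of t] that cd by (auto simp: N_def)
  define qp where "qp t = (if t \<le> \<sigma> then q t else p t)" for t
  define pq where "pq t = (if t \<le> \<sigma> then p t else q t)" for t
  have qp: "minimal qp" using minimal_concat[OF q p \<sigma> eq[symmetric]] by (simp add: qp_def[abs_def])
  have pq: "minimal pq" using minimal_concat[OF p q \<sigma> eq] by (simp add: pq_def[abs_def])
  have rep: "\<And>t. t \<in> {c..\<sigma>} \<Longrightarrow> p t \<in> fst \<kappa> \<and> snd \<kappa> (p t) = fst (Xl t)"
    "\<And>t. t \<in> {\<sigma>..d} \<Longrightarrow> p t \<in> fst \<kappa> \<and> snd \<kappa> (p t) = fst (Xr t)"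
    "\<And>t. t \<in> {c..\<sigma>} \<Longrightarrow> qp t \<in> fst \<kappa> \<and> snd \<kappa> (qp t) = fst (Yl t)"
    "\<And>t. t \<in> {\<sigma>..d} \<Longrightarrow> qp t \<in> fst \<kappa> \<and> snd \<kappa> (qp t) = fst (Xr t)"
    "\<And>t. t \<in> {c..\<sigma>} \<Longrightarrow> pq t \<in> fst \<kappa> \<and> snd \<kappa> (pq t) = fst (Xl t)"
    "\<And>t. t \<in> {\<sigma>..d} \<Longrightarrow> pq t \<in> fst \<kappa> \<and> snd \<kappa> (pq t) = fst (Yr t)"
    using in\<kappa> ord eq'(1) Xl0(2) Yl0(2) Xr0(2) Yr0(2) by (auto simp: qp_def pq_def order_antisym)
  have mp: "broken_minimal (lagrangian \<kappa>) \<sigma> c \<sigma> c Xl \<sigma> d d Xr"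
    by (rule minimal_broken_minimal[OF p ord \<kappa>(1) rep(1) Xl rep(2) Xr])
  have mqp: "broken_minimal (lagrangian \<kappa>) \<sigma> c \<sigma> c Yl \<sigma> d d Xr"
    by (rule minimal_broken_minimal[OF qp ord \<kappa>(1) rep(3) Yl rep(4) Xr])
  have mpq: "broken_minimal (lagrangian \<kappa>) \<sigma> c \<sigma> c Xl \<sigma> d d Yr"
    by (rule minimal_broken_minimal[OF pq ord \<kappa>(1) rep(5) Xl rep(6) Yr])
  have left: "fst (Xl t) = fst (Yl t)" if t: "t \<in> {c..\<sigma>}" for t
    by (rule ell.endpoint_rigidity[OF ord(2) _ _ ord(3) Xl Yl Xr \<sigma>m(1) jets(1) \<sigma>m(3) _ lK rK(1) mp mqp t])
      (use small[OF len(1)] ord in auto)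
  have right: "fst (Xr t) = fst (Yr t)" if t: "t \<in> {\<sigma>..d}" for t
    by (rule ell.endpoint_rigidity[OF ord(3) _ _ ord(2) Xr Yr Xl \<sigma>m(2) jets(2) \<sigma>m(4) _ rK lK(1)
          broken_minimal_commute[OF mp] broken_minimal_commute[OF mpq] t])
      (use small[OF len(2)] ord in auto)
  have "p t = q t" if "t \<in> {c..d}" for t
  proof -
    have "snd \<kappa> (p t) = snd \<kappa> (q t)"
      using left[of t] right[of t] that Xl0(2)[of t] Yl0(2)[of t] Xr0(2)[of t] Yr0(2)[of t] by (cases "t \<le> \<sigma>") auto
    then show ?thesis
      using in\<kappa>[OF that] chart_inv_chart[OF \<kappa>(1), of "p t"] chart_inv_chart[OF \<kappa>(1), of "q t"] by metis
  qed
  note agree = this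
  show ?thesis
  proof (intro exI[of _ "min (\<sigma> - c) (d - \<sigma>)"] conjI allI impI)
    fix t assume "\<bar>t - \<sigma>\<bar> < min (\<sigma> - c) (d - \<sigma>)"
    then have "t \<in> {c..d}" by auto
    then show "p t = q t" by (rule agree)
  qed (use ord in simp)
qed

end

locale hausdorff_minimization = minimization A g V T W \<xi> \<eta>
  for A :: "('q::t2_space, 'e::euclidean_space) chart set" and g V T W \<xi> \<eta>
begin

text \<open>
  Positions have unique limits in a Hausdorff space. Once the positions at the limit time agree, the
  velocities can be compared in one chart, where they are continuous.
\<close>

lemma lift_eq_closed:
  assumes p: "minimal p" and q: "minimal q" and t: "t \<in> {0..T}" and lim: "t islimpt D" "D \<subseteq> {0..T}"
    and D: "\<And>s. s \<in> D \<Longrightarrow> lift 0 T p s = lift 0 T q s"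
  shows "lift 0 T p t = lift 0 T q t"
proof -
  have nb: "at t within D \<noteq> bot" using lim(1) by (simp add: trivial_limit_within)
  have evD: "\<forall>\<^sub>F s in at t within D. s \<in> D" by (auto simp: eventually_at_filter)
  have Deq: "p s = q s" "vel 0 T p s = vel 0 T q s" if "s \<in> D" for s using lift_eqD[OF D[OF that]] by auto
  have "(p \<longlongrightarrow> p t) (at t within D)" "(q \<longlongrightarrow> q t) (at t within D)"
    using ck_curve_continuous[OF minimal_C1[OF p]] ck_curve_continuous[OF minimal_C1[OF q]] t lim(2)
    by (auto simp: continuous_on_def intro: tendsto_within_subset)
  moreover have "\<forall>\<^sub>F s in at t within D. p s = q s" using evD by eventually_elim (rule Deq(1))
  ultimately have pt: "p t = q t"
    using tendsto_unique[OF nb] tendsto_cong by metis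
  obtain \<kappa> where \<kappa>: "\<kappa> \<in> A" "p t \<in> fst \<kappa>" using chart_at by blast
  have vel_lim: "((\<lambda>s. vel 0 T \<gamma> s \<kappa>) \<longlongrightarrow> vel 0 T \<gamma> t \<kappa>) (at t within D)"
    if \<gamma>: "minimal \<gamma>" "\<gamma> t \<in> fst \<kappa>" for \<gamma>
  proof -
    let ?S = "{0..T} \<inter> \<gamma> -` fst \<kappa>"
    have tS: "t \<in> ?S" using t \<gamma> by simp
    have "continuous_on ?S (\<lambda>s. vel 0 T \<gamma> s \<kappa>)"
      using velocity_ck_on[OF T_pos, of 0 \<gamma> \<kappa>] minimal_C1[OF \<gamma>(1)] \<kappa>(1) by simp
    then have "((\<lambda>s. vel 0 T \<gamma> s \<kappa>) \<longlongrightarrow> vel 0 T \<gamma> t \<kappa>) (at t within ?S)"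
      using tS by (simp add: continuous_on_def)
    then show ?thesis
      using at_within_relatively_open[OF openin_chart_preimage[OF \<kappa>(1) ck_curve_continuous[OF minimal_C1[OF \<gamma>(1)]]] tS]
        tendsto_within_subset[OF _ lim(2)] by metis
  qed
  have "\<forall>\<^sub>F s in at t within D. vel 0 T p s \<kappa> = vel 0 T q s \<kappa>"
    using evD by eventually_elim (simp add: Deq(2))
  from tendsto_cong[OF this] have "((\<lambda>s. vel 0 T p s \<kappa>) \<longlongrightarrow> vel 0 T q t \<kappa>) (at t within D)"
    using vel_lim[OF q] \<kappa>(2) pt by simp
  with vel_lim[OF p \<kappa>(2)] have "vel 0 T p t \<kappa> = vel 0 T q t \<kappa>"
    by (rule tendsto_unique[OF nb])
  then show ?thesis
    by (intro lift_chart_eqI[OF T_pos minimal_C1[OF p] t T_pos minimal_C1[OF q] t \<kappa> pt])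
qed

text \<open>
  The interior times at which the tangent lifts agree form a set that is open by local coincidence, closed
  in \<open>(0, T)\<close> by continuity, and nonempty. The end points are limits of interior times.
\<close>

lemma minimal_curves_coincide:
  assumes p: "minimal p" and q: "minimal q" and \<tau>: "\<tau> \<in> {0<..<T}"
    and eq: "lift 0 T p \<tau> = lift 0 T q \<tau>" and t: "t \<in> {0..T}"
  shows "p t = q t"
proof -
  define D where "D = {s \<in> {0<..<T}. lift 0 T p s = lift 0 T q s}"
  have op: "open D" unfolding open_dist
  proof
    fix \<sigma> assume "\<sigma> \<in> D"
    then have \<sigma>: "0 < \<sigma>" "\<sigma> < T" "lift 0 T p \<sigma> = lift 0 T q \<sigma>" by (auto simp: D_def)
    obtain e where e: "0 < e" "\<And>t. \<bar>t - \<sigma>\<bar> < e \<Longrightarrow> p t = q t"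
      using local_coincidence[OF p q \<sigma>] by blast
    define e' where "e' = min e (min \<sigma> (T - \<sigma>))"
    have "s \<in> D" if s: "dist s \<sigma> < e'" for s
    proof -
      have sT: "s \<in> {0<..<T}" using s by (auto simp: e'_def dist_real_def)
      define c where "c = (\<sigma> - e' + s) / 2"
      define d where "d = (s + (\<sigma> + e')) / 2"
      have cd: "0 \<le> c" "c < s" "s < d" "d \<le> T" "\<And>t. t \<in> {c..d} \<Longrightarrow> \<bar>t - \<sigma>\<bar> < e"
        using s unfolding c_def d_def e'_def dist_real_def by (auto simp: abs_less_iff min_def split: if_splits)
      have "lift c d p s = lift c d q s" using cd e(2) by (intro tangent_lift_cong) auto
      then have "lift 0 T p s = lift 0 T q s"
        using lift_restrict[OF minimal_C1[OF p], of c d s] lift_restrict[OF minimal_C1[OF q], of c d s] cd by simp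
      then show ?thesis using sT by (simp add: D_def)
    qed
    moreover have "0 < e'" using e(1) \<sigma> by (simp add: e'_def)
    ultimately show "\<exists>e>0. \<forall>y. dist y \<sigma> < e \<longrightarrow> y \<in> D" by blast
  qed
  have "D \<subseteq> {0<..<T}" by (auto simp: D_def)
  have DT: "D \<subseteq> {0..T}" by (auto simp: D_def)
  have Deq: "lift 0 T p s = lift 0 T q s" if "s \<in> D" for s using that by (simp add: D_def)
  have "openin (top_of_set {0<..<T}) D" using op \<open>D \<subseteq> {0<..<T}\<close> by (simp add: open_subset)
  moreover have "closedin (top_of_set {0<..<T}) D"
    unfolding closedin_limpt
  proof (intro conjI allI impI \<open>D \<subseteq> {0<..<T}\<close>)
    fix s assume "s islimpt D \<and> s \<in> {0<..<T}"
    then have s: "s islimpt D" "s \<in> {0<..<T}" "s \<in> {0..T}" by auto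
    have "lift 0 T p s = lift 0 T q s"
      by (rule lift_eq_closed[OF p q s(3,1) DT Deq])
    then show "s \<in> D" using s(2) by (simp add: D_def)
  qed
  moreover have "\<tau> \<in> D" using \<tau> eq by (simp add: D_def)
  ultimately have DT': "D = {0<..<T}"
    using connected_Ioo[of 0 T] unfolding connected_clopen by blast
  have "t islimpt closure {0<..<T}" using t T_pos by (simp add: islimpt_Icc)
  then have "t islimpt D" unfolding DT' limpt_of_closure .
  then have "lift 0 T p t = lift 0 T q t"
    by (rule lift_eq_closed[OF p q t _ DT Deq])
  then show ?thesis using lift_eqD by blast
qed

end

theorem proposition4:
  fixes A :: "('q::{t2_space, second_countable_topology}, 'e::euclidean_space) chart set"
    and g :: "('q, 'e) metric"
    and V :: "'q \<Rightarrow> real"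
    and T \<tau> :: real
    and \<xi> \<eta> :: "'q \<times> ('q, 'e) tvec"
    and q q\<^sub>0 :: "real \<Rightarrow> 'q"
    and B :: "(real \<Rightarrow> 'q) set"
  assumes "smooth_atlas A"
    and "connected (UNIV :: 'q set)"
    and "riemannian_metric A g"
    and "geodesically_complete A g"
    and "smooth_function A V"
    and "\<And>p. 0 \<le> V p"
    and "0 < T"
    and "\<xi> \<in> tangent_bundle A"
    and "\<eta> \<in> tangent_bundle A"
    and "local_minimizer A g V T \<xi> \<eta> q"
    and "c1_neighborhood A T \<xi> \<eta> q B"
    and "\<And>\<gamma>. \<gamma> \<in> B \<Longrightarrow> action A g V T q \<le> action A g V T \<gamma>"
    and "q\<^sub>0 \<in> B"
    and "action A g V T q\<^sub>0 = action A g V T q"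
    and "\<tau> \<in> {0<..<T}"
    and "tangent_lift A {0..T} q\<^sub>0 \<tau> = tangent_lift A {0..T} q \<tau>"
  shows "\<forall>t\<in>{0..T}. q\<^sub>0 t = q t"
proof -
  obtain W where W: "openin (prod_topology (top_of_set {0..T}) (tangent_topology A)) W"
    "\<forall>t\<in>{0..T}. (t, tangent_lift A {0..T} q t) \<in> W"
    "B = {\<gamma> \<in> admissible_curves A T \<xi> \<eta>. \<forall>t\<in>{0..T}. (t, tangent_lift A {0..T} \<gamma> t) \<in> W}"
    using assms(11) unfolding c1_neighborhood_def by blast
  interpret hausdorff_minimization A g V T W \<xi> \<eta>
    using assms(1,3,5,7) W(1) by unfold_locales
  have B: "B = competitors"
    unfolding W(3) competitors_def admissible_curves_def tube_path_def piecewise_smooth_curve_def piecewise_smooth_def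
    by blast
  have "q \<in> B" using assms(10) W(2,3) by (simp add: local_minimizer_def)
  then have "minimal q" "minimal q\<^sub>0"
    using assms(12,13,14) by (auto simp: minimal_def B[symmetric] action_eq_act)
  then show ?thesis using minimal_curves_coincide[OF _ _ assms(15,16)] by blast
qed

end
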